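(* Let $q$ be a $\pi_1(\Sigma)$-automorphic holomorphic $k$-differential on $\mathbb H^2$, $k\ge2$, and let $x_1,x_2,X_1,X_2\in\partial_\infty\mathbb H^2$ be pairwise distinct points. Then $$\operatorname{Rh}(x_1,x_2,X_1,X_2;\hat q)=r_k\int_{\mathbb H^2}\Bigl\langle q(z),\sum_{i,j\in\{1,2\}}(-1)^{i+j}\Bigl(\frac{(X_j-x_i)\,dz}{(z-x_i)(z-X_j)}\Bigr)^k\Bigr\rangle d\sigma(z),$$ where $r_k=\frac{(-1)^k2^{k-2}((k-1)!)^2}{(2k-2)!\,\pi}$.
   Context: $\Sigma$ is a closed oriented surface of genus $\ge2$, $\pi_1(\Sigma)$ acts on $\mathbb H^2$ as a cocompact Fuchsian group $\Gamma$, and automorphic means $\Gamma$-invariant. $\mathbb H^2$ has curvature $-1$, area form $d\sigma=i\,h\,dz\wedge d\bar z$, and $\langle f\,dz^k,g\,dz^k\rangle=f\bar g\,h^{-k}$. $\hat q$ is the function $u\mapsto q(u,\dots,u)$ on the unit tangent bundle of $\mathbb H^2$. Rhombus function. For a Hölder function $f$ on the unit tangent bundle of $\mathbb H^2$, points $x,y,X,Y\in\partial_\infty\mathbb H^2$ and Busemann functions $h_x,h_y,h_X,h_Y$, let $\gamma_{z,Z}$ be the unit speed geodesic from $z$ to $Z$. For $z\in\{x,y\}$, $Z\in\{X,Y\}$, $c\in\{z,Z\}$ choose $t^c_{z,Z}$ with $h_c(\gamma_{z,Z}(t^c_{z,Z}))=t$ (Busemann functions being normalized to tend to $+\infty$ at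 their centre). Then $$\operatorname{Rh}(x,y,X,Y;f)=\lim_{t\to\infty}\Bigl\{\int_{t^x_{x,X}}^{t^X_{x,X}}f(\dot\gamma_{x,X})ds-\int_{t^y_{y,X}}^{t^X_{y,X}}f(\dot\gamma_{y,X})ds-\int_{t^x_{x,Y}}^{t^Y_{x,Y}}f(\dot\gamma_{x,Y})ds+\int_{t^y_{y,Y}}^{t^Y_{y,Y}}f(\dot\gamma_{y,Y})ds\Bigr\}.$$ *)

theory Defs
  imports "HOL-Complex_Analysis.Complex_Analysis" "HOL-Algebra.Bij"
begin

text \<open>
  The hyperbolic plane is the Poincare disc, so that every ideal point is a complex number of
  modulus one. The Riemannian metric, of curvature \<open>-1\<close>, is
  \<open>4 |dz|^2 / (1 - |z|^2)^2 = 2 h |dz|^2\<close>; its area form is \<open>i h dz \<and> d(cnj z) = 2 h dx \<and> dy\<close>.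
\<close>

definition hyp_plane :: "complex set" where
  "hyp_plane = ball 0 1"

definition ideal_boundary :: "complex set" where
  "ideal_boundary = sphere 0 1"

definition hyp_h :: "complex \<Rightarrow> real" where
  "hyp_h z = 2 / (1 - (norm z)\<^sup>2)\<^sup>2"

definition hyp_area :: "complex measure" where
  "hyp_area = density (restrict_space lborel hyp_plane) (\<lambda>z. ennreal (2 * hyp_h z))"

definition hyp_dist :: "complex \<Rightarrow> complex \<Rightarrow> real" where
  "hyp_dist z w = arcosh (1 + 2 * (norm (z - w))\<^sup>2 / ((1 - (norm z)\<^sup>2) * (1 - (norm w)\<^sup>2)))"

definition geodesic_on :: "real set \<Rightarrow> (real \<Rightarrow> complex) \<Rightarrow> bool" where
  "geodesic_on I \<gamma> \<longleftrightarrow>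
     (\<forall>s\<in>I. \<gamma> s \<in> hyp_plane) \<and> (\<forall>s\<in>I. \<forall>t\<in>I. hyp_dist (\<gamma> s) (\<gamma> t) = \<bar>s - t\<bar>)"

definition geodesic_line :: "complex \<Rightarrow> complex \<Rightarrow> (real \<Rightarrow> complex) \<Rightarrow> bool" where
  "geodesic_line z Z \<gamma> \<longleftrightarrow>
     geodesic_on UNIV \<gamma> \<and> (\<gamma> \<longlongrightarrow> z) at_bot \<and> (\<gamma> \<longlongrightarrow> Z) at_top"

text \<open>Busemann functions are defined up to an additive constant; the sign is the one for which
  they tend to \<open>+\<infinity>\<close> along rays towards the centre.\<close>

definition busemann :: "complex \<Rightarrow> (complex \<Rightarrow> real) \<Rightarrow> bool" where
  "busemann c b \<longleftrightarrow>
     (\<exists>\<rho> a. geodesic_on {0..} \<rho> \<and> (\<rho> \<longlongrightarrow> c) at_top \<and>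
        (\<forall>z\<in>hyp_plane. ((\<lambda>s. s - hyp_dist z (\<rho> s) + a) \<longlongrightarrow> b z) at_top))"

text \<open>Orientation-preserving isometries of the disc are its holomorphic bijections. They are
  represented by functions that are \<open>undefined\<close> off the disc, so that composition makes them a
  subgroup of \<open>BijGroup hyp_plane\<close>.\<close>

definition hyp_automorphisms :: "(complex \<Rightarrow> complex) set" where
  "hyp_automorphisms = {g \<in> Bij hyp_plane. g holomorphic_on hyp_plane}"

definition fuchsian_group :: "(complex \<Rightarrow> complex) set \<Rightarrow> bool" where
  "fuchsian_group \<Gamma> \<longleftrightarrow>
     subgroup \<Gamma> (BijGroup hyp_plane) \<and> \<Gamma> \<subseteq> hyp_automorphisms \<and>
     (\<forall>K. compact K \<and> K \<subseteq> hyp_plane \<longrightarrow> finite {g \<in> \<Gamma>. g ` K \<inter> K \<noteq> {}})"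

definition cocompact_group :: "(complex \<Rightarrow> complex) set \<Rightarrow> bool" where
  "cocompact_group \<Gamma> \<longleftrightarrow>
     (\<exists>K. compact K \<and> K \<subseteq> hyp_plane \<and> (\<Union>g\<in>\<Gamma>. g ` K) = hyp_plane)"

text \<open>The cocompact Fuchsian groups isomorphic to the fundamental group of a closed oriented
  surface of genus at least two are those that act freely: the surface is the quotient of the
  disc, and its genus is at least two by Gauss-Bonnet.\<close>

definition surface_fuchsian_group :: "(complex \<Rightarrow> complex) set \<Rightarrow> bool" where
  "surface_fuchsian_group \<Gamma> \<longleftrightarrow>
     fuchsian_group \<Gamma> \<and> cocompact_group \<Gamma> \<and>
     (\<forall>g\<in>\<Gamma>. (\<exists>z\<in>hyp_plane. g z = z) \<longrightarrow> g = \<one>\<^bsub>BijGroup hyp_plane\<^esub>)"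

text \<open>A \<open>k\<close>-differential \<open>q dz^k\<close> is represented by its coefficient function \<open>q\<close>.\<close>

definition automorphic_differential ::
  "(complex \<Rightarrow> complex) set \<Rightarrow> nat \<Rightarrow> (complex \<Rightarrow> complex) \<Rightarrow> bool" where
  "automorphic_differential \<Gamma> k q \<longleftrightarrow>
     q holomorphic_on hyp_plane \<and>
     (\<forall>g\<in>\<Gamma>. \<forall>z\<in>hyp_plane. q (g z) * deriv g z ^ k = q z)"

definition diff_inner :: "nat \<Rightarrow> complex \<Rightarrow> complex \<Rightarrow> complex \<Rightarrow> complex" where
  "diff_inner k z f g = f * cnj g / of_real (hyp_h z ^ k)"

text \<open>A tangent vector \<open>v\<close> at \<open>z\<close> is the pair \<open>(z, v)\<close>; functions on the unit tangent bundle
  are only ever evaluated at velocities of unit speed geodesics.\<close>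

definition diff_hat :: "nat \<Rightarrow> (complex \<Rightarrow> complex) \<Rightarrow> complex \<times> complex \<Rightarrow> complex" where
  "diff_hat k q = (\<lambda>(z, v). q z * v ^ k)"

definition velocity :: "(real \<Rightarrow> complex) \<Rightarrow> real \<Rightarrow> complex \<times> complex" where
  "velocity \<gamma> s = (\<gamma> s, vector_derivative \<gamma> (at s))"

text \<open>The choices in the definition of the rhombus function: Busemann functions \<open>b c\<close>,
  geodesics \<open>\<gamma> z Z\<close>, and times \<open>\<tau> c z Z t\<close> at which \<open>\<gamma> z Z\<close> meets level \<open>t\<close> of \<open>b c\<close>.\<close>

definition rhombus_choice ::
  "complex \<Rightarrow> complex \<Rightarrow> complex \<Rightarrow> complex \<Rightarrow> (complex \<Rightarrow> complex \<Rightarrow> real) \<Rightarrow>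
   (complex \<Rightarrow> complex \<Rightarrow> real \<Rightarrow> complex) \<Rightarrow> (complex \<Rightarrow> complex \<Rightarrow> complex \<Rightarrow> real \<Rightarrow> real) \<Rightarrow> bool"
where
  "rhombus_choice x y X Y b \<gamma> \<tau> \<longleftrightarrow>
     (\<forall>c\<in>{x, y, X, Y}. busemann c (b c)) \<and>
     (\<forall>z\<in>{x, y}. \<forall>Z\<in>{X, Y}.
        geodesic_line z Z (\<gamma> z Z) \<and> (\<forall>c\<in>{z, Z}. \<forall>t. b c (\<gamma> z Z (\<tau> c z Z t)) = t))"

definition truncated_rhombus ::
  "complex \<Rightarrow> complex \<Rightarrow> complex \<Rightarrow> complex \<Rightarrow> (complex \<times> complex \<Rightarrow> complex) \<Rightarrow>
   (complex \<Rightarrow> complex \<Rightarrow> real \<Rightarrow> complex) \<Rightarrow> (complex \<Rightarrow> complex \<Rightarrow> complex \<Rightarrow> real \<Rightarrow> real) \<Rightarrow>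
   real \<Rightarrow> complex"
where
  "truncated_rhombus x y X Y f \<gamma> \<tau> t =
     (LBINT s=ereal (\<tau> x x X t)..ereal (\<tau> X x X t). f (velocity (\<gamma> x X) s)) -
     (LBINT s=ereal (\<tau> y y X t)..ereal (\<tau> X y X t). f (velocity (\<gamma> y X) s)) -
     (LBINT s=ereal (\<tau> x x Y t)..ereal (\<tau> Y x Y t). f (velocity (\<gamma> x Y) s)) +
     (LBINT s=ereal (\<tau> y y Y t)..ereal (\<tau> Y y Y t). f (velocity (\<gamma> y Y) s))"

definition has_rhombus ::
  "complex \<Rightarrow> complex \<Rightarrow> complex \<Rightarrow> complex \<Rightarrow> (complex \<times> complex \<Rightarrow> complex) \<Rightarrow> complex \<Rightarrow> bool"
where
  "has_rhombus x y X Y f L \<longleftrightarrow>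
     (\<forall>b \<gamma> \<tau>. rhombus_choice x y X Y b \<gamma> \<tau> \<longrightarrow>
        (truncated_rhombus x y X Y f \<gamma> \<tau> \<longlongrightarrow> L) at_top)"

definition Rh ::
  "complex \<Rightarrow> complex \<Rightarrow> complex \<Rightarrow> complex \<Rightarrow> (complex \<times> complex \<Rightarrow> complex) \<Rightarrow> complex" where
  "Rh x y X Y f = (THE L. has_rhombus x y X Y f L)"

definition r_const :: "nat \<Rightarrow> real" where
  "r_const k = (-1) ^ k * 2 ^ (k - 2) * (fact (k - 1))\<^sup>2 / (fact (2 * k - 2) * pi)"

end

(* For ideal points x and X let u = s + i v, |v| < pi/2, be the coordinate of the disc in which the
   geodesic from x to X is the real axis with arc length s. The form
   (X - x) dz / ((z - x) (z - X)) is -du, and writing q dz^k = Q du^k the area integral of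
   <q, (-du)^k> becomes (-2)^k times the integral of cos(v)^(2k-2) Q(s + i v) ds dv. For bounded q
   the holomorphic function Q decays in s, so the integral over s does not depend on v and equals
   the integral of q along the geodesic; Wallis' formula turns the remaining factor into 1/r_k.

   An automorphic q is bounded only in the hyperbolic norm, and the four integrals diverge
   separately. Geodesics with a common endpoint approach each other exponentially, so by Cauchy's
   estimate the alternating sum of the integrals truncated at horocycles of level t is within
   C K exp(-t) of its limit, with K independent of q. The alternating sum of the
   kernels has only a simple pole at each ideal point after multiplication by (1 - |z|^2)^(k-2),
   hence the area integral converges absolutely. The identity holds for the bounded differentials
   q(r z) with r < 1, and both estimates are uniform in r, so r tends to 1. *)
theory Submission
  imports Defs "HOL-Real_Asymp.Real_Asymp" "HOL-Probability.Sinc_Integral"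
begin

subsection \<open>Holomorphic change of variables\<close>

text \<open>Automorphy and cocompactness are consumed by the single estimate
  \<open>|q| (1 - |z|^2)^k <= C\<close>. Everything else is stated for holomorphic \<open>q\<close>
  with this bound, a class that is stable under dilations while automorphic forms are not. On the
  side of the geodesics, the eight ends of the four truncated segments are regrouped by ideal point,
  so that two geodesics with a common end are compared at the same horocycle. Hence the additive
  constant of a Busemann function may vary with the ideal point, but both geodesics ending there
  must share it. On the side of the area, the alternation acts through partial fractions: each base
  is a difference of two simple poles, and the pure powers of these poles depend on one index only
  and cancel. The mixed terms are balanced by \<open>(1 - |z|^2)^(k-2)\<close>, the part of the
  weight that the bound on \<open>q\<close> does not absorb; the exponent is nonnegative because
  \<open>k >= 2\<close>.\<close>

text \<open>The change of variables theorem for absolutely integrable functions is available only on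
  \<open>real ^ 'n\<close>, hence the detour through \<open>real ^ 2\<close>.\<close>

definition vec_of_complex :: "complex \<Rightarrow> real ^ 2" where
  "vec_of_complex z = (\<chi> i. if i = 1 then Re z else Im z)"

definition complex_of_vec :: "real ^ 2 \<Rightarrow> complex" where
  "complex_of_vec v = Complex (v $ 1) (v $ 2)"

lemma vec_of_complex_nth [simp]:
  "vec_of_complex z $ 1 = Re z" "vec_of_complex z $ 2 = Im z"
  by (auto simp: vec_of_complex_def)

lemma vec_of_complex_inverse [simp]: "complex_of_vec (vec_of_complex z) = z"
  by (auto simp: complex_of_vec_def)

lemma complex_of_vec_inverse [simp]: "vec_of_complex (complex_of_vec v) = v"
  by (simp add: vec_eq_iff forall_2 complex_of_vec_def)

lemma linear_vec_of_complex: "linear vec_of_complex"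
  by (rule linearI) (auto simp: vec_eq_iff forall_2)

lemma linear_complex_of_vec: "linear complex_of_vec"
  by (rule linearI) (auto simp: complex_eq_iff complex_of_vec_def)

lemmas bounded_linear_vec_of_complex = linear_vec_of_complex[unfolded linear_conv_bounded_linear]
lemmas bounded_linear_complex_of_vec = linear_complex_of_vec[unfolded linear_conv_bounded_linear]

lemma continuous_vec_of_complex: "continuous_on A vec_of_complex"
  by (simp add: linear_continuous_on bounded_linear_vec_of_complex)

lemma continuous_complex_of_vec: "continuous_on A complex_of_vec"
  by (simp add: linear_continuous_on bounded_linear_complex_of_vec)

lemma Basis_real2: "(Basis :: (real ^ 2) set) = {axis 1 1, axis 2 1}"
  by (auto simp: Basis_vec_def UNIV_2)

text \<open>Lebesgue measure is determined by its values on boxes. The map only relabels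
  coordinates, so boxes pull back to boxes with the same sides.\<close>

lemma distr_vec_of_complex: "distr lborel borel vec_of_complex = lborel"
proof (rule lborel_eqI[symmetric])
  fix l u :: "real ^ 2"
  assume le: "\<And>b. b \<in> Basis \<Longrightarrow> l \<bullet> b \<le> u \<bullet> b"
  have [measurable]: "vec_of_complex \<in> borel_measurable borel"
    by (intro borel_measurable_continuous_onI continuous_vec_of_complex)
  have "vec_of_complex -` box l u = box (complex_of_vec l) (complex_of_vec u)"
    by (auto simp: in_box_complex_iff mem_box Basis_real2 inner_axis complex_of_vec_def)
  then have "emeasure (distr lborel borel vec_of_complex) (box l u)
      = emeasure lborel (box (complex_of_vec l) (complex_of_vec u))"
    by (subst emeasure_distr) auto
  also have "\<dots> = (\<Prod>b\<in>Basis. (complex_of_vec u - complex_of_vec l) \<bullet> b)"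
    using le[of "axis 1 1"] le[of "axis 2 1"] by (subst emeasure_lborel_box)
      (auto simp: Basis_complex_def Basis_real2 inner_axis complex_of_vec_def)
  also have "\<dots> = (\<Prod>b\<in>Basis. (u - l) \<bullet> b)"
  proof -
    have "axis 1 1 \<noteq> (axis 2 1 :: real ^ 2)" by (simp add: axis_eq_axis)
    then show ?thesis
      by (simp add: Basis_complex_def Basis_real2 inner_axis complex_of_vec_def
          inner_diff_left)
  qed
  finally show "emeasure (distr lborel borel vec_of_complex) (box l u)
      = ennreal (\<Prod>b\<in>Basis. (u - l) \<bullet> b)" .
qed simp

text \<open>Identifies area in the plane with the product measure; every application of Fubini below
  passes through this.\<close>

lemma distr_Complex: "distr lborel borel (\<lambda>p. Complex (fst p) (snd p)) = lborel"
proof (rule lborel_eqI[symmetric])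
  fix l u :: complex
  assume le: "\<And>b. b \<in> Basis \<Longrightarrow> l \<bullet> b \<le> u \<bullet> b"
  have [measurable]: "(\<lambda>p. Complex (fst p) (snd p)) \<in> borel_measurable borel"
    by (intro borel_measurable_continuous_onI continuous_intros)
  have "(\<lambda>p. Complex (fst p) (snd p)) -` box l u = box (Re l, Im l) (Re u, Im u)"
    by (auto simp: in_box_complex_iff mem_box Basis_prod_def)
  then have "emeasure (distr lborel borel (\<lambda>p. Complex (fst p) (snd p))) (box l u)
      = emeasure lborel (box (Re l, Im l) (Re u, Im u))"
    by (subst emeasure_distr) auto
  also have "\<dots> = (\<Prod>b\<in>Basis. ((Re u, Im u) - (Re l, Im l)) \<bullet> b)"
    using le[of 1] le[of \<i>] by (subst emeasure_lborel_box)
      (auto simp: Basis_complex_def Basis_prod_def)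
  also have "\<dots> = (\<Prod>b\<in>Basis. (u - l) \<bullet> b)"
    by (simp add: Basis_complex_def Basis_prod_def inner_diff_left mult.commute)
  finally show "emeasure (distr lborel borel (\<lambda>p. Complex (fst p) (snd p))) (box l u)
      = ennreal (\<Prod>b\<in>Basis. (u - l) \<bullet> b)" .
qed simp

text \<open>Openness of \<open>S\<close> and continuity of \<open>h\<close> give Borel
  measurability, which allows passing between \<open>lborel\<close> and its completion, on which
  absolute integrability is based. The rest is transport along a measure-preserving linear
  isomorphism.\<close>

lemma vec_of_complex_integral:
  assumes "open S" and "continuous_on S h"
  shows "(vec_of_complex \<circ> h \<circ> complex_of_vec) absolutely_integrable_on (vec_of_complex ` S)
      \<longleftrightarrow> set_integrable lborel S h" (is "?A \<longleftrightarrow> ?B")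
    and "set_integrable lborel S h \<Longrightarrow>
      integral (vec_of_complex ` S) (vec_of_complex \<circ> h \<circ> complex_of_vec)
      = vec_of_complex (LINT z:S|lborel. h z)"
proof -
  let ?T = "vec_of_complex ` S" and ?k = "vec_of_complex \<circ> h \<circ> complex_of_vec"
  have T: "?T = complex_of_vec -` S"
    by (force simp: image_iff)
  have "open ?T"
    unfolding T using assms(1) by (intro continuous_open_vimage) (auto intro: continuous_complex_of_vec
      simp: bounded_linear_complex_of_vec linear_continuous_at)
  have cont: "continuous_on ?T ?k"
    by (intro continuous_on_compose continuous_complex_of_vec continuous_vec_of_complex)
       (use assms in \<open>auto simp: image_image\<close>)
  have meas: "(\<lambda>v. indicator ?T v *\<^sub>R ?k v) \<in> borel_measurable borel"
    using borel_measurable_continuous_on_indicator[OF _ cont] \<open>open ?T\<close> by auto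
  have [measurable]: "vec_of_complex \<in> borel_measurable borel"
    by (intro borel_measurable_continuous_onI continuous_vec_of_complex)
  have eq: "indicator ?T (vec_of_complex z) *\<^sub>R ?k (vec_of_complex z)
      = vec_of_complex (indicator S z *\<^sub>R h z)" for z
    by (auto simp: T indicator_def linear_0[OF linear_vec_of_complex])
  have "?A \<longleftrightarrow> integrable lborel (\<lambda>v. indicator ?T v *\<^sub>R ?k v)"
    unfolding set_integrable_def by (intro integrable_completion) (use meas in auto)
  also have "\<dots> \<longleftrightarrow> integrable (distr lborel borel vec_of_complex) (\<lambda>v. indicator ?T v *\<^sub>R ?k v)"
    by (simp only: distr_vec_of_complex)
  also have "\<dots> \<longleftrightarrow> integrable lborel (\<lambda>z. vec_of_complex (indicator S z *\<^sub>R h z))"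
    unfolding eq[symmetric] by (rule integrable_distr_eq) (use meas in auto)
  also have "\<dots> \<longleftrightarrow> ?B"
    unfolding set_integrable_def
    using integrable_bounded_linear[OF bounded_linear_vec_of_complex]
      integrable_bounded_linear[OF bounded_linear_complex_of_vec,
        of lborel "\<lambda>z. vec_of_complex (indicator S z *\<^sub>R h z)"] by auto
  finally show 1: "?A \<longleftrightarrow> ?B" .
  assume B: ?B
  have "integral ?T ?k = (LINT v:?T|lebesgue. ?k v)"
    using B 1 by (intro set_lebesgue_integral_eq_integral(2)[symmetric]) auto
  also have "\<dots> = integral\<^sup>L lborel (\<lambda>v. indicator ?T v *\<^sub>R ?k v)"
    unfolding set_lebesgue_integral_def by (intro integral_completion) (use meas in auto)
  also have "\<dots> = integral\<^sup>L (distr lborel borel vec_of_complex) (\<lambda>v. indicator ?T v *\<^sub>R ?k v)"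
    by (simp only: distr_vec_of_complex)
  also have "\<dots> = integral\<^sup>L lborel (\<lambda>z. vec_of_complex (indicator S z *\<^sub>R h z))"
    unfolding eq[symmetric] by (rule integral_distr) (use meas in auto)
  also have "\<dots> = vec_of_complex (LINT z:S|lborel. h z)"
    using B unfolding set_lebesgue_integral_def set_integrable_def
    by (intro integral_bounded_linear[OF bounded_linear_vec_of_complex])
  finally show "integral ?T ?k = vec_of_complex (LINT z:S|lborel. h z)" .
qed

text \<open>The real derivative of \<open>f\<close> is multiplication by a complex number
  \<open>a + i b\<close>; as a real matrix this has determinant \<open>a^2 + b^2\<close>, so the
  Jacobian is the squared modulus of \<open>deriv f\<close>.\<close>

lemma holomorphic_change_of_variables:
  fixes f g :: "complex \<Rightarrow> complex"
  assumes "open S" and hol: "f holomorphic_on S" and inj: "inj_on f S"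
    and g: "continuous_on (f ` S) g"
    and int: "set_integrable lborel S (\<lambda>z. (cmod (deriv f z))\<^sup>2 *\<^sub>R g (f z))"
  shows "set_integrable lborel (f ` S) g"
    and "(LINT z:f ` S|lborel. g z) = (LINT z:S|lborel. (cmod (deriv f z))\<^sup>2 *\<^sub>R g (f z))"
proof -
  let ?F = "vec_of_complex \<circ> f \<circ> complex_of_vec" and ?G = "vec_of_complex \<circ> g \<circ> complex_of_vec"
  let ?h = "\<lambda>z. (cmod (deriv f z))\<^sup>2 *\<^sub>R g (f z)"
  define F' where "F' v = vec_of_complex \<circ> (\<lambda>w. deriv f (complex_of_vec v) * w) \<circ> complex_of_vec" for v
  let ?T = "vec_of_complex ` S"
  have T: "?T = complex_of_vec -` S"
    by (force simp: image_iff)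
  have "open ?T"
    unfolding T using assms(1) by (intro continuous_open_vimage) (auto intro: continuous_complex_of_vec
      simp: bounded_linear_complex_of_vec linear_continuous_at)
  have FT: "?F ` ?T = vec_of_complex ` f ` S"
    by (auto simp: image_image)
  have der: "(?F has_derivative F' v) (at v within ?T)" if "v \<in> ?T" for v
  proof -
    have "complex_of_vec v \<in> S" using that T by auto
    then have "(f has_derivative (\<lambda>w. deriv f (complex_of_vec v) * w)) (at (complex_of_vec v))"
      using holomorphic_derivI[OF hol \<open>open S\<close>] by (simp add: has_field_derivative_def)
    moreover have "(complex_of_vec has_derivative complex_of_vec) (at v within ?T)"
      by (rule bounded_linear_imp_has_derivative[OF bounded_linear_complex_of_vec])
    moreover have "(vec_of_complex has_derivative vec_of_complex) (at z)" for z
      by (rule bounded_linear_imp_has_derivative[OF bounded_linear_vec_of_complex])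
    ultimately show ?thesis
      unfolding F'_def by (metis (no_types, lifting) diff_chain_within has_derivative_at_withinI)
  qed
  have det: "\<bar>det (matrix (F' v))\<bar> = (cmod (deriv f (complex_of_vec v)))\<^sup>2" for v
  proof -
    have "det (matrix (F' v)) = (cmod (deriv f (complex_of_vec v)))\<^sup>2"
      by (simp add: det_2 matrix_def F'_def complex_of_vec_def axis_def cmod_power2 flip: power2_eq_square)
    then show ?thesis by simp
  qed
  have cont: "continuous_on S ?h"
    by (intro continuous_intros holomorphic_on_imp_continuous_on holomorphic_deriv hol
        continuous_on_compose2[OF g]) (use assms in auto)
  have inj': "inj_on ?F ?T"
    using inj by (auto simp: inj_on_def) (metis vec_of_complex_inverse)
  have eq: "(\<lambda>v. \<bar>det (matrix (F' v))\<bar> *\<^sub>R ?G (?F v)) = vec_of_complex \<circ> ?h \<circ> complex_of_vec"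
    by (auto simp: det linear_scale[OF linear_vec_of_complex])
  have *: "?G absolutely_integrable_on (?F ` ?T) \<and>
      integral (?F ` ?T) ?G = vec_of_complex (LINT z:S|lborel. ?h z)"
  proof (subst has_absolute_integral_change_of_variables[OF _ der inj', symmetric])
    show "?T \<in> sets lebesgue"
      using \<open>open ?T\<close> by (intro sets_completionI_sets) auto
  qed (use vec_of_complex_integral[OF \<open>open S\<close> cont] int in \<open>auto simp only: eq\<close>)
  have "open (f ` S)"
    using open_mapping_thm3[OF hol \<open>open S\<close> inj] .
  note v = vec_of_complex_integral[OF this g]
  show "set_integrable lborel (f ` S) g"
    using * v(1) unfolding FT by blast
  then have "vec_of_complex (LINT z:f ` S|lborel. g z) = vec_of_complex (LINT z:S|lborel. ?h z)"
    using * v(2) unfolding FT by metis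
  then show "(LINT z:f ` S|lborel. g z) = (LINT z:S|lborel. ?h z)"
    by (metis vec_of_complex_inverse)
qed

subsection \<open>The half-plane and strip models\<close>

text \<open>The Poisson kernel of the disc. Its level sets are the horocycles at \<open>c\<close>,
  its logarithm is a Busemann function at \<open>c\<close>, and it is the height in the half-plane
  model that has \<open>c\<close> at infinity.\<close>

definition poisson :: "complex \<Rightarrow> complex \<Rightarrow> real" where
  "poisson c z = (1 - (cmod z)\<^sup>2) / (cmod (z - c))\<^sup>2"

text \<open>The half-plane model with infinity placed at \<open>X\<close> and \<i> at the centre of
  the disc; \<open>half_plane_coord X\<close> inverts it.\<close>

definition cayley :: "complex \<Rightarrow> complex \<Rightarrow> complex" where
  "cayley X w = X * (w - \<i>) / (w + \<i>)"

definition half_plane_coord :: "complex \<Rightarrow> complex \<Rightarrow> complex" where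
  "half_plane_coord X z = \<i> * (X + z) / (X - z)"

text \<open>\<open>foot x X\<close> is the real endpoint of the vertical line that represents the geodesic from
  \<open>x\<close> to \<open>X\<close> when \<open>X\<close> is moved to infinity; \<open>strip_map x X\<close> restricted to the reals is that
  geodesic with unit speed.\<close>

definition foot :: "complex \<Rightarrow> complex \<Rightarrow> real" where
  "foot x X = Re (half_plane_coord X x)"

definition strip :: "complex set" where
  "strip = {u. \<bar>Im u\<bar> < pi / 2}"

definition strip_map :: "complex \<Rightarrow> complex \<Rightarrow> complex \<Rightarrow> complex" where
  "strip_map x X u = cayley X (of_real (foot x X) + \<i> * exp u)"

lemma upper_half_plane_add_i: "Im w \<ge> 0 \<Longrightarrow> w + \<i> \<noteq> 0"
  by (auto simp: complex_eq_iff)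

lemma one_minus_norm_cayley:
  assumes "cmod X = 1" "Im w \<ge> 0"
  shows "1 - (cmod (cayley X w))\<^sup>2 = 4 * Im w / (cmod (w + \<i>))\<^sup>2"
proof -
  have "w + \<i> \<noteq> 0" using assms upper_half_plane_add_i by auto
  then have "1 - (cmod (cayley X w))\<^sup>2 = ((cmod (w + \<i>))\<^sup>2 - (cmod (w - \<i>))\<^sup>2) / (cmod (w + \<i>))\<^sup>2"
    using assms by (simp add: cayley_def norm_mult norm_divide power_divide diff_divide_distrib
        del: right_diff_distrib_numeral)
  also have "(cmod (w + \<i>))\<^sup>2 - (cmod (w - \<i>))\<^sup>2 = 4 * Im w"
    by (simp add: cmod_power2) (simp add: power2_eq_square algebra_simps)
  finally show ?thesis .
qed

lemma cayley_minus:
  assumes "w + \<i> \<noteq> 0" "w' + \<i> \<noteq> 0"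
  shows "cayley X w - cayley X w' = 2 * \<i> * X * (w - w') / ((w + \<i>) * (w' + \<i>))"
  using assms by (simp add: cayley_def divide_simps) (simp add: algebra_simps)

lemma cayley_minus_infinity:
  assumes "w + \<i> \<noteq> 0"
  shows "cayley X w - X = - 2 * \<i> * X / (w + \<i>)"
  using assms by (simp add: cayley_def divide_simps) (simp add: algebra_simps)

lemma cayley_in_plane:
  assumes "cmod X = 1" "Im w > 0"
  shows "cayley X w \<in> hyp_plane"
proof -
  have "w + \<i> \<noteq> 0" using assms upper_half_plane_add_i by auto
  then have "1 - (cmod (cayley X w))\<^sup>2 > 0"
    using assms by (simp add: one_minus_norm_cayley)
  then have "cmod (cayley X w) < 1"
    by (simp add: power2_less_1_iff abs_square_less_1)
  then show ?thesis by (simp add: hyp_plane_def)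
qed

lemma poisson_cayley:
  assumes "cmod X = 1" "Im w > 0"
  shows "poisson X (cayley X w) = Im w"
proof -
  have "w + \<i> \<noteq> 0" using assms upper_half_plane_add_i by auto
  then show ?thesis
    using assms by (simp add: poisson_def one_minus_norm_cayley cayley_minus_infinity
        norm_mult norm_divide power_divide power_mult_distrib)
qed

lemma hyp_dist_cayley:
  assumes "cmod X = 1" "Im w > 0" "Im w' > 0"
  shows "hyp_dist (cayley X w) (cayley X w') = arcosh (1 + (cmod (w - w'))\<^sup>2 / (2 * Im w * Im w'))"
proof -
  have "w + \<i> \<noteq> 0" "w' + \<i> \<noteq> 0" using assms upper_half_plane_add_i by auto
  then have "2 * (cmod (cayley X w - cayley X w'))\<^sup>2 /
      ((1 - (cmod (cayley X w))\<^sup>2) * (1 - (cmod (cayley X w'))\<^sup>2))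
    = (cmod (w - w'))\<^sup>2 / (2 * Im w * Im w')"
    using assms by (simp add: one_minus_norm_cayley cayley_minus norm_mult norm_divide
        power_divide power_mult_distrib divide_simps)
  then show ?thesis by (simp add: hyp_dist_def)
qed

lemma Im_half_plane_coord:
  assumes "cmod X = 1" "z \<noteq> X"
  shows "Im (half_plane_coord X z) = poisson X z"
proof -
  have "Im (half_plane_coord X z) = ((cmod X)\<^sup>2 - (cmod z)\<^sup>2) / (cmod (z - X))\<^sup>2"
    by (simp add: half_plane_coord_def Im_divide cmod_power2) (simp add: power2_eq_square field_simps)
  then show ?thesis using assms by (simp add: poisson_def)
qed

lemma cayley_half_plane_coord:
  assumes "X \<noteq> 0" "z \<noteq> X"
  shows "cayley X (half_plane_coord X z) = z"
proof -
  have "half_plane_coord X z - \<i> = 2 * \<i> * z / (X - z)" "half_plane_coord X z + \<i> = 2 * \<i> * X / (X - z)"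
    using assms by (simp_all add: half_plane_coord_def divide_simps) (simp_all add: algebra_simps)
  then show ?thesis using assms by (simp add: cayley_def)
qed

lemma poisson_pos:
  assumes "z \<in> hyp_plane" "cmod c = 1"
  shows "poisson c z > 0"
proof -
  have "z \<noteq> c" "(cmod z)\<^sup>2 < 1"
    using assms by (auto simp: hyp_plane_def power_less_one_iff)
  then show ?thesis by (auto simp: poisson_def)
qed

lemma in_plane_cayleyE:
  assumes "cmod X = 1" "z \<in> hyp_plane"
  obtains w where "Im w > 0" "z = cayley X w"
proof
  have "z \<noteq> X" "X \<noteq> 0" using assms by (auto simp: hyp_plane_def)
  then show "Im (half_plane_coord X z) > 0" "z = cayley X (half_plane_coord X z)"
    using assms poisson_pos Im_half_plane_coord cayley_half_plane_coord by auto
qed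

lemma cayley_inject:
  assumes "w + \<i> \<noteq> 0" "w' + \<i> \<noteq> 0" "X \<noteq> 0" "cayley X w = cayley X w'"
  shows "w = w'"
  using cayley_minus[of w w' X] assms by simp

lemma of_real_foot:
  assumes "cmod x = 1" "cmod X = 1" "x \<noteq> X"
  shows "of_real (foot x X) = half_plane_coord X x"
  using Im_half_plane_coord[OF assms(2,3)] assms by (simp add: complex_eq_iff foot_def poisson_def)

lemma cayley_foot:
  assumes "cmod x = 1" "cmod X = 1" "x \<noteq> X"
  shows "cayley X (of_real (foot x X)) = x"
  using assms by (subst of_real_foot) (auto intro!: cayley_half_plane_coord)

lemma foot_add_i_nz: "complex_of_real r + \<i> \<noteq> 0"
  by (simp add: complex_eq_iff)

lemma norm_ideal_diff:
  assumes "cmod x = 1" "cmod X = 1" "x \<noteq> X"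
  shows "X - x = 2 * \<i> * X / (of_real (foot x X) + \<i>)"
  using cayley_minus_infinity[OF foot_add_i_nz, of X "foot x X"] cayley_foot[OF assms]
  by (metis minus_diff_eq minus_divide_left minus_mult_left minus_minus)

lemma Im_exp_i: "Im (of_real r + \<i> * exp u) = exp (Re u) * cos (Im u)"
  by (simp add: Re_exp)

lemma strip_Im_pos: "u \<in> strip \<Longrightarrow> exp (Re u) * cos (Im u) > 0"
  unfolding strip_def by (intro mult_pos_pos cos_gt_zero_pi) auto

lemma of_real_strip [simp]: "of_real s \<in> strip"
  by (simp add: strip_def)

lemma strip_map_in_plane: "cmod X = 1 \<Longrightarrow> u \<in> strip \<Longrightarrow> strip_map x X u \<in> hyp_plane"
  unfolding strip_map_def
  by (rule cayley_in_plane) (simp_all add: strip_Im_pos Im_exp_i del: plus_complex.sel)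

lemma open_strip: "open strip"
proof -
  have "strip = Im -` {-pi/2<..<pi/2}" by (auto simp: strip_def abs_less_iff)
  moreover have "open (Im -` {-pi/2<..<pi/2})" by (intro open_vimage continuous_intros)
  ultimately show ?thesis by simp
qed

lemma convex_strip: "convex strip"
proof -
  have "strip = {u. Im u > -pi/2} \<inter> {u. Im u < pi/2}" by (auto simp: strip_def abs_less_iff)
  moreover have "convex \<dots>" by (intro convex_Int convex_halfspace_Im_gt convex_halfspace_Im_lt)
  ultimately show ?thesis by simp
qed

lemma cayley_has_derivative:
  assumes "w + \<i> \<noteq> 0"
  shows "(cayley X has_field_derivative 2 * \<i> * X / (w + \<i>)\<^sup>2) (at w)"
proof -
  have "((\<lambda>w. X * (w - \<i>) / (w + \<i>)) has_field_derivative
      (X * (w + \<i>) - X * (w - \<i>) * 1) / ((w + \<i>) * (w + \<i>))) (at w)"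
    using assms by (auto intro!: derivative_eq_intros)
  moreover have "X * (w + \<i>) - X * (w - \<i>) * 1 = 2 * \<i> * X"
    by (simp add: algebra_simps)
  ultimately show ?thesis
    by (simp only: cayley_def[abs_def] power2_eq_square)
qed

text \<open>The right-hand side is the vector field of the hyperbolic one-parameter group fixing
  \<open>x\<close> and \<open>X\<close>; translation of the strip by a real number is its
  flow.\<close>

lemma strip_map_has_derivative:
  assumes "cmod x = 1" "cmod X = 1" "x \<noteq> X" "u \<in> strip"
  shows "(strip_map x X has_field_derivative
      - ((strip_map x X u - x) * (strip_map x X u - X) / (X - x))) (at u)"
proof -
  let ?w = "of_real (foot x X) + \<i> * exp u" and ?f = "complex_of_real (foot x X)"
  have nz: "?w + \<i> \<noteq> 0"
    using strip_Im_pos[OF assms(4)] by (intro upper_half_plane_add_i) (simp only: Im_exp_i)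
  have "(cayley X has_field_derivative 2 * \<i> * X / (?w + \<i>)\<^sup>2) (at ?w)"
    using nz by (rule cayley_has_derivative)
  moreover have "((\<lambda>u. ?f + \<i> * exp u) has_field_derivative \<i> * exp u) (at u)"
    by (auto intro!: derivative_eq_intros)
  ultimately have D: "(strip_map x X has_field_derivative (2 * \<i> * X / (?w + \<i>)\<^sup>2) * (\<i> * exp u)) (at u)"
    unfolding strip_map_def[abs_def] by (rule DERIV_chain2)
  have x: "strip_map x X u - x = 2 * \<i> * X * (\<i> * exp u) / ((?w + \<i>) * (?f + \<i>))"
    using cayley_minus[OF nz foot_add_i_nz, of X "foot x X"] cayley_foot[OF assms(1-3)]
    by (simp add: strip_map_def)
  have X: "strip_map x X u - X = - 2 * \<i> * X / (?w + \<i>)"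
    unfolding strip_map_def by (rule cayley_minus_infinity[OF nz])
  \<comment> \<open>Read \<open>a\<close> as \<open>2 * \<i> * X\<close>, \<open>v\<close> and
    \<open>g\<close> as the denominators belonging to the moving point and to the foot, and
    \<open>e\<close> as \<open>\<i> * exp u\<close>; both sides of the claim then become rational in
    four atoms.\<close>
  have *: "(a / v\<^sup>2) * e = - ((a * e / (v * g)) * (- a / v) / (a / g))"
    if "a \<noteq> 0" "v \<noteq> 0" "g \<noteq> 0" for a v g e :: complex
    using that by (simp add: power2_eq_square)
  have "2 * \<i> * X \<noteq> 0" using assms by auto
  from *[OF this nz foot_add_i_nz] D show ?thesis
    unfolding x X unfolding norm_ideal_diff[OF assms(1-3)] by (simp only: mult_minus_left)
qed

subsection \<open>Busemann functions and geodesics\<close>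

text \<open>The argument \<open>A\<close> of \<open>arcosh\<close> blows up, but its product with
  \<open>D = 1 - |w|^2\<close> tends to \<open>2 / poisson c z\<close>. Since
  \<open>arcosh A = ln (A + sqrt (A^2 - 1))\<close>, adding \<open>ln D\<close> moves the factor
  \<open>D\<close> under the logarithm and leaves a finite limit.\<close>

lemma hyp_dist_asymptotic:
  assumes z: "z \<in> hyp_plane" and c: "cmod c = 1" and lim: "(w \<longlongrightarrow> c) F"
    and w: "eventually (\<lambda>s. w s \<in> hyp_plane) F"
  shows "((\<lambda>s. ln (1 - (cmod (w s))\<^sup>2) + hyp_dist z (w s)) \<longlongrightarrow> ln (4 / poisson c z)) F"
proof -
  define D where "D s = 1 - (cmod (w s))\<^sup>2" for s
  define A where "A s = 1 + 2 * (cmod (z - w s))\<^sup>2 / ((1 - (cmod z)\<^sup>2) * D s)" for s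
  have z1: "1 - (cmod z)\<^sup>2 > 0"
    using z by (simp add: hyp_plane_def power_less_one_iff)
  have P: "poisson c z > 0" using poisson_pos[OF z c] .
  have D0: "(D \<longlongrightarrow> 0) F"
    unfolding D_def by (rule tendsto_eq_intros lim refl)+ (simp add: c)
  have "((\<lambda>s. D s + 2 * (cmod (z - w s))\<^sup>2 / (1 - (cmod z)\<^sup>2)) \<longlongrightarrow>
      0 + 2 * (cmod (z - c))\<^sup>2 / (1 - (cmod z)\<^sup>2)) F"
    using z1 by (intro tendsto_intros lim D0) auto
  also have "0 + 2 * (cmod (z - c))\<^sup>2 / (1 - (cmod z)\<^sup>2) = 2 / poisson c z"
    by (simp add: poisson_def)
  finally have B: "((\<lambda>s. D s + 2 * (cmod (z - w s))\<^sup>2 / (1 - (cmod z)\<^sup>2)) \<longlongrightarrow> 2 / poisson c z) F" .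
  let ?B = "\<lambda>s. D s + 2 * (cmod (z - w s))\<^sup>2 / (1 - (cmod z)\<^sup>2)"
  have "((\<lambda>s. ln (?B s + sqrt ((?B s)\<^sup>2 - (D s)\<^sup>2))) \<longlongrightarrow>
      ln (2 / poisson c z + sqrt ((2 / poisson c z)\<^sup>2 - 0\<^sup>2))) F"
    using P by (intro tendsto_intros B D0) (auto simp: add_pos_pos intro!: less_imp_neq[THEN not_sym])
  moreover have "2 / poisson c z + sqrt ((2 / poisson c z)\<^sup>2 - 0\<^sup>2) = 4 / poisson c z"
    using P by simp
  moreover have "eventually (\<lambda>s. ln (?B s + sqrt ((?B s)\<^sup>2 - (D s)\<^sup>2)) =
      ln (1 - (cmod (w s))\<^sup>2) + hyp_dist z (w s)) F"
    using w
  proof eventually_elim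
    case (elim s)
    have D: "D s > 0"
      using elim by (simp add: D_def hyp_plane_def power_less_one_iff)
    have A1: "A s \<ge> 1" using D z1 by (simp add: A_def)
    have B: "?B s = D s * A s" using D z1 by (simp add: A_def field_simps)
    have "sqrt ((?B s)\<^sup>2 - (D s)\<^sup>2) = sqrt ((D s)\<^sup>2 * ((A s)\<^sup>2 - 1))"
      unfolding B by (simp add: power_mult_distrib algebra_simps)
    also have "\<dots> = D s * sqrt ((A s)\<^sup>2 - 1)"
      using D by (simp add: real_sqrt_mult)
    finally have "ln (?B s + sqrt ((?B s)\<^sup>2 - (D s)\<^sup>2)) = ln (D s * (A s + sqrt ((A s)\<^sup>2 - 1)))"
      unfolding B by (simp add: algebra_simps)
    also have "\<dots> = ln (D s) + ln (A s + sqrt ((A s)\<^sup>2 - 1))"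
      using D A1 by (intro ln_mult_pos) (auto intro!: add_pos_nonneg)
    also have "ln (A s + sqrt ((A s)\<^sup>2 - 1)) = arcosh (A s)"
      using A1 by (simp add: arcosh_real_def)
    finally show ?case by (simp add: A_def D_def hyp_dist_def)
  qed
  ultimately show ?thesis by (simp add: tendsto_cong)
qed

text \<open>The divergent term of the asymptotics does not involve the base point, so it cancels in
  the difference.\<close>

lemma hyp_dist_diff_tendsto:
  assumes "z \<in> hyp_plane" "z' \<in> hyp_plane" "cmod c = 1" "(w \<longlongrightarrow> c) F"
    and "eventually (\<lambda>s. w s \<in> hyp_plane) F"
  shows "((\<lambda>s. hyp_dist z' (w s) - hyp_dist z (w s)) \<longlongrightarrow> ln (poisson c z) - ln (poisson c z')) F"
proof -
  have "((\<lambda>s. (ln (1 - (cmod (w s))\<^sup>2) + hyp_dist z' (w s)) - (ln (1 - (cmod (w s))\<^sup>2) + hyp_dist z (w s)))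
      \<longlongrightarrow> ln (4 / poisson c z') - ln (4 / poisson c z)) F"
    by (intro tendsto_diff hyp_dist_asymptotic assms)
  then show ?thesis
    using poisson_pos[OF assms(1,3)] poisson_pos[OF assms(2,3)] by (simp add: ln_div)
qed

text \<open>Comparison with the value at the centre of the disc eliminates both the parametrisation
  of the ray and the constant \<open>a\<close>; of the ray only its limit \<open>c\<close>
  remains.\<close>

lemma busemann_eq_ln_poisson:
  assumes "busemann c b" "cmod c = 1"
  obtains \<beta> where "\<And>z. z \<in> hyp_plane \<Longrightarrow> b z = ln (poisson c z) + \<beta>"
proof
  obtain \<rho> a where \<rho>: "geodesic_on {0..} \<rho>" "(\<rho> \<longlongrightarrow> c) at_top"
    and b: "\<And>z. z \<in> hyp_plane \<Longrightarrow> ((\<lambda>s. s - hyp_dist z (\<rho> s) + a) \<longlongrightarrow> b z) at_top"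
    using assms(1) unfolding busemann_def by auto
  have ev: "eventually (\<lambda>s. \<rho> s \<in> hyp_plane) at_top"
    using eventually_ge_at_top[of 0] by eventually_elim (use \<rho>(1) in \<open>auto simp: geodesic_on_def\<close>)
  fix z assume z: "z \<in> hyp_plane"
  have 0: "0 \<in> hyp_plane" by (simp add: hyp_plane_def)
  have "((\<lambda>s. (s - hyp_dist z (\<rho> s) + a) - (s - hyp_dist 0 (\<rho> s) + a)) \<longlongrightarrow> b z - b 0) at_top"
    by (intro tendsto_diff b z 0)
  moreover have "((\<lambda>s. hyp_dist 0 (\<rho> s) - hyp_dist z (\<rho> s)) \<longlongrightarrow> ln (poisson c z) - ln (poisson c 0)) at_top"
    by (rule hyp_dist_diff_tendsto[OF z 0 assms(2) \<rho>(2) ev])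
  ultimately have "b z - b 0 = ln (poisson c z) - ln (poisson c 0)"
    by (intro tendsto_unique[of at_top]) (simp_all add: algebra_simps)
  then show "b z = ln (poisson c z) + (b 0 - ln (poisson c 0))" by simp
qed

section \<open>Horizontal centre lines of strips as unit speed geodesics\<close>

lemma strip_map_of_real: "strip_map x X (of_real s) = cayley X (Complex (foot x X) (exp s))"
proof -
  have "of_real (foot x X) + \<i> * exp (of_real s) = Complex (foot x X) (exp s)"
    by (simp add: complex_eq_iff Re_exp Im_exp)
  then show ?thesis by (simp add: strip_map_def)
qed

lemma hyp_dist_strip_map:
  assumes "cmod X = 1"
  shows "hyp_dist (strip_map x X (of_real s)) (strip_map x X (of_real t)) = \<bar>s - t\<bar>"
proof -
  have "(cmod (Complex (foot x X) (exp s) - Complex (foot x X) (exp t)))\<^sup>2 = (exp s - exp t)\<^sup>2"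
    by (simp add: cmod_power2)
  moreover have "(exp s - exp t)\<^sup>2 / (2 * exp s * exp t) = cosh (s - t) - 1"
  proof -
    have "(a - b)\<^sup>2 / (2 * a * b) = (a / b + b / a) / 2 - 1" if "a \<noteq> 0" "b \<noteq> 0" for a b :: real
      using that by (simp add: field_simps power2_eq_square)
    from this[of "exp s" "exp t"] show ?thesis
      by (simp add: cosh_def exp_diff exp_minus)
  qed
  ultimately have "(cmod (Complex (foot x X) (exp s) - Complex (foot x X) (exp t)))\<^sup>2
      / (2 * exp s * exp t) = cosh (s - t) - 1"
    by simp
  then have "hyp_dist (strip_map x X (of_real s)) (strip_map x X (of_real t)) = arcosh (cosh (s - t))"
    unfolding strip_map_of_real by (subst hyp_dist_cayley[OF assms]) simp_all
  also have "\<dots> = \<bar>s - t\<bar>"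
    by (metis abs_ge_zero arcosh_cosh_real cosh_real_abs)
  finally show ?thesis .
qed

lemma strip_map_at_top:
  assumes "cmod X = 1"
  shows "((\<lambda>s. strip_map x X (of_real s)) \<longlongrightarrow> X) at_top"
proof -
  have "((\<lambda>s. strip_map x X (of_real s) - X) \<longlongrightarrow> 0) at_top"
  proof (rule Lim_null_comparison)
    show "eventually (\<lambda>s. cmod (strip_map x X (of_real s) - X) \<le> 2 / exp s) at_top"
    proof (rule always_eventually, rule allI)
      fix s :: real
      let ?w = "Complex (foot x X) (exp s)"
      have "?w + \<i> \<noteq> 0" by (rule upper_half_plane_add_i) simp
      then have "cmod (strip_map x X (of_real s) - X) = 2 / cmod (?w + \<i>)"
        using assms by (simp add: strip_map_of_real cayley_minus_infinity norm_mult norm_divide)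
      moreover have "exp s \<le> cmod (?w + \<i>)"
        using abs_Im_le_cmod[of "?w + \<i>"] by (simp add: abs_if split: if_splits)
      ultimately show "cmod (strip_map x X (of_real s) - X) \<le> 2 / exp s"
        by (simp add: frac_le)
    qed
    show "((\<lambda>s. 2 / exp s :: real) \<longlongrightarrow> 0) at_top" by real_asymp
  qed
  then show ?thesis by (simp add: LIM_zero_cancel)
qed

lemma strip_map_at_bot:
  assumes "cmod x = 1" "cmod X = 1" "x \<noteq> X"
  shows "((\<lambda>s. strip_map x X (of_real s)) \<longlongrightarrow> x) at_bot"
proof -
  have "((\<lambda>s. cayley X (of_real (foot x X) + \<i> * of_real (exp s))) \<longlongrightarrow>
      cayley X (of_real (foot x X) + \<i> * of_real 0)) at_bot"
    unfolding cayley_def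
    by (intro tendsto_intros exp_at_bot) (simp add: foot_add_i_nz)
  then show ?thesis
    using cayley_foot[OF assms] by (simp add: strip_map_def exp_of_real)
qed

lemma geodesic_line_strip_map:
  assumes "cmod x = 1" "cmod X = 1" "x \<noteq> X"
  shows "geodesic_line x X (\<lambda>s. strip_map x X (of_real (s + r)))"
proof -
  have 1: "filterlim (\<lambda>s::real. s + r) at_top at_top" "filterlim (\<lambda>s::real. s + r) at_bot at_bot"
    by real_asymp+
  show ?thesis
    unfolding geodesic_line_def geodesic_on_def
    using assms filterlim_compose[OF strip_map_at_bot[OF assms] 1(2)]
      filterlim_compose[OF strip_map_at_top[OF assms(2), of x] 1(1)]
    by (auto simp: strip_map_in_plane hyp_dist_strip_map simp del: of_real_add)
qed

text \<open>Busemann functions turn the end of a geodesic at \<open>X\<close> into the exponential growth of the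
  height in the half-plane model centred at \<open>X\<close>; the distance formula then forces the
  horizontal coordinate to be constant.\<close>

lemma geodesic_line_eq_strip_map:
  assumes "geodesic_line x X \<gamma>" "cmod x = 1" "cmod X = 1" "x \<noteq> X"
  obtains r where "\<And>s. \<gamma> s = strip_map x X (of_real (s + r))"
proof
  have in_plane: "\<gamma> s \<in> hyp_plane" and dist: "hyp_dist (\<gamma> s) (\<gamma> t) = \<bar>s - t\<bar>" for s t
    using assms(1) by (auto simp: geodesic_line_def geodesic_on_def)
  have bot: "(\<gamma> \<longlongrightarrow> x) at_bot" and top: "(\<gamma> \<longlongrightarrow> X) at_top"
    using assms(1) by (auto simp: geodesic_line_def)
  have neq: "\<gamma> s \<noteq> X" for s
    using in_plane[of s] assms by (auto simp: hyp_plane_def)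
  have P: "poisson X (\<gamma> s) > 0" for s by (rule poisson_pos[OF in_plane assms(3)])
  define r where "r = ln (poisson X (\<gamma> 0))"
  have height: "poisson X (\<gamma> u) = exp (u + r)" for u
  proof -
    have "((\<lambda>t. hyp_dist (\<gamma> 0) (\<gamma> t) - hyp_dist (\<gamma> u) (\<gamma> t)) \<longlongrightarrow>
        ln (poisson X (\<gamma> u)) - ln (poisson X (\<gamma> 0))) at_top"
      by (rule hyp_dist_diff_tendsto[OF in_plane in_plane assms(3) top]) (simp add: in_plane)
    \<comment> \<open>Once \<open>t\<close> exceeds both parameters the two distances are
      \<open>t\<close> and \<open>t - u\<close>.\<close>
    moreover have "eventually (\<lambda>t. hyp_dist (\<gamma> 0) (\<gamma> t) - hyp_dist (\<gamma> u) (\<gamma> t) = u) at_top"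
      using eventually_ge_at_top[of "max 0 u"] by eventually_elim (simp add: dist)
    ultimately have "((\<lambda>t. u) \<longlongrightarrow> ln (poisson X (\<gamma> u)) - ln (poisson X (\<gamma> 0))) (at_top :: real filter)"
      by (simp add: tendsto_cong)
    then have "ln (poisson X (\<gamma> u)) = u + r"
      by (simp add: tendsto_const_iff r_def)
    then show ?thesis using P by (metis exp_ln)
  qed
  define w where "w s = half_plane_coord X (\<gamma> s)" for s
  have Im_w: "Im (w s) = exp (s + r)" for s
    using Im_half_plane_coord[OF assms(3) neq] height by (simp add: w_def)
  have cay: "cayley X (w s) = \<gamma> s" for s
    using assms neq unfolding w_def by (intro cayley_half_plane_coord) auto
  have Re_eq: "Re (w s) = Re (w t)" for s t
  proof -
    let ?a = "1 + (cmod (w s - w t))\<^sup>2 / (2 * Im (w s) * Im (w t))"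
    have "?a \<ge> 1" by (simp add: Im_w)
    then have "?a = cosh (arcosh ?a)" by simp
    also have "arcosh ?a = \<bar>s - t\<bar>"
      using dist[of s t] hyp_dist_cayley[OF assms(3), of "w s" "w t"] by (simp add: cay Im_w)
    finally have "(cmod (w s - w t))\<^sup>2 = (cosh (s - t) - 1) * (2 * exp (s + r) * exp (t + r))"
      by (simp add: Im_w field_simps)
    \<comment> \<open>This is the square of the difference of heights, so the full squared distance
      in the half-plane is already vertical and nothing is left for the real parts.\<close>
    also have "\<dots> = (exp (s + r) - exp (t + r))\<^sup>2"
    proof -
      have "((a / b + b / a) / 2 - 1) * (2 * (a * c) * (b * c)) = (a * c - b * c)\<^sup>2"
        if "a \<noteq> 0" "b \<noteq> 0" for a b c :: real
        using that by (simp add: field_simps power2_eq_square)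
      from this[of "exp s" "exp t" "exp r"] show ?thesis
        by (simp add: cosh_def exp_diff exp_minus exp_add)
    qed
    finally have "(Re (w s) - Re (w t))\<^sup>2 = 0"
      by (simp add: cmod_power2 Im_w)
    then show ?thesis by simp
  qed
  \<comment> \<open>The constant real part is identified at the other end, where the geodesic
    converges to \<open>x\<close>.\<close>
  have "((\<lambda>s. Re (w s)) \<longlongrightarrow> foot x X) at_bot"
    unfolding w_def foot_def half_plane_coord_def
    using assms by (intro tendsto_intros bot) auto
  moreover have "(\<lambda>s. Re (w s)) = (\<lambda>s. Re (w u))" for u
    using Re_eq by auto
  ultimately have "Re (w u) = foot x X" for u
    by (metis tendsto_const_iff trivial_limit_at_bot_linorder)
  then have "w s = Complex (foot x X) (exp (s + r))" for s
    by (simp add: complex_eq_iff Im_w)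
  then show "\<gamma> s = strip_map x X (of_real (s + r))" for s
    by (metis cay strip_map_of_real)
qed

lemma poisson_strip_map_top:
  assumes "cmod X = 1"
  shows "poisson X (strip_map x X (of_real s)) = exp s"
  unfolding strip_map_of_real by (subst poisson_cayley[OF assms]) auto

text \<open>Along the geodesic the product of the Poisson kernels at its two ends is constant; the
  constant \<open>1 + (foot x X)^2\<close> equals \<open>4 / |X - x|^2\<close>. Its logarithm is the
  parameter at which the horocycle \<open>poisson x = 1\<close> is met.\<close>

lemma poisson_strip_map_bot:
  assumes "cmod x = 1" "cmod X = 1" "x \<noteq> X"
  shows "poisson x (strip_map x X (of_real s)) = exp (ln (1 + (foot x X)\<^sup>2) - s)"
proof -
  let ?w = "Complex (foot x X) (exp s)" and ?f = "complex_of_real (foot x X)"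
  have nz: "?w + \<i> \<noteq> 0" by (rule upper_half_plane_add_i) simp
  have x: "cayley X ?w - x = 2 * \<i> * X * (?w - ?f) / ((?w + \<i>) * (?f + \<i>))"
    using cayley_minus[OF nz foot_add_i_nz, of X "foot x X"] cayley_foot[OF assms] by simp
  have "?w - ?f = \<i> * of_real (exp s)" by (simp add: complex_eq_iff)
  then have "cmod (?w - ?f) = exp s" by (simp add: norm_mult)
  then have "poisson x (strip_map x X (of_real s)) = (cmod (?f + \<i>))\<^sup>2 / exp s"
    using nz foot_add_i_nz assms unfolding poisson_def strip_map_of_real x
    by (subst one_minus_norm_cayley)
      (auto simp: norm_mult norm_divide power_divide power_mult_distrib divide_simps power2_eq_square)
  also have "(cmod (?f + \<i>))\<^sup>2 = 1 + (foot x X)\<^sup>2" by (simp add: cmod_power2)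
  also have "\<dots> = exp (ln \<dots>)" by (simp add: add_pos_nonneg)
  finally show ?thesis by (simp add: exp_diff)
qed

text \<open>The ray lies on the diameter from the antipode \<open>-c\<close>. At parameter
  \<open>0\<close> its Poisson kernel is \<open>1\<close>, so the additive constant in the
  definition can be taken to be \<open>0\<close>.\<close>

lemma busemann_ln_poisson:
  assumes "cmod c = 1"
  shows "busemann c (\<lambda>z. ln (poisson c z))"
  unfolding busemann_def
proof (intro exI conjI ballI)
  let ?\<rho> = "\<lambda>s. strip_map (-c) c (of_real s)"
  have geo: "geodesic_line (-c) c ?\<rho>"
    using geodesic_line_strip_map[of "-c" c 0, unfolded add_0_right] assms by force
  then show "geodesic_on {0..} ?\<rho>" "(?\<rho> \<longlongrightarrow> c) at_top"
    by (auto simp: geodesic_line_def geodesic_on_def)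
  have in_plane: "?\<rho> s \<in> hyp_plane" for s
    by (rule strip_map_in_plane[OF assms of_real_strip])
  fix z assume z: "z \<in> hyp_plane"
  have 1: "((\<lambda>s. hyp_dist (?\<rho> 0) (?\<rho> s) - hyp_dist z (?\<rho> s)) \<longlongrightarrow>
      ln (poisson c z) - ln (poisson c (?\<rho> 0))) at_top"
    using geo in_plane in_plane[of 0]
    by (intro hyp_dist_diff_tendsto z assms) (auto simp: geodesic_line_def)
  have 2: "eventually (\<lambda>s. hyp_dist (?\<rho> 0) (?\<rho> s) - hyp_dist z (?\<rho> s)
      = s - hyp_dist z (?\<rho> s) + 0) at_top"
    using eventually_ge_at_top[of 0]
  proof eventually_elim
    case (elim s)
    then show ?case using hyp_dist_strip_map[OF assms, of "-c" 0 s] by simp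
  qed
  have 3: "poisson c (?\<rho> 0) = 1"
    using poisson_strip_map_top[OF assms, of "-c" 0] by simp
  show "((\<lambda>s. s - hyp_dist z (?\<rho> s) + 0) \<longlongrightarrow> ln (poisson c z)) at_top"
    using Lim_transform_eventually[OF 1 2] by (simp only: 3 ln_one diff_zero)
qed

lemma foot_commute: "foot X x = - foot x X"
proof -
  have "half_plane_coord x X = - half_plane_coord X x"
    using minus_divide_right[of "\<i> * (X + x)" "X - x"] by (simp add: half_plane_coord_def add.commute[of x])
  then show ?thesis by (simp add: foot_def)
qed

text \<open>Exchanging the endpoints negates the vector field of which the strip coordinate is the
  time, so the two coordinates have constant sum. The constant is forced by the height at
  \<open>x\<close>: it is \<open>exp s\<close> in one coordinate and
  \<open>exp (ln (1 + (foot x X)^2) - s)\<close> in the other.\<close>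

lemma strip_map_reverse:
  assumes "cmod x = 1" "cmod X = 1" "x \<noteq> X" "u \<in> strip"
  shows "strip_map X x u = strip_map x X (of_real (ln (1 + (foot x X)\<^sup>2)) - u)"
proof -
  let ?f = "complex_of_real (foot x X)" and ?E = "exp u"
  have x: "x = X * (?f - \<i>) / (?f + \<i>)"
    using cayley_foot[OF assms(1-3)] by (simp add: cayley_def)
  have E: "exp (of_real (ln (1 + (foot x X)\<^sup>2)) - u) = (1 + ?f\<^sup>2) / ?E"
    by (simp add: exp_diff exp_of_real add_pos_nonneg)
  have pos: "Re ?E > 0"
    using strip_Im_pos[OF assms(4)] by (simp add: Re_exp)
  have "?E + \<i> * ?f + 1 \<noteq> 0" using pos by (auto simp: complex_eq_iff)
  then have nz: "?E + \<i> * (?f - \<i>) \<noteq> 0" by (simp add: algebra_simps)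
  have "strip_map X x u = x * (\<i> * (?E + \<i> * (?f + \<i>))) / (\<i> * (?E + \<i> * (?f - \<i>)))"
    by (simp add: strip_map_def cayley_def foot_commute[of X x] algebra_simps)
  also have "\<dots> = X * (?f - \<i>) * (?E + \<i> * (?f + \<i>)) / ((?f + \<i>) * (?E + \<i> * (?f - \<i>)))"
    by (subst x) simp
  also have "\<dots> = X * ((?f - \<i>) * (?E + \<i> * (?f + \<i>)) / ?E) / ((?f + \<i>) * (?E + \<i> * (?f - \<i>)) / ?E)"
    by simp
  also have "(?f - \<i>) * (?E + \<i> * (?f + \<i>)) / ?E = ?f + \<i> * ((1 + ?f\<^sup>2) / ?E) - \<i>"
    by (simp add: divide_simps) (simp add: algebra_simps power2_eq_square)
  also have "(?f + \<i>) * (?E + \<i> * (?f - \<i>)) / ?E = ?f + \<i> * ((1 + ?f\<^sup>2) / ?E) + \<i>"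
    by (simp add: divide_simps) (simp add: algebra_simps power2_eq_square)
  also have "X * (?f + \<i> * ((1 + ?f\<^sup>2) / ?E) - \<i>) / (?f + \<i> * ((1 + ?f\<^sup>2) / ?E) + \<i>)
      = strip_map x X (of_real (ln (1 + (foot x X)\<^sup>2)) - u)"
    by (simp only: strip_map_def cayley_def E)
  finally show ?thesis .
qed

subsection \<open>Integrals along geodesics between horocycles\<close>

definition strip_velocity :: "complex \<Rightarrow> complex \<Rightarrow> complex \<Rightarrow> complex" where
  "strip_velocity x X u = - ((strip_map x X u - x) * (strip_map x X u - X) / (X - x))"

text \<open>The coefficient of \<open>q dz^k\<close> in the coordinate \<open>u\<close>; on the real
  line it is \<open>diff_hat k q\<close> evaluated at the unit tangent vectors of the
  geodesic.\<close>

definition strip_pullback :: "nat \<Rightarrow> (complex \<Rightarrow> complex) \<Rightarrow> complex \<Rightarrow> complex \<Rightarrow> complex \<Rightarrow> complex" where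
  "strip_pullback k q x X u = q (strip_map x X u) * strip_velocity x X u ^ k"

text \<open>The integral of \<open>q\<close> along the part of the geodesic from \<open>x\<close> to \<open>X\<close> that lies between
  the horocycles \<open>poisson x = exp a\<close> and \<open>poisson X = exp b\<close>.\<close>

definition cutoff_integral ::
  "nat \<Rightarrow> (complex \<Rightarrow> complex) \<Rightarrow> complex \<Rightarrow> complex \<Rightarrow> real \<Rightarrow> real \<Rightarrow> complex" where
  "cutoff_integral k q x X a b =
     (LBINT s=ereal (ln (1 + (foot x X)\<^sup>2) - a)..ereal b. strip_pullback k q x X (of_real s))"

text \<open>\<open>\<beta> c\<close> stands for the additive constant of the Busemann function at
  \<open>c\<close>, so level \<open>t\<close> of that function is the horocycle
  \<open>ln (poisson c z) = t - \<beta> c\<close>.\<close>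

definition cutoff_rhombus ::
  "nat \<Rightarrow> (complex \<Rightarrow> complex) \<Rightarrow> complex \<Rightarrow> complex \<Rightarrow> complex \<Rightarrow> complex \<Rightarrow>
   (complex \<Rightarrow> real) \<Rightarrow> real \<Rightarrow> complex" where
  "cutoff_rhombus k q x y X Y \<beta> t =
     cutoff_integral k q x X (t - \<beta> x) (t - \<beta> X) - cutoff_integral k q y X (t - \<beta> y) (t - \<beta> X) -
     cutoff_integral k q x Y (t - \<beta> x) (t - \<beta> Y) + cutoff_integral k q y Y (t - \<beta> y) (t - \<beta> Y)"

lemma strip_map_deriv:
  assumes "cmod x = 1" "cmod X = 1" "x \<noteq> X" "u \<in> strip"
  shows "(strip_map x X has_field_derivative strip_velocity x X u) (at u)"
  using strip_map_has_derivative[OF assms] by (simp add: strip_velocity_def)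

lemma strip_velocity_eq:
  assumes "cmod x = 1" "cmod X = 1" "x \<noteq> X" "u \<in> strip"
  shows "strip_velocity x X u =
    2 * \<i> * X / (of_real (foot x X) + \<i> * exp u + \<i>)\<^sup>2 * (\<i> * exp u)"
proof -
  let ?w = "of_real (foot x X) + \<i> * exp u"
  have "?w + \<i> \<noteq> 0"
    using strip_Im_pos[OF assms(4)] by (intro upper_half_plane_add_i) (simp only: Im_exp_i)
  then have "(cayley X has_field_derivative 2 * \<i> * X / (?w + \<i>)\<^sup>2) (at ?w)"
    by (rule cayley_has_derivative)
  moreover have "((\<lambda>u. of_real (foot x X) + \<i> * exp u) has_field_derivative \<i> * exp u) (at u)"
    by (auto intro!: derivative_eq_intros)
  ultimately have "(strip_map x X has_field_derivative 2 * \<i> * X / (?w + \<i>)\<^sup>2 * (\<i> * exp u)) (at u)"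
    unfolding strip_map_def[abs_def] by (rule DERIV_chain2)
  then show ?thesis
    using strip_map_deriv[OF assms] DERIV_unique by blast
qed

lemma holomorphic_strip_map:
  assumes "cmod x = 1" "cmod X = 1" "x \<noteq> X"
  shows "strip_map x X holomorphic_on strip"
  using strip_map_deriv[OF assms] by (intro holomorphic_onI)
    (auto simp: field_differentiable_def intro: has_field_derivative_at_within)

lemma holomorphic_strip_pullback:
  assumes "cmod x = 1" "cmod X = 1" "x \<noteq> X" "q holomorphic_on hyp_plane"
  shows "strip_pullback k q x X holomorphic_on strip"
proof -
  have "(q \<circ> strip_map x X) holomorphic_on strip"
    using assms strip_map_in_plane
    by (intro holomorphic_on_compose_gen[OF holomorphic_strip_map assms(4)]) auto
  then show ?thesis
    unfolding strip_pullback_def[abs_def] strip_velocity_def comp_def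
    using assms by (intro holomorphic_intros holomorphic_strip_map) auto
qed

lemma strip_pullback_primitive:
  assumes "cmod x = 1" "cmod X = 1" "x \<noteq> X" "q holomorphic_on hyp_plane"
  obtains F where "\<And>u. u \<in> strip \<Longrightarrow> (F has_field_derivative strip_pullback k q x X u) (at u)"
proof -
  obtain F where "\<And>u. u \<in> strip \<Longrightarrow> (F has_field_derivative strip_pullback k q x X u) (at u within strip)"
    using holomorphic_convex_primitive'[OF convex_strip open_strip holomorphic_strip_pullback[OF assms]]
    by blast
  then show ?thesis
    by (intro that) (auto simp: at_within_open[OF _ open_strip])
qed

lemma has_vector_derivative_of_real_compose:
  assumes "(F has_field_derivative D) (at (of_real s))"
  shows "((\<lambda>s. F (complex_of_real s)) has_vector_derivative D) (at s within S)"
  using has_vector_derivative_real_field[OF assms]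
  by (rule has_vector_derivative_at_within)

lemma continuous_strip_pullback_real:
  assumes "cmod x = 1" "cmod X = 1" "x \<noteq> X" "q holomorphic_on hyp_plane"
  shows "continuous_on S (\<lambda>s. strip_pullback k q x X (of_real s))"
  by (rule continuous_on_compose2[OF holomorphic_on_imp_continuous_on[OF
      holomorphic_strip_pullback[OF assms]]]) (auto intro!: continuous_intros)

lemma cutoff_integral_primitive:
  assumes "cmod x = 1" "cmod X = 1" "x \<noteq> X" "q holomorphic_on hyp_plane"
    and F: "\<And>u. u \<in> strip \<Longrightarrow> (F has_field_derivative strip_pullback k q x X u) (at u)"
  shows "cutoff_integral k q x X a b = F (of_real b) - F (of_real (ln (1 + (foot x X)\<^sup>2) - a))"
  unfolding cutoff_integral_def
  by (rule interval_integral_FTC_finite[where F = "\<lambda>s. F (complex_of_real s)"])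
    (use assms in \<open>auto intro!: continuous_strip_pullback_real has_vector_derivative_of_real_compose F\<close>)

lemma interval_integral_shift:
  fixes f :: "real \<Rightarrow> complex"
  shows "(LBINT s=ereal a..ereal b. f (s + r)) = (LBINT s=ereal (a + r)..ereal (b + r). f s)"
proof -
  have *: "(LBINT s:{c<..<d}. f (s + r)) = (LBINT s:{c + r<..<d + r}. f s)" for c d
    unfolding set_lebesgue_integral_def
    by (subst (2) lborel_integral_real_affine[of 1 _ r])
      (auto intro!: Bochner_Integration.integral_cong simp: indicator_def add.commute)
  show ?thesis
    unfolding interval_lebesgue_integral_def using *[of a b] *[of b a] by auto
qed

text \<open>A parametrisation with the same endpoints is a shift of \<open>strip_map x X\<close>,
  and the shift drops out of the integral. The crossing times are determined by the levels because
  both Poisson kernels are exponentials of the parameter.\<close>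

lemma geodesic_integral_eq_cutoff:
  assumes x: "cmod x = 1" "cmod X = 1" "x \<noteq> X"
    and geo: "geodesic_line x X \<gamma>"
    and s: "ln (poisson x (\<gamma> s)) = a" and S: "ln (poisson X (\<gamma> S)) = b"
  shows "(LBINT s=ereal s..ereal S. diff_hat k q (velocity \<gamma> s)) = cutoff_integral k q x X a b"
proof -
  obtain r where r: "\<And>s. \<gamma> s = strip_map x X (of_real (s + r))"
    using geodesic_line_eq_strip_map[OF geo x] by blast
  have "(\<gamma> has_vector_derivative strip_velocity x X (of_real (s + r))) (at s)" for s
  proof -
    have "((\<lambda>s. complex_of_real (s + r)) has_vector_derivative 1) (at s)"
      by (auto intro!: derivative_eq_intros)
    from field_vector_diff_chain_at[OF this strip_map_deriv[OF x of_real_strip]]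
    show ?thesis by (simp add: comp_def r[abs_def] del: of_real_add)
  qed
  then have "vector_derivative \<gamma> (at s) = strip_velocity x X (of_real (s + r))" for s
    by (intro vector_derivative_at)
  then have "diff_hat k q (velocity \<gamma> s) = strip_pullback k q x X (of_real (s + r))" for s
    by (simp only: diff_hat_def velocity_def strip_pullback_def case_prod_conv r)
  then have "(LBINT s=ereal s..ereal S. diff_hat k q (velocity \<gamma> s)) =
      (LBINT s=ereal (s + r)..ereal (S + r). strip_pullback k q x X (of_real s))"
    using interval_integral_shift[of s S "\<lambda>s. strip_pullback k q x X (of_real s)" r] by simp
  moreover have "s + r = ln (1 + (foot x X)\<^sup>2) - a"
    using s unfolding r by (simp add: poisson_strip_map_bot[OF x] del: of_real_add)
  moreover have "S + r = b"
    using S unfolding r by (simp add: poisson_strip_map_top x del: of_real_add)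
  ultimately show ?thesis by (simp add: cutoff_integral_def)
qed

text \<open>All freedom in Busemann functions, parametrisations and crossing times collapses to one
  additive constant per ideal point.\<close>

lemma truncated_rhombus_eq_cutoff:
  assumes choice: "rhombus_choice x y X Y b \<gamma> \<tau>"
    and circle: "cmod x = 1" "cmod y = 1" "cmod X = 1" "cmod Y = 1"
    and neq: "x \<noteq> X" "x \<noteq> Y" "y \<noteq> X" "y \<noteq> Y"
  obtains \<beta> where "\<And>k q t. truncated_rhombus x y X Y (diff_hat k q) \<gamma> \<tau> t = cutoff_rhombus k q x y X Y \<beta> t"
proof -
  have "\<forall>c\<in>{x, y, X, Y}. \<exists>\<beta>. \<forall>z\<in>hyp_plane. b c z = ln (poisson c z) + \<beta>"
  proof
    fix c assume c: "c \<in> {x, y, X, Y}"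
    then have "busemann c (b c)" "cmod c = 1"
      using choice circle by (auto simp: rhombus_choice_def)
    then show "\<exists>\<beta>. \<forall>z\<in>hyp_plane. b c z = ln (poisson c z) + \<beta>"
      using busemann_eq_ln_poisson by metis
  qed
  then obtain \<beta> where \<beta>: "\<And>c z. c \<in> {x, y, X, Y} \<Longrightarrow> z \<in> hyp_plane \<Longrightarrow> b c z = ln (poisson c z) + \<beta> c"
    by metis
  have seg: "(LBINT s=ereal (\<tau> z z Z t)..ereal (\<tau> Z z Z t). diff_hat k q (velocity (\<gamma> z Z) s))
      = cutoff_integral k q z Z (t - \<beta> z) (t - \<beta> Z)"
    if z: "z \<in> {x, y}" and Z: "Z \<in> {X, Y}" for k q z Z t
  proof (rule geodesic_integral_eq_cutoff)
    have geo: "geodesic_line z Z (\<gamma> z Z)" and \<tau>: "\<And>c. c \<in> {z, Z} \<Longrightarrow> b c (\<gamma> z Z (\<tau> c z Z t)) = t"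
      using choice z Z by (auto simp: rhombus_choice_def)
    show "geodesic_line z Z (\<gamma> z Z)" by (rule geo)
    have in_plane: "\<gamma> z Z s \<in> hyp_plane" for s
      using geo by (auto simp: geodesic_line_def geodesic_on_def)
    have "ln (poisson c (\<gamma> z Z (\<tau> c z Z t))) = t - \<beta> c" if c: "c \<in> {z, Z}" for c
      using \<tau>[OF c] \<beta>[of c, OF _ in_plane, of "\<tau> c z Z t"] c z Z by auto
    then show "ln (poisson z (\<gamma> z Z (\<tau> z z Z t))) = t - \<beta> z"
      and "ln (poisson Z (\<gamma> z Z (\<tau> Z z Z t))) = t - \<beta> Z"
      by auto
  qed (use z Z circle neq in auto)
  show thesis
    by (rule that[of \<beta>]) (simp add: truncated_rhombus_def cutoff_rhombus_def seg)
qed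

text \<open>\<open>has_rhombus\<close> quantifies over all admissible choices and would hold of
  every number if there were none; uniqueness of the limit depends on this existence.\<close>

lemma rhombus_choice_exists:
  assumes circle: "cmod x = 1" "cmod y = 1" "cmod X = 1" "cmod Y = 1"
    and neq: "x \<noteq> X" "x \<noteq> Y" "y \<noteq> X" "y \<noteq> Y"
  shows "\<exists>b \<gamma> \<tau>. rhombus_choice x y X Y b \<gamma> \<tau>"
proof (intro exI)
  let ?b = "\<lambda>c z. ln (poisson c z)"
  let ?\<gamma> = "\<lambda>z Z s. strip_map z Z (of_real s)"
  let ?\<tau> = "\<lambda>c z Z t. if c = Z then t else ln (1 + (foot z Z)\<^sup>2) - t"
  show "rhombus_choice x y X Y ?b ?\<gamma> ?\<tau>"
    unfolding rhombus_choice_def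
  proof (intro conjI ballI allI)
    fix c assume "c \<in> {x, y, X, Y}"
    then show "busemann c (?b c)" using circle by (auto intro: busemann_ln_poisson)
  next
    fix z Z assume "z \<in> {x, y}" "Z \<in> {X, Y}"
    then have z: "cmod z = 1" "cmod Z = 1" "z \<noteq> Z" using circle neq by auto
    show "geodesic_line z Z (?\<gamma> z Z)"
      using geodesic_line_strip_map[OF z, of 0] by simp
    fix c t assume "c \<in> {z, Z}"
    then show "ln (poisson c (strip_map z Z (of_real (?\<tau> c z Z t)))) = t"
      using z(3) by (auto simp: poisson_strip_map_top[OF z(2)] poisson_strip_map_bot[OF z]
          simp del: of_real_diff)
  qed
qed

subsection \<open>Contraction at the ends\<close>

text \<open>Geodesics with a common endpoint are parallel vertical lines in the half-plane model,
  where the coefficient of \<open>q\<close> is controlled by Cauchy's estimate.\<close>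

definition half_plane_pullback :: "nat \<Rightarrow> (complex \<Rightarrow> complex) \<Rightarrow> complex \<Rightarrow> complex \<Rightarrow> complex" where
  "half_plane_pullback k q X w = q (cayley X w) * (2 * \<i> * X / (w + \<i>)\<^sup>2) ^ k"

text \<open>Up to the factor \<open>2^(k/2)\<close> the left-hand side is the pointwise norm of
  \<open>q\<close> for the inner product on \<open>k\<close>-differentials, hence invariant under
  isometries.\<close>

definition hyperbolic_bound :: "nat \<Rightarrow> (complex \<Rightarrow> complex) \<Rightarrow> real \<Rightarrow> bool" where
  "hyperbolic_bound k q C \<longleftrightarrow> (\<forall>z\<in>hyp_plane. cmod (q z) * (1 - (cmod z)\<^sup>2) ^ k \<le> C)"

lemma hyperbolic_bound_nonneg:
  assumes "hyperbolic_bound k q C"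
  shows "C \<ge> 0"
proof -
  have "0 \<in> hyp_plane" by (simp add: hyp_plane_def)
  then have "cmod (q 0) \<le> C" using assms by (force simp: hyperbolic_bound_def)
  then show ?thesis using norm_ge_zero[of "q 0"] by linarith
qed

lemma strip_pullback_eq_half_plane_pullback:
  assumes "cmod x = 1" "cmod X = 1" "x \<noteq> X"
  shows "strip_pullback k q x X (of_real s) =
    half_plane_pullback k q X (Complex (foot x X) (exp s)) * (\<i> * of_real (exp s)) ^ k"
proof -
  have "of_real (foot x X) + \<i> * exp (complex_of_real s) = Complex (foot x X) (exp s)"
    by (simp add: complex_eq_iff Re_exp Im_exp)
  then show ?thesis
    by (simp only: strip_pullback_def half_plane_pullback_def strip_map_of_real exp_of_real
        strip_velocity_eq[OF assms of_real_strip] power_mult_distrib mult.assoc)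
qed

lemma holomorphic_half_plane_pullback:
  assumes "cmod X = 1" "q holomorphic_on hyp_plane"
  shows "half_plane_pullback k q X holomorphic_on {w. Im w > 0}"
proof -
  have nz: "w + \<i> \<noteq> 0" if "Im w > 0" for w using that by (intro upper_half_plane_add_i) simp
  have "cayley X holomorphic_on {w. Im w > 0}"
    unfolding cayley_def using nz by (intro holomorphic_intros) auto
  from holomorphic_on_compose_gen[OF this assms(2)]
  have "(\<lambda>w. q (cayley X w)) holomorphic_on {w. Im w > 0}"
    using assms(1) cayley_in_plane by (auto simp: comp_def)
  then show ?thesis
    unfolding half_plane_pullback_def using nz by (intro holomorphic_intros) auto
qed

text \<open>The Cayley map is an isometry: \<open>1 - |z|^2 = 2 Im w |dz/dw|\<close>, so the
  invariant norm reappears with \<open>2 Im w\<close> as weight.\<close>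

lemma half_plane_pullback_bound:
  assumes X: "cmod X = 1" and q: "hyperbolic_bound k q C" and w: "Im w > 0"
  shows "cmod (half_plane_pullback k q X w) \<le> C / (2 * Im w) ^ k"
proof -
  let ?z = "cayley X w"
  have nz: "w + \<i> \<noteq> 0" using w upper_half_plane_add_i[of w] by auto
  have "1 - (cmod ?z)\<^sup>2 = 4 * Im w / (cmod (w + \<i>))\<^sup>2"
    using w by (intro one_minus_norm_cayley X) auto
  then have D: "cmod (2 * \<i> * X / (w + \<i>)\<^sup>2) = (1 - (cmod ?z)\<^sup>2) / (2 * Im w)"
    using w nz X by (simp add: norm_divide norm_mult norm_power)
  have "cmod (half_plane_pullback k q X w) = cmod (q ?z) * ((1 - (cmod ?z)\<^sup>2) / (2 * Im w)) ^ k"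
    by (simp only: half_plane_pullback_def norm_mult norm_power D)
  then have "cmod (half_plane_pullback k q X w) = cmod (q ?z) * (1 - (cmod ?z)\<^sup>2) ^ k / (2 * Im w) ^ k"
    by (simp only: power_divide times_divide_eq_right)
  also have "\<dots> \<le> C / (2 * Im w) ^ k"
    using q cayley_in_plane[OF X w] w by (intro divide_right_mono) (auto simp: hyperbolic_bound_def)
  finally show ?thesis .
qed

text \<open>Cauchy's estimate on the disc of radius \<open>Im w / 2\<close>. Heights there stay
  above \<open>Im w / 2\<close>, so the function is at most \<open>C / Im w ^ k\<close>; the radius
  contributes one further power of the height and the factor \<open>2\<close>.\<close>

lemma half_plane_pullback_deriv_bound:
  assumes X: "cmod X = 1" and hol: "q holomorphic_on hyp_plane" and q: "hyperbolic_bound k q C"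
    and w: "Im w > 0"
  shows "cmod (deriv (half_plane_pullback k q X) w) \<le> 2 * C / Im w ^ Suc k"
proof -
  let ?f = "half_plane_pullback k q X"
  have Im: "Im v \<ge> Im w / 2" if "v \<in> cball w (Im w / 2)" for v
    using that abs_Im_le_cmod[of "w - v"] by (auto simp: dist_norm)
  have f: "?f holomorphic_on cball w (Im w / 2)"
    using holomorphic_half_plane_pullback[OF X hol]
    by (rule holomorphic_on_subset) (use w Im in fastforce)
  have C: "C \<ge> 0" by (rule hyperbolic_bound_nonneg[OF q])
  have "cmod ((deriv ^^ 1) ?f w) \<le> fact 1 * (C / Im w ^ k) / (Im w / 2) ^ 1"
  proof (rule Cauchy_inequality)
    show "?f holomorphic_on ball w (Im w / 2)"
      using f by (rule holomorphic_on_subset) auto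
    show "continuous_on (cball w (Im w / 2)) ?f"
      using f by (rule holomorphic_on_imp_continuous_on)
    fix v assume "cmod (w - v) = Im w / 2"
    then have v: "Im v \<ge> Im w / 2" by (intro Im) (simp add: dist_norm)
    have "cmod (?f v) \<le> C / (2 * Im v) ^ k"
      using v w by (intro half_plane_pullback_bound X q) linarith
    also have "\<dots> \<le> C / Im w ^ k"
      using v w C by (intro divide_left_mono power_mono mult_pos_pos zero_less_power) auto
    finally show "cmod (?f v) \<le> C / Im w ^ k" .
  qed (use w in auto)
  then show ?thesis using w by (simp add: field_simps)
qed

lemma half_plane_pullback_diff_bound:
  assumes X: "cmod X = 1" and hol: "q holomorphic_on hyp_plane" and q: "hyperbolic_bound k q C"
    and y: "y > 0"
  shows "cmod (half_plane_pullback k q X (Complex a y) - half_plane_pullback k q X (Complex b y))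
    \<le> 2 * C / y ^ Suc k * \<bar>a - b\<bar>"
proof -
  let ?S = "{w. Im w = y}" and ?f = "half_plane_pullback k q X"
  have "cmod (?f (Complex a y) - ?f (Complex b y)) \<le> 2 * C / y ^ Suc k * cmod (Complex a y - Complex b y)"
  proof (rule field_differentiable_bound)
    have "?S = {w. \<i> \<bullet> w = y}" by (simp add: inner_complex_def)
    then show "convex ?S" by (simp only: convex_hyperplane)
    fix w assume w: "w \<in> ?S"
    have "(?f has_field_derivative deriv ?f w) (at w)"
      using holomorphic_derivI[OF holomorphic_half_plane_pullback[OF X hol] open_halfspace_Im_gt] w y
      by auto
    then show "(?f has_field_derivative deriv ?f w) (at w within ?S)"
      by (rule has_field_derivative_at_within)
    show "cmod (deriv ?f w) \<le> 2 * C / y ^ Suc k"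
      using half_plane_pullback_deriv_bound[OF X hol q, of w] w y by simp
  qed auto
  also have "cmod (Complex a y - Complex b y) = \<bar>a - b\<bar>"
    by (simp add: cmod_def)
  finally show ?thesis .
qed

text \<open>At height \<open>exp s\<close> the difference of coefficients is of order
  \<open>exp (- (k + 1) s)\<close>, whereas \<open>dz^k\<close> contributes only
  \<open>exp (k s)\<close>. The surplus power is the contraction of asymptotic geodesics.\<close>

lemma strip_pullback_diff_bound:
  assumes "cmod x = 1" "cmod x' = 1" "cmod X = 1" "x \<noteq> X" "x' \<noteq> X"
    and hol: "q holomorphic_on hyp_plane" and q: "hyperbolic_bound k q C"
  shows "cmod (strip_pullback k q x X (of_real s) - strip_pullback k q x' X (of_real s))
    \<le> 2 * C * \<bar>foot x X - foot x' X\<bar> * exp (- s)"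
proof -
  let ?f = "half_plane_pullback k q X"
  have "cmod (strip_pullback k q x X (of_real s) - strip_pullback k q x' X (of_real s))
      = cmod (?f (Complex (foot x X) (exp s)) - ?f (Complex (foot x' X) (exp s))) * exp s ^ k"
    using assms by (simp add: strip_pullback_eq_half_plane_pullback norm_mult norm_power
        flip: left_diff_distrib)
  also have "\<dots> \<le> 2 * C / exp s ^ Suc k * \<bar>foot x X - foot x' X\<bar> * exp s ^ k"
    by (intro mult_right_mono half_plane_pullback_diff_bound assms) auto
  also have "\<dots> = 2 * C * \<bar>foot x X - foot x' X\<bar> * exp (- s)"
    by (simp add: exp_minus field_simps)
  finally show ?thesis .
qed

text \<open>Backward traversal negates the velocity. This reduces the ends at the initial points to
  the case of ends at the terminal points.\<close>

lemma strip_pullback_reverse: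
  assumes "cmod x = 1" "cmod X = 1" "x \<noteq> X"
  shows "strip_pullback k q x X (of_real (ln (1 + (foot x X)\<^sup>2) - s))
    = (- 1) ^ k * strip_pullback k q X x (of_real s)"
proof -
  let ?u = "complex_of_real (ln (1 + (foot x X)\<^sup>2) - s)"
  have eq: "strip_map X x (of_real s) = strip_map x X ?u"
    using strip_map_reverse[OF assms of_real_strip, of s] by simp
  have "(z - X) * (z - x) / (x - X) = - ((z - x) * (z - X) / (X - x))" for z
    by (metis minus_divide_right minus_diff_eq mult.commute)
  then have "strip_velocity X x (of_real s) = - strip_velocity x X ?u"
    unfolding strip_velocity_def eq by (rule arg_cong)
  then have "strip_velocity X x (of_real s) ^ k = (- 1) ^ k * strip_velocity x X ?u ^ k"
    by (simp only: power_minus[of "strip_velocity x X ?u"])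
  moreover have "(- 1) ^ k * (- 1) ^ k = (1 :: complex)"
    by (simp flip: power_mult_distrib)
  ultimately show ?thesis
    unfolding strip_pullback_def eq by (simp add: mult_ac)
qed

text \<open>Mean value inequality against the majorant \<open>- B * exp (- s)\<close>, whose total
  increase from \<open>a\<close> to infinity is \<open>B * exp (- a)\<close>; hence the bound does
  not depend on \<open>b\<close>.\<close>

lemma primitive_diff_bound:
  fixes F G :: "complex \<Rightarrow> complex"
  assumes F: "\<And>s. s \<ge> a \<Longrightarrow> (F has_field_derivative f (of_real s)) (at (of_real s))"
    and G: "\<And>s. s \<ge> a \<Longrightarrow> (G has_field_derivative g (of_real s)) (at (of_real s))"
    and bound: "\<And>s. s \<ge> a \<Longrightarrow> cmod (f (of_real s) - g (of_real s)) \<le> B * exp (- s)"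
    and "a \<le> b"
  shows "cmod ((F (of_real b) - G (of_real b)) - (F (of_real a) - G (of_real a))) \<le> B * exp (- a)"
proof (cases "a < b")
  case True
  have B: "B \<ge> 0"
    using order_trans[OF norm_ge_zero bound[of a]] by (simp add: zero_le_mult_iff)
  have D: "((\<lambda>s. F (of_real s) - G (of_real s)) has_vector_derivative f (of_real s) - g (of_real s)) (at s within S)"
    if "s \<ge> a" for s S
    using that by (intro derivative_intros has_vector_derivative_of_real_compose F G)
  have "cmod ((F (of_real b) - G (of_real b)) - (F (of_real a) - G (of_real a)))
      \<le> (- B * exp (- b)) - (- B * exp (- a))"
  proof (rule differentiable_bound_general[OF True, where f' = "\<lambda>s. f (of_real s) - g (of_real s)"
        and \<phi>' = "\<lambda>s. B * exp (- s)"])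
    show "continuous_on {a..b} (\<lambda>s. F (complex_of_real s) - G (complex_of_real s))"
      by (rule continuous_on_vector_derivative[OF D]) auto
    show "((\<lambda>s. - B * exp (- s)) has_vector_derivative B * exp (- s)) (at s)" for s
      by (auto intro!: derivative_eq_intros simp flip: has_real_derivative_iff_has_vector_derivative)
  qed (use D bound in \<open>auto intro!: continuous_intros\<close>)
  also have "\<dots> \<le> B * exp (- a)" using B by simp
  finally show ?thesis .
next
  case False
  then have "cmod (f (of_real a) - g (of_real a)) \<le> B * exp (- a)" "a = b"
    using bound[of a] \<open>a \<le> b\<close> by auto
  then show ?thesis using norm_ge_zero[of "f (of_real a) - g (of_real a)"] by (simp del: norm_ge_zero)
qed

lemma cutoff_rhombus_Cauchy:
  assumes circle: "cmod x = 1" "cmod y = 1" "cmod X = 1" "cmod Y = 1"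
    and neq: "x \<noteq> X" "x \<noteq> Y" "y \<noteq> X" "y \<noteq> Y"
  obtains K where "\<And>k q C t t'. q holomorphic_on hyp_plane \<Longrightarrow> hyperbolic_bound k q C \<Longrightarrow> t \<le> t' \<Longrightarrow>
    cmod (cutoff_rhombus k q x y X Y \<beta> t' - cutoff_rhombus k q x y X Y \<beta> t) \<le> C * K * exp (- t)"
proof
  fix k q C and t t' :: real
  assume hol: "q holomorphic_on hyp_plane" and q: "hyperbolic_bound k q C" and t: "t \<le> t'"
  have "\<exists>F. \<forall>u\<in>strip. (F has_field_derivative strip_pullback k q z Z u) (at u)"
    if "cmod z = 1" "cmod Z = 1" "z \<noteq> Z" for z Z
    using strip_pullback_primitive[OF that hol] by metis
  then obtain F where F: "\<And>z Z u. \<lbrakk>cmod z = 1; cmod Z = 1; z \<noteq> Z; u \<in> strip\<rbrakk> \<Longrightarrow>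
      (F z Z has_field_derivative strip_pullback k q z Z u) (at u)"
    by metis
  \<comment> \<open>The same primitive with the parameter reversed, so that growing arguments run
    towards the initial point \<open>z\<close>.\<close>
  define G where "G z Z u = F z Z (of_real (ln (1 + (foot z Z)\<^sup>2)) - u)" for z Z u
  have cut: "cutoff_integral k q z Z a b = F z Z (of_real b) - G z Z (of_real a)"
    if "cmod z = 1" "cmod Z = 1" "z \<noteq> Z" for z Z a b
    using cutoff_integral_primitive[OF that hol F[OF that]] by (simp add: G_def)
  have G: "(G z Z has_field_derivative - ((- 1) ^ k * strip_pullback k q Z z (of_real s))) (at (of_real s))"
    if z: "cmod z = 1" "cmod Z = 1" "z \<noteq> Z" for z Z s
  proof -
    let ?L = "complex_of_real (ln (1 + (foot z Z)\<^sup>2))"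
    have "(F z Z has_field_derivative (- 1) ^ k * strip_pullback k q Z z (of_real s)) (at (?L - of_real s))"
      using F[OF z, of "?L - of_real s"] strip_pullback_reverse[OF z, of k q s]
      by (simp add: strip_def)
    moreover have "((\<lambda>u. ?L - u) has_field_derivative - 1) (at (of_real s))"
      by (auto intro!: derivative_eq_intros)
    ultimately show ?thesis
      unfolding G_def[abs_def] using DERIV_chain2 by fastforce
  qed
  let ?K = "\<lambda>z z' Z. 2 * C * \<bar>foot z Z - foot z' Z\<bar>"
  have top: "cmod ((F x Z (of_real (t' - r)) - F y Z (of_real (t' - r)))
      - (F x Z (of_real (t - r)) - F y Z (of_real (t - r)))) \<le> ?K x y Z * exp (- (t - r))"
    if "Z \<in> {X, Y}" for Z r
    by (rule primitive_diff_bound[where f = "strip_pullback k q x Z" and g = "strip_pullback k q y Z"])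
       (use that t circle neq in \<open>auto intro!: F strip_pullback_diff_bound hol q simp: strip_def\<close>)
  have bot: "cmod ((G z X (of_real (t' - r)) - G z Y (of_real (t' - r)))
      - (G z X (of_real (t - r)) - G z Y (of_real (t - r)))) \<le> ?K X Y z * exp (- (t - r))"
    if z: "z \<in> {x, y}" for z r
  proof (rule primitive_diff_bound[where f = "\<lambda>u. - ((- 1) ^ k * strip_pullback k q X z u)"
        and g = "\<lambda>u. - ((- 1) ^ k * strip_pullback k q Y z u)"])
    fix s
    have "cmod (- ((- 1) ^ k * strip_pullback k q X z (of_real s)) - - ((- 1) ^ k * strip_pullback k q Y z (of_real s)))
        = cmod (strip_pullback k q X z (of_real s) - strip_pullback k q Y z (of_real s))"
      by (simp add: norm_mult norm_power norm_minus_commute flip: right_diff_distrib)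
    also have "\<dots> \<le> ?K X Y z * exp (- s)"
      by (rule strip_pullback_diff_bound) (use z circle neq hol q in auto)
    finally show "cmod (- ((- 1) ^ k * strip_pullback k q X z (of_real s)) - - ((- 1) ^ k * strip_pullback k q Y z (of_real s)))
        \<le> ?K X Y z * exp (- s)" .
  qed (use z t circle neq in \<open>auto intro!: G\<close>)
  let ?top = "\<lambda>Z. (F x Z (of_real (t' - \<beta> Z)) - F y Z (of_real (t' - \<beta> Z)))
      - (F x Z (of_real (t - \<beta> Z)) - F y Z (of_real (t - \<beta> Z)))"
  let ?bot = "\<lambda>z. (G z X (of_real (t' - \<beta> z)) - G z Y (of_real (t' - \<beta> z)))
      - (G z X (of_real (t - \<beta> z)) - G z Y (of_real (t - \<beta> z)))"
  have triangle: "cmod (a - b - c + d) \<le> cmod a + cmod b + cmod c + cmod d" for a b c d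
    using norm_triangle_ineq[of "a - b - c" d] norm_triangle_ineq4[of "a - b" c]
      norm_triangle_ineq4[of a b] by linarith
  \<comment> \<open>The ends are regrouped by ideal point: at \<open>X\<close> and \<open>Y\<close>
    the geodesics from \<open>x\<close> and \<open>y\<close> are paired, at \<open>x\<close> and
    \<open>y\<close> those to \<open>X\<close> and \<open>Y\<close>.\<close>
  have "cutoff_rhombus k q x y X Y \<beta> t' - cutoff_rhombus k q x y X Y \<beta> t
      = ?top X - ?top Y - ?bot x + ?bot y"
    unfolding cutoff_rhombus_def using circle neq by (simp add: cut del: of_real_diff)
  then have "cmod (cutoff_rhombus k q x y X Y \<beta> t' - cutoff_rhombus k q x y X Y \<beta> t)
      \<le> cmod (?top X) + cmod (?top Y) + cmod (?bot x) + cmod (?bot y)"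
    by (simp only: triangle)
  also have "\<dots> \<le> ?K x y X * exp (- (t - \<beta> X)) + ?K x y Y * exp (- (t - \<beta> Y))
      + ?K X Y x * exp (- (t - \<beta> x)) + ?K X Y y * exp (- (t - \<beta> y))"
    by (intro add_mono top bot) auto
  also have "\<dots> = C * (2 * (\<bar>foot x X - foot y X\<bar> * exp (\<beta> X) + \<bar>foot x Y - foot y Y\<bar> * exp (\<beta> Y)
      + \<bar>foot X x - foot Y x\<bar> * exp (\<beta> x) + \<bar>foot X y - foot Y y\<bar> * exp (\<beta> y))) * exp (- t)"
    by (simp add: exp_diff exp_minus field_simps)
  finally show "cmod (cutoff_rhombus k q x y X Y \<beta> t' - cutoff_rhombus k q x y X Y \<beta> t) \<le>
    C * (2 * (\<bar>foot x X - foot y X\<bar> * exp (\<beta> X) + \<bar>foot x Y - foot y Y\<bar> * exp (\<beta> Y)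
      + \<bar>foot X x - foot Y x\<bar> * exp (\<beta> x) + \<bar>foot X y - foot Y y\<bar> * exp (\<beta> y))) * exp (- t)" .
qed

subsection \<open>The area integral in strip coordinates\<close>

lemma inj_on_strip_map:
  assumes "cmod X = 1"
  shows "inj_on (strip_map x X) strip"
proof (rule inj_onI)
  fix u v assume u: "u \<in> strip" and v: "v \<in> strip" and eq: "strip_map x X u = strip_map x X v"
  have nz: "of_real (foot x X) + \<i> * exp u + \<i> \<noteq> 0" if "u \<in> strip" for u
    using strip_Im_pos[OF that] by (intro upper_half_plane_add_i) (simp only: Im_exp_i)
  have "of_real (foot x X) + \<i> * exp u = of_real (foot x X) + \<i> * exp v"
    using eq assms unfolding strip_map_def by (intro cayley_inject[OF nz[OF u] nz[OF v], of X]) auto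
  then have "exp u = exp v" by simp
  moreover have "\<bar>Im u - Im v\<bar> < 2 * pi" using u v unfolding strip_def mem_Collect_eq by linarith
  ultimately show "u = v" by (rule exp_complex_eqI[rotated])
qed

lemma strip_map_image:
  assumes "cmod X = 1"
  shows "strip_map x X ` strip = hyp_plane"
proof
  show "strip_map x X ` strip \<subseteq> hyp_plane"
    using strip_map_in_plane[OF assms] by auto
  show "hyp_plane \<subseteq> strip_map x X ` strip"
  proof
    fix z assume "z \<in> hyp_plane"
    then obtain w where w: "Im w > 0" "z = cayley X w" using in_plane_cayleyE[OF assms] by blast
    let ?v = "- \<i> * (w - of_real (foot x X))"
    have "?v \<noteq> 0" using w by (auto simp: complex_eq_iff)
    moreover have "Ln ?v \<in> strip"
      using w Re_Ln_pos_lt_imp[of ?v] by (simp add: strip_def)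
    ultimately show "z \<in> strip_map x X ` strip"
      using w by (intro image_eqI[of _ _ "Ln ?v"]) (auto simp: strip_map_def algebra_simps)
  qed
qed

text \<open>Equivalently, the hyperbolic metric in the strip is \<open>|du| / cos (Im u)\<close>;
  all powers of the cosine in the area integral come from here.\<close>

lemma norm_strip_velocity:
  assumes "cmod x = 1" "cmod X = 1" "x \<noteq> X" "u \<in> strip"
  shows "1 - (cmod (strip_map x X u))\<^sup>2 = 2 * cos (Im u) * cmod (strip_velocity x X u)"
proof -
  let ?w = "of_real (foot x X) + \<i> * exp u"
  have Im: "Im ?w = exp (Re u) * cos (Im u)" by (rule Im_exp_i)
  have pos: "Im ?w > 0" unfolding Im by (rule strip_Im_pos[OF assms(4)])
  have "1 - (cmod (strip_map x X u))\<^sup>2 = 4 * Im ?w / (cmod (?w + \<i>))\<^sup>2"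
    unfolding strip_map_def using pos by (intro one_minus_norm_cayley assms) auto
  also have "\<dots> = 2 * cos (Im u) * cmod (strip_velocity x X u)"
    unfolding strip_velocity_eq[OF assms] Im
    using assms by (simp add: norm_mult norm_divide norm_power)
  finally show ?thesis .
qed

lemma strip_velocity_nz:
  assumes "cmod x = 1" "cmod X = 1" "x \<noteq> X" "u \<in> strip"
  shows "strip_velocity x X u \<noteq> 0"
proof -
  have "(cmod (strip_map x X u))\<^sup>2 < 1"
    using strip_map_in_plane[OF assms(2,4), of x] by (simp add: hyp_plane_def power_less_one_iff)
  then show ?thesis using norm_strip_velocity[OF assms] by auto
qed

lemma exp_neg_abs_le: "exp (- \<bar>s\<bar>) \<le> 2 * inverse (1 + s\<^sup>2)" for s :: real
proof -
  have "(1 + s\<^sup>2) / 2 \<le> exp \<bar>s\<bar>"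
    using exp_lower_Taylor_quadratic[of "\<bar>s\<bar>"] by simp
  moreover have "(1 + s\<^sup>2) / 2 > 0"
    by (simp add: add_pos_nonneg)
  ultimately have "inverse (exp \<bar>s\<bar>) \<le> inverse ((1 + s\<^sup>2) / 2)"
    by (rule le_imp_inverse_le)
  then show ?thesis
    by (simp only: exp_minus inverse_divide divide_inverse[of 2])
qed

text \<open>The modulus is \<open>2 exp (Re u) / |w + i|^2\<close>. The numerator gives decay to the
  left, where \<open>|w + i| >= 1\<close>, and the denominator gives decay to the right. Both
  estimates are uniform in \<open>Im u\<close>.\<close>

lemma strip_velocity_decay:
  assumes "cmod x = 1" "cmod X = 1" "x \<noteq> X"
  obtains K where "\<And>u. u \<in> strip \<Longrightarrow> cmod (strip_velocity x X u) \<le> K * inverse (1 + (Re u)\<^sup>2)"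
proof
  fix u assume u: "u \<in> strip"
  define A where "A = cmod (of_real (foot x X) + \<i>)"
  have A: "A \<ge> 1" using abs_Im_le_cmod[of "of_real (foot x X) + \<i>"] by (simp add: A_def)
  let ?w = "of_real (foot x X) + \<i> * exp u" and ?e = "exp (Re u)"
  have w1: "cmod (?w + \<i>) \<ge> 1"
    using abs_Im_le_cmod[of "?w + \<i>"] strip_Im_pos[OF u] by (simp add: Re_exp)
  have w2: "cmod (?w + \<i>) \<ge> ?e - A"
    using norm_diff_ineq[of "\<i> * exp u" "of_real (foot x X) + \<i>"]
    by (simp add: A_def norm_mult algebra_simps)
  have v: "cmod (strip_velocity x X u) = 2 * ?e / (cmod (?w + \<i>))\<^sup>2"
    unfolding strip_velocity_eq[OF assms u] using assms by (simp add: norm_mult norm_divide norm_power)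
  have pos: "cmod (strip_velocity x X u) \<le> 2 * ?e"
  proof -
    have "1 \<le> (cmod (?w + \<i>))\<^sup>2" using w1 by (simp add: one_le_power)
    then show ?thesis unfolding v using frac_le[of "2 * ?e" "2 * ?e" 1 "(cmod (?w + \<i>))\<^sup>2"] by simp
  qed
  have neg: "cmod (strip_velocity x X u) \<le> 8 * A\<^sup>2 / ?e"
  \<comment> \<open>Beyond \<open>2 * A\<close> the triangle inequality yields
    \<open>|w + i| >= exp (Re u) / 2\<close>; below it the exponential is bounded and the crude
    estimate suffices.\<close>
  proof (cases "?e \<ge> 2 * A")
    case True
    then have "(?e / 2)\<^sup>2 \<le> (cmod (?w + \<i>))\<^sup>2" using w2 by (intro power_mono) auto
    then have "cmod (strip_velocity x X u) \<le> 2 * ?e / (?e / 2)\<^sup>2"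
      unfolding v by (intro frac_le) auto
    also have "\<dots> = 8 / ?e" by (simp add: power2_eq_square)
    also have "\<dots> \<le> 8 * A\<^sup>2 / ?e" using A by (intro divide_right_mono) (auto simp: one_le_power)
    finally show ?thesis .
  next
    case False
    then have "?e * ?e \<le> (2 * A) * (2 * A)" using A by (intro mult_mono) auto
    then have "2 * ?e \<le> 8 * A\<^sup>2 / ?e" by (simp add: pos_le_divide_eq power2_eq_square)
    then show ?thesis using pos by simp
  qed
  have "cmod (strip_velocity x X u) \<le> 8 * A\<^sup>2 * exp (- \<bar>Re u\<bar>)"
  proof (cases "Re u \<ge> 0")
    case True
    then show ?thesis using neg by (simp add: exp_minus field_simps)
  next
    case False
    have "2 * ?e \<le> 8 * A\<^sup>2 * ?e"
      using one_le_power[OF A, of 2] by (intro mult_right_mono) auto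
    with pos have "cmod (strip_velocity x X u) \<le> 8 * A\<^sup>2 * ?e" by (rule order_trans)
    moreover have "- \<bar>Re u\<bar> = Re u" using False by simp
    ultimately show ?thesis by (simp only:)
  qed
  also have "\<dots> \<le> 8 * A\<^sup>2 * (2 * inverse (1 + (Re u)\<^sup>2))"
    by (intro mult_left_mono exp_neg_abs_le) auto
  finally show "cmod (strip_velocity x X u) \<le>
      (16 * (cmod (of_real (foot x X) + \<i>))\<^sup>2) * inverse (1 + (Re u)\<^sup>2)"
    by (simp add: A_def)
qed

section \<open>Integrals over the strip: Wallis, Cauchy and Fubini\<close>

lemma integrable_lorentz: "integrable lborel (\<lambda>s::real. inverse (1 + s\<^sup>2))"
  using integrable_inverse_1_plus_square by (simp add: set_integrable_def)

text \<open>The recursion comes from integrating the derivative of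
  \<open>sin v * cos v ^ (2 * m + 1)\<close>, a function that vanishes at both ends.\<close>

lemma wallis_cos_even:
  "((\<lambda>v. cos v ^ (2 * m)) has_integral pi * fact (2 * m) / (4 ^ m * (fact m)\<^sup>2)) {- (pi / 2)..pi / 2}"
proof (induction m)
  case 0
  show ?case using has_integral_const_real[of "1::real" "- (pi / 2)" "pi / 2"] by simp
next
  case (Suc m)
  let ?W = "\<lambda>m. pi * fact (2 * m) / (4 ^ m * (fact m)\<^sup>2) :: real"
  have "((\<lambda>v. cos v * cos v ^ (2 * m + 1) - sin v * (real (2 * m + 1) * cos v ^ (2 * m) * sin v)) has_integral
      sin (pi / 2) * cos (pi / 2) ^ (2 * m + 1) - sin (- (pi / 2)) * cos (- (pi / 2)) ^ (2 * m + 1)) {- (pi / 2)..pi / 2}"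
  proof (rule fundamental_theorem_of_calculus)
    fix v :: real
    have "((\<lambda>v. sin v * cos v ^ Suc (2 * m)) has_real_derivative
        cos v * cos v ^ Suc (2 * m) + (1 + real (2 * m)) * (- sin v * cos v ^ (2 * m)) * sin v) (at v)"
      by (rule DERIV_mult[OF DERIV_sin DERIV_power_Suc[OF DERIV_cos]])
    then have "((\<lambda>v. sin v * cos v ^ (2 * m + 1)) has_real_derivative
        cos v * cos v ^ (2 * m + 1) - sin v * (real (2 * m + 1) * cos v ^ (2 * m) * sin v)) (at v)"
      by (simp add: algebra_simps)
    then show "((\<lambda>v. sin v * cos v ^ (2 * m + 1)) has_vector_derivative
        cos v * cos v ^ (2 * m + 1) - sin v * (real (2 * m + 1) * cos v ^ (2 * m) * sin v)) (at v within {- (pi / 2)..pi / 2})"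
      by (simp add: has_real_derivative_iff_has_vector_derivative has_vector_derivative_at_within)
  qed simp
  moreover have "cos v * cos v ^ (2 * m + 1) - sin v * (real (2 * m + 1) * cos v ^ (2 * m) * sin v)
      = real (2 * m + 2) * cos v ^ (2 * Suc m) - real (2 * m + 1) * cos v ^ (2 * m)" for v :: real
  proof -
    have "sin v * (real (2 * m + 1) * cos v ^ (2 * m) * sin v) = real (2 * m + 1) * cos v ^ (2 * m) * (sin v)\<^sup>2"
      by (simp add: power2_eq_square)
    also have "(sin v)\<^sup>2 = 1 - (cos v)\<^sup>2" by (simp add: sin_squared_eq)
    finally show ?thesis by (simp add: algebra_simps power2_eq_square)
  qed
  ultimately have "((\<lambda>v. real (2 * m + 2) * cos v ^ (2 * Suc m) - real (2 * m + 1) * cos v ^ (2 * m)) has_integral 0)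
      {- (pi / 2)..pi / 2}"
    by simp
  from has_integral_add[OF this has_integral_mult_right[OF Suc, of "real (2 * m + 1)"]]
  have "((\<lambda>v. real (2 * m + 2) * cos v ^ (2 * Suc m)) has_integral real (2 * m + 1) * ?W m) {- (pi / 2)..pi / 2}"
    by simp
  from has_integral_mult_right[OF this, of "1 / real (2 * m + 2)"]
  have "((\<lambda>v. 1 / real (2 * m + 2) * (real (2 * m + 2) * cos v ^ (2 * Suc m))) has_integral
      1 / real (2 * m + 2) * (real (2 * m + 1) * ?W m)) {- (pi / 2)..pi / 2}" .
  moreover have "1 / real (2 * m + 2) * (real (2 * m + 2) * cos v ^ (2 * Suc m)) = cos v ^ (2 * Suc m)" for v :: real
    by (simp del: of_nat_add of_nat_mult of_nat_Suc)
  moreover have "1 / real (2 * m + 2) * (real (2 * m + 1) * ?W m) = ?W (Suc m)"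
  proof -
    have f: "fact (2 * Suc m) = (real (2 * m + 2) * real (2 * m + 1)) * fact (2 * m)"
      by (simp add: algebra_simps)
    have g: "4 ^ Suc m * (fact (Suc m))\<^sup>2 = (real (2 * m + 2))\<^sup>2 * (4 ^ m * (fact m)\<^sup>2)"
      by (simp add: power2_eq_square algebra_simps)
    have "1 / a * (b * (p * F / G)) = p * (a * b * F) / (a\<^sup>2 * G)" if "a \<noteq> 0" for a b p F G :: real
      using that by (simp add: power2_eq_square)
    from this[of "real (2 * m + 2)"] show ?thesis unfolding f g by simp
  qed
  ultimately show ?case by (simp only:)
qed

lemma truncated_integral_tendsto:
  fixes f :: "real \<Rightarrow> complex"
  assumes f: "integrable lborel f"
    and \<alpha>: "filterlim \<alpha> at_bot at_top" and \<beta>: "filterlim \<beta> at_top (at_top :: real filter)"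
  shows "((\<lambda>t. LBINT s=ereal (\<alpha> t)..ereal (\<beta> t). f s) \<longlongrightarrow> (\<integral>s. f s \<partial>lborel)) at_top"
proof (rule Lim_transform_eventually)
  have [measurable]: "f \<in> borel_measurable borel" using f by auto
  show "((\<lambda>t. \<integral>s. indicator {\<alpha> t<..<\<beta> t} s *\<^sub>R f s \<partial>lborel) \<longlongrightarrow> (\<integral>s. f s \<partial>lborel)) at_top"
  proof (rule integral_dominated_convergence_at_top[where w = "\<lambda>s. norm (f s)"])
    show "AE s in lborel. ((\<lambda>t. indicator {\<alpha> t<..<\<beta> t} s *\<^sub>R f s) \<longlongrightarrow> f s) at_top"
    proof (rule AE_I2, rule tendsto_eventually)
      fix s
      have "eventually (\<lambda>t. \<alpha> t < s) at_top" "eventually (\<lambda>t. s < \<beta> t) at_top"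
        using \<alpha> \<beta> by (auto simp: filterlim_at_bot_dense filterlim_at_top_dense)
      then show "eventually (\<lambda>t. indicator {\<alpha> t<..<\<beta> t} s *\<^sub>R f s = f s) at_top"
        by eventually_elim auto
    qed
    show "eventually (\<lambda>t. AE s in lborel. norm (indicator {\<alpha> t<..<\<beta> t} s *\<^sub>R f s) \<le> norm (f s)) at_top"
      by (auto simp: indicator_def)
  qed (use f in auto)
  have "eventually (\<lambda>t. \<alpha> t < 0) at_top" "eventually (\<lambda>t. 0 < \<beta> t) at_top"
    using \<alpha> \<beta> by (auto simp: filterlim_at_bot_dense filterlim_at_top_dense)
  then show "eventually (\<lambda>t. (\<integral>s. indicator {\<alpha> t<..<\<beta> t} s *\<^sub>R f s \<partial>lborel)
      = (LBINT s=ereal (\<alpha> t)..ereal (\<beta> t). f s)) at_top"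
    by eventually_elim (simp add: interval_lebesgue_integral_le_eq set_lebesgue_integral_def)
qed

text \<open>Here \<open>q\<close> itself is bounded, so the velocity factors supply decay. The
  invariant bound would make the coefficient merely bounded along a geodesic.\<close>

lemma strip_pullback_decay:
  assumes "cmod x = 1" "cmod X = 1" "x \<noteq> X"
    and B: "\<And>z. z \<in> hyp_plane \<Longrightarrow> cmod (q z) \<le> B" and "k \<ge> 1"
  obtains M where "M \<ge> 0"
    "\<And>u. u \<in> strip \<Longrightarrow> cmod (strip_pullback k q x X u) \<le> M * inverse (1 + (Re u)\<^sup>2)"
proof -
  obtain K where K: "\<And>u. u \<in> strip \<Longrightarrow> cmod (strip_velocity x X u) \<le> K * inverse (1 + (Re u)\<^sup>2)"
    using strip_velocity_decay[OF assms(1-3)] by blast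
  have "0 \<in> strip" by (simp add: strip_def)
  have K0: "K \<ge> 0" using order_trans[OF norm_ge_zero K[OF \<open>0 \<in> strip\<close>]] by simp
  have B0: "B \<ge> 0" using order_trans[OF norm_ge_zero B[of 0]] by (simp add: hyp_plane_def)
  show ?thesis
  proof (rule that[of "B * K ^ k"])
    show "0 \<le> B * K ^ k" using K0 B0 by simp
    fix u assume u: "u \<in> strip"
    let ?w = "inverse (1 + (Re u)\<^sup>2)"
    have w: "0 \<le> ?w" "?w \<le> 1" by (auto simp: inverse_le_1_iff)
    have "cmod (strip_pullback k q x X u) \<le> B * (K * ?w) ^ k"
      unfolding strip_pullback_def norm_mult norm_power
      by (intro mult_mono power_mono K B u strip_map_in_plane assms B0) auto
    also have "\<dots> = B * K ^ k * ?w ^ k" by (simp only: power_mult_distrib mult.assoc)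
    also have "?w ^ k \<le> ?w ^ 1" using w \<open>k \<ge> 1\<close> by (intro power_decreasing) auto
    then have "B * K ^ k * ?w ^ k \<le> B * K ^ k * ?w"
      using K0 B0 by (intro mult_left_mono) (simp_all only: power_one_right mult_nonneg_nonneg zero_le_power)
    finally show "cmod (strip_pullback k q x X u) \<le> B * K ^ k * ?w" .
  qed
qed

lemma complex_in_strip: "\<bar>v\<bar> < pi / 2 \<Longrightarrow> Complex s v \<in> strip"
  by (simp add: strip_def)

text \<open>By Cauchy's theorem all horizontal lines of the strip carry the same integral; in terms of a
  primitive, the contribution of the vertical segments vanishes at infinity.\<close>

lemma horizontal_line_integral:
  assumes hol: "f holomorphic_on strip"
    and M: "\<And>u. u \<in> strip \<Longrightarrow> cmod (f u) \<le> M * inverse (1 + (Re u)\<^sup>2)"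
    and v: "\<bar>v\<bar> < pi / 2"
  shows "integrable lborel (\<lambda>s. f (Complex s v))"
    and "(\<integral>s. f (Complex s v) \<partial>lborel) = (\<integral>s. f (of_real s) \<partial>lborel)"
proof -
  have cont: "continuous_on UNIV (\<lambda>s. f (Complex s v))" if "\<bar>v\<bar> < pi / 2" for v
  proof -
    have "continuous_on UNIV (\<lambda>s. Complex s v)"
      by (simp add: Complex_eq) (intro continuous_intros)
    then show ?thesis
      using that complex_in_strip
      by (intro continuous_on_compose2[OF holomorphic_on_imp_continuous_on[OF hol]]) auto
  qed
  have int: "integrable lborel (\<lambda>s. f (Complex s v))" if "\<bar>v\<bar> < pi / 2" for v
  proof (rule Bochner_Integration.integrable_bound)
    show "integrable lborel (\<lambda>s. M * inverse (1 + s\<^sup>2))"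
      using integrable_lorentz by simp
    show "(\<lambda>s. f (Complex s v)) \<in> borel_measurable lborel"
      using borel_measurable_continuous_onI[OF cont[OF that]] by simp
    show "AE s in lborel. norm (f (Complex s v)) \<le> norm (M * inverse (1 + s\<^sup>2))"
    proof (rule AE_I2)
      fix s
      show "norm (f (Complex s v)) \<le> norm (M * inverse (1 + s\<^sup>2))"
        using order_trans[OF M[OF complex_in_strip[OF that]] abs_ge_self, of s] by simp
    qed
  qed
  show "integrable lborel (\<lambda>s. f (Complex s v))" by (rule int[OF v])
  obtain F where F: "\<And>u. u \<in> strip \<Longrightarrow> (F has_field_derivative f u) (at u)"
    using holomorphic_convex_primitive'[OF convex_strip open_strip hol] at_within_open[OF _ open_strip]
    by metis
  have segment: "(LBINT s=ereal (- R)..ereal R. f (Complex s v)) = F (Complex R v) - F (Complex (- R) v)"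
    if v: "\<bar>v\<bar> < pi / 2" for v R
  proof (rule interval_integral_FTC_finite)
    show "continuous_on {min (- R) R..max (- R) R} (\<lambda>s. f (Complex s v))"
      using cont[OF v] by (rule continuous_on_subset) auto
    fix s
    have "((\<lambda>s. Complex s v) has_vector_derivative 1) (at s)"
      by (simp add: Complex_eq) (auto intro!: derivative_eq_intros)
    from field_vector_diff_chain_at[OF this F[OF complex_in_strip[OF v]]]
    show "((\<lambda>s. F (Complex s v)) has_vector_derivative f (Complex s v)) (at s within {min (- R) R..max (- R) R})"
      by (simp add: comp_def has_vector_derivative_at_within)
  qed
  have vertical: "cmod (F (Complex R v) - F (Complex R 0)) \<le> M * inverse (1 + R\<^sup>2) * \<bar>v\<bar>" for R
  proof -
    let ?S = "{u \<in> strip. Re u = R}"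
    have "?S = strip \<inter> {u. 1 \<bullet> u = R}" by (auto simp: inner_complex_def)
    then have "convex ?S" by (simp only: convex_Int convex_strip convex_hyperplane)
    moreover have "(F has_field_derivative f u) (at u within ?S)" if "u \<in> ?S" for u
      using F that by (auto intro: has_field_derivative_at_within)
    moreover have "cmod (f u) \<le> M * inverse (1 + R\<^sup>2)" if "u \<in> ?S" for u
      using M[of u] that by auto
    ultimately have "cmod (F (Complex R v) - F (Complex R 0)) \<le> M * inverse (1 + R\<^sup>2) * cmod (Complex R v - Complex R 0)"
      by (rule field_differentiable_bound) (use v in \<open>auto simp: strip_def\<close>)
    then show ?thesis by (simp add: cmod_def)
  qed
  let ?D = "\<lambda>R. (F (Complex R v) - F (Complex (- R) v)) - (F (Complex R 0) - F (Complex (- R) 0))"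
  have "(?D \<longlongrightarrow> 0) at_top"
  proof (rule Lim_null_comparison)
    show "eventually (\<lambda>R. cmod (?D R) \<le> 2 * (M * inverse (1 + R\<^sup>2) * \<bar>v\<bar>)) at_top"
    proof (rule always_eventually, rule allI)
      fix R
      have D: "?D R = (F (Complex R v) - F (Complex R 0)) - (F (Complex (- R) v) - F (Complex (- R) 0))"
        by simp
      show "cmod (?D R) \<le> 2 * (M * inverse (1 + R\<^sup>2) * \<bar>v\<bar>)"
        unfolding D
        using norm_triangle_ineq4[of "F (Complex R v) - F (Complex R 0)" "F (Complex (- R) v) - F (Complex (- R) 0)"]
          vertical[of R] vertical[of "- R", unfolded power2_minus] by linarith
    qed
    show "((\<lambda>R. 2 * (M * inverse (1 + R\<^sup>2) * \<bar>v\<bar>)) \<longlongrightarrow> 0) at_top" by real_asymp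
  qed
  moreover have "(?D \<longlongrightarrow> (\<integral>s. f (Complex s v) \<partial>lborel) - (\<integral>s. f (Complex s 0) \<partial>lborel)) at_top"
    unfolding segment[OF v, symmetric] segment[of 0, simplified, symmetric]
    by (intro tendsto_diff truncated_integral_tendsto int v filterlim_ident
        filterlim_uminus_at_bot_at_top) auto
  ultimately have "0 = (\<integral>s. f (Complex s v) \<partial>lborel) - (\<integral>s. f (Complex s 0) \<partial>lborel)"
    by (rule tendsto_unique[OF trivial_limit_at_top_linorder])
  then show "(\<integral>s. f (Complex s v) \<partial>lborel) = (\<integral>s. f (of_real s) \<partial>lborel)"
    by (simp add: complex_of_real_def)
qed

text \<open>The weight depends on \<open>Im u\<close> only and the integral over a horizontal line
  does not depend on its height, so the double integral factors. With \<open>|c| <= 1\<close>, the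
  finite width of the strip makes the decay bound an integrable majorant.\<close>

lemma strip_integral_Fubini:
  assumes hol: "f holomorphic_on strip"
    and M: "\<And>u. u \<in> strip \<Longrightarrow> cmod (f u) \<le> M * inverse (1 + (Re u)\<^sup>2)" "M \<ge> 0"
    and c: "continuous_on UNIV c" "\<And>v. \<bar>c v\<bar> \<le> 1"
  shows "set_integrable lborel strip (\<lambda>u. of_real (c (Im u)) * f u)"
    and "(LINT u:strip|lborel. of_real (c (Im u)) * f u) =
      of_real (LINT v:{- (pi / 2)<..<pi / 2}|lborel. c v) * (\<integral>s. f (of_real s) \<partial>lborel)"
proof -
  let ?I = "{- (pi / 2)<..<pi / 2}"
  let ?g = "\<lambda>u. indicator strip u *\<^sub>R (of_real (c (Im u)) * f u)"
  let ?h = "\<lambda>s v. ?g (Complex s v)"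
  let ?w = "\<lambda>(s, v). M * inverse (1 + s\<^sup>2) * indicator ?I v :: real"
  have strip_iff: "Complex s v \<in> strip \<longleftrightarrow> v \<in> ?I" for s v
    by (auto simp: strip_def abs_less_iff)
  have [measurable]: "(\<lambda>p. Complex (fst p) (snd p)) \<in> borel_measurable borel"
    by (intro borel_measurable_continuous_onI continuous_intros)
  have cont: "continuous_on strip (\<lambda>u. of_real (c (Im u)) * f u)"
    by (intro continuous_intros holomorphic_on_imp_continuous_on[OF hol]
        continuous_on_compose2[OF c(1)]) auto
  have g: "?g \<in> borel_measurable borel"
    using borel_measurable_continuous_on_indicator[OF _ cont] open_strip by auto
  have h: "(\<lambda>p. ?g (Complex (fst p) (snd p))) \<in> borel_measurable borel"
    using measurable_compose[OF _ g, of "\<lambda>p. Complex (fst p) (snd p)"] by simp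
  have w: "integrable (lborel \<Otimes>\<^sub>M lborel) ?w"
  proof (rule lborel_pair.Fubini_integrable)
    show "?w \<in> borel_measurable (lborel \<Otimes>\<^sub>M lborel)" by measurable
    have "(\<integral>v. norm (?w (s, v)) \<partial>lborel) = M * pi * inverse (1 + s\<^sup>2)" for s
      using M(2) by (simp add: abs_mult)
    then show "integrable lborel (\<lambda>s. \<integral>v. norm (?w (s, v)) \<partial>lborel)"
      using integrable_lorentz by simp
    show "AE s in lborel. integrable lborel (\<lambda>v. ?w (s, v))"
      by (intro AE_I2) simp
  qed
  have hint: "integrable (lborel \<Otimes>\<^sub>M lborel) (\<lambda>p. ?g (Complex (fst p) (snd p)))"
  proof (rule Bochner_Integration.integrable_bound[OF w])
    show "(\<lambda>p. ?g (Complex (fst p) (snd p))) \<in> borel_measurable (lborel \<Otimes>\<^sub>M lborel)"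
      using h by (simp add: lborel_prod)
    have "norm (?g (Complex s v)) \<le> norm (?w (s, v))" for s v
    proof (cases "v \<in> ?I")
      case True
      then have "cmod (of_real (c v) * f (Complex s v)) \<le> 1 * (M * inverse (1 + s\<^sup>2))"
        unfolding norm_mult using M(1)[of "Complex s v"] c(2)[of v] strip_iff
        by (intro mult_mono) auto
      also have "\<dots> = norm (?w (s, v))" using True M(2) by simp
      finally show ?thesis using True strip_iff by simp
    qed (simp add: strip_iff)
    then show "AE p in lborel \<Otimes>\<^sub>M lborel. norm (?g (Complex (fst p) (snd p))) \<le> norm (?w p)"
      by (intro AE_I2) (auto simp: case_prod_unfold simp del: real_norm_def)
  qed
  have distr: "distr (lborel \<Otimes>\<^sub>M lborel) borel (\<lambda>p. Complex (fst p) (snd p)) = lborel"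
    by (simp add: lborel_prod distr_Complex)
  have meas: "(\<lambda>p. Complex (fst p) (snd p)) \<in> measurable (lborel \<Otimes>\<^sub>M lborel) borel"
    by (simp add: lborel_prod)
  have "integrable (distr (lborel \<Otimes>\<^sub>M lborel) borel (\<lambda>p. Complex (fst p) (snd p))) ?g"
    using integrable_distr_eq[OF meas g] hint by simp
  then show "set_integrable lborel strip (\<lambda>u. of_real (c (Im u)) * f u)"
    unfolding distr set_integrable_def .
  have "(LINT u:strip|lborel. of_real (c (Im u)) * f u)
      = integral\<^sup>L (distr (lborel \<Otimes>\<^sub>M lborel) borel (\<lambda>p. Complex (fst p) (snd p))) ?g"
    unfolding distr set_lebesgue_integral_def ..
  also have "\<dots> = (\<integral>p. ?g (Complex (fst p) (snd p)) \<partial>(lborel \<Otimes>\<^sub>M lborel))"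
    by (rule integral_distr[OF meas g])
  also have "\<dots> = (\<integral>v. \<integral>s. ?g (Complex s v) \<partial>lborel \<partial>lborel)"
    using lborel_pair.integral_snd[of "\<lambda>s v. ?g (Complex s v)"] hint by (simp add: case_prod_unfold)
  also have "\<dots> = (\<integral>v. (indicator ?I v * complex_of_real (c v)) * (\<integral>s. f (of_real s) \<partial>lborel) \<partial>lborel)"
  proof (rule Bochner_Integration.integral_cong[OF refl])
    fix v
    show "(\<integral>s. ?g (Complex s v) \<partial>lborel) = (indicator ?I v * complex_of_real (c v)) * (\<integral>s. f (of_real s) \<partial>lborel)"
    proof (cases "v \<in> ?I")
      case True
      then have "(\<integral>s. ?g (Complex s v) \<partial>lborel) = of_real (c v) * (\<integral>s. f (Complex s v) \<partial>lborel)"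
        using strip_iff by simp
      also have "(\<integral>s. f (Complex s v) \<partial>lborel) = (\<integral>s. f (of_real s) \<partial>lborel)"
        using True by (intro horizontal_line_integral[OF hol M(1)]) (auto simp: abs_less_iff)
      finally show ?thesis using True by simp
    qed (simp add: strip_iff)
  qed
  also have "\<dots> = (\<integral>v. complex_of_real (indicator ?I v * c v) \<partial>lborel) * (\<integral>s. f (of_real s) \<partial>lborel)"
    by (simp add: of_real_indicator)
  also have "(\<integral>v. complex_of_real (indicator ?I v * c v) \<partial>lborel) = of_real (LINT v:?I|lborel. c v)"
    unfolding set_lebesgue_integral_def real_scaleR_def by (rule integral_complex_of_real)
  finally show "(LINT u:strip|lborel. of_real (c (Im u)) * f u) =
      of_real (LINT v:?I|lborel. c v) * (\<integral>s. f (of_real s) \<partial>lborel)" .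
qed

section \<open>The kernel of one geodesic in strip coordinates\<close>

definition kernel_term :: "nat \<Rightarrow> (complex \<Rightarrow> complex) \<Rightarrow> complex \<Rightarrow> complex \<Rightarrow> complex \<Rightarrow> complex" where
  "kernel_term k q x X z =
    (2 * hyp_h z) *\<^sub>R diff_inner k z (q z) (((X - x) / ((z - x) * (z - X))) ^ k)"

lemma one_minus_norm_pos: "z \<in> hyp_plane \<Longrightarrow> 1 - (cmod z)\<^sup>2 > 0"
  by (simp add: hyp_plane_def power_less_one_iff)

lemma hyp_h_pos: "z \<in> hyp_plane \<Longrightarrow> hyp_h z > 0"
  using one_minus_norm_pos[of z] by (simp add: hyp_h_def)

lemma continuous_hyp_h: "continuous_on hyp_plane hyp_h"
proof -
  have "(1 - (cmod z)\<^sup>2)\<^sup>2 \<noteq> 0" if "z \<in> hyp_plane" for z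
    using one_minus_norm_pos[OF that] by simp
  then show ?thesis
    unfolding hyp_h_def[abs_def] by (intro continuous_intros) auto
qed

lemma continuous_kernel_term:
  assumes "cmod x = 1" "cmod X = 1" "q holomorphic_on hyp_plane"
  shows "continuous_on hyp_plane (kernel_term k q x X)"
proof -
  have "z \<noteq> x" "z \<noteq> X" if "z \<in> hyp_plane" for z
    using that assms by (auto simp: hyp_plane_def)
  moreover have "hyp_h z \<noteq> 0" if "z \<in> hyp_plane" for z
    using hyp_h_pos[OF that] by simp
  ultimately show ?thesis
    unfolding kernel_term_def[abs_def] diff_inner_def
    by (intro continuous_intros continuous_hyp_h holomorphic_on_imp_continuous_on assms) auto
qed

text \<open>With \<open>c = cos (Im u)\<close> and \<open>n = |v|^2\<close> for the velocity
  \<open>v\<close>, the metric gives \<open>h = 1 / (2 c^2 n)\<close>. The Jacobian \<open>n\<close>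
  times \<open>2 h\<close> is \<open>1 / c^2\<close>, and \<open>h^(-k)\<close> is
  \<open>2^k c^(2k) n^k\<close>. The kernel is \<open>(- 1 / v)^k\<close>; its conjugate cancels one
  half of \<open>n^k = v^k (cnj v)^k\<close> and leaves \<open>v^k\<close> together with the
  sign.\<close>

lemma kernel_term_strip_map:
  assumes x: "cmod x = 1" "cmod X = 1" "x \<noteq> X" and u: "u \<in> strip" and "k \<ge> 1"
  shows "(cmod (strip_velocity x X u))\<^sup>2 *\<^sub>R kernel_term k q x X (strip_map x X u)
    = (- 2) ^ k * (of_real (cos (Im u) ^ (2 * (k - 1))) * strip_pullback k q x X u)"
proof -
  let ?z = "strip_map x X u" and ?v = "strip_velocity x X u"
  define c where "c = cos (Im u)"
  define n where "n = (cmod ?v)\<^sup>2"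
  have c: "c > 0" unfolding c_def using u by (intro cos_gt_zero_pi) (auto simp: strip_def)
  have v: "?v \<noteq> 0" by (rule strip_velocity_nz[OF x u])
  have n: "n > 0" using v by (simp add: n_def)
  have nv: "of_real n = ?v * cnj ?v" unfolding n_def by (rule complex_norm_square)
  have h: "hyp_h ?z = 1 / (2 * c\<^sup>2 * n)"
    unfolding hyp_h_def norm_strip_velocity[OF x u] c_def[symmetric] n_def
    by (simp add: power_mult_distrib)
  have \<phi>: "(X - x) / ((?z - x) * (?z - X)) = - (1 / ?v)"
    unfolding strip_velocity_def by simp
  obtain m where k: "k = Suc m" using \<open>k \<ge> 1\<close> by (cases k) auto
  have "cnj (((X - x) / ((?z - x) * (?z - X))) ^ k) = (- 1) ^ k / cnj ?v ^ k"
    unfolding \<phi> by (simp add: power_minus[of "1 / cnj ?v"] power_one_over divide_simps)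
  then have "n *\<^sub>R kernel_term k q x X ?z
      = of_real (n * (2 * (1 / (2 * c\<^sup>2 * n)))) * (q ?z * ((- 1) ^ k / cnj ?v ^ k) / of_real ((1 / (2 * c\<^sup>2 * n)) ^ k))"
    unfolding kernel_term_def diff_inner_def h by (simp add: scaleR_conv_of_real mult.assoc)
  also have "n * (2 * (1 / (2 * c\<^sup>2 * n))) = 1 / c\<^sup>2"
    using c n by (simp add: field_simps)
  also have "(1 / (2 * c\<^sup>2 * n)) ^ k = 1 / (2 ^ k * (c\<^sup>2) ^ k * n ^ k)"
    by (simp only: power_one_over power_mult_distrib)
  also have "of_real (1 / c\<^sup>2) * (q ?z * ((- 1) ^ k / cnj ?v ^ k) / of_real (1 / (2 ^ k * (c\<^sup>2) ^ k * n ^ k)))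
      = ((- 1) ^ k * 2 ^ k) * (of_real ((c\<^sup>2) ^ k / c\<^sup>2) * (q ?z * (of_real n ^ k / cnj ?v ^ k)))"
    by (simp add: field_simps)
  also have "of_real n ^ k / cnj ?v ^ k = ?v ^ k"
    unfolding nv using v by (simp add: power_mult_distrib)
  also have "(c\<^sup>2) ^ k / c\<^sup>2 = c ^ (2 * (k - 1))"
    using c by (simp add: k power_mult)
  also have "(- 1) ^ k * 2 ^ k = (- 2 :: complex) ^ k"
    by (simp flip: power_mult_distrib)
  finally show ?thesis
    by (simp only: n_def c_def strip_pullback_def)
qed

text \<open>For \<open>k >= 2\<close> the exponent \<open>k - 2\<close> is a genuine difference, so
  \<open>2^k * 2^(k-2)\<close> cancels the \<open>4^(k-1)\<close> of the Wallis integral.\<close>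

lemma r_const_wallis:
  assumes "k \<ge> 2"
  shows "r_const k * ((- 2) ^ k * (pi * fact (2 * (k - 1)) / (4 ^ (k - 1) * (fact (k - 1))\<^sup>2))) = 1"
proof -
  obtain m where k: "k = m + 2" using assms by (metis add.commute le_iff_add)
  have e: "2 * k - 2 = 2 * (k - 1)" by simp
  have "r_const k * ((- 2) ^ k * (pi * fact (2 * (k - 1)) / (4 ^ (k - 1) * (fact (k - 1))\<^sup>2)))
      = (- 1) ^ k * (- 2) ^ k * 2 ^ (k - 2) / 4 ^ (k - 1)"
    unfolding r_const_def e by (simp add: field_simps)
  also have "(- 1) ^ k * (- 2) ^ k = (2 :: real) ^ k"
    by (simp flip: power_mult_distrib)
  also have "(2 :: real) ^ k * 2 ^ (k - 2) = 4 ^ (k - 1)"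
    by (simp add: k power_mult_distrib[symmetric] mult.assoc flip: power_add)
  also have "4 ^ (k - 1) / 4 ^ (k - 1) = (1 :: real)" by simp
  finally show ?thesis .
qed

text \<open>For bounded \<open>q\<close> the integral along a single geodesic converges absolutely,
  so the horocycle offsets \<open>a\<close> and \<open>b\<close> disappear in the limit.\<close>

lemma kernel_term_integral:
  assumes x: "cmod x = 1" "cmod X = 1" "x \<noteq> X" and k: "k \<ge> 2"
    and hol: "q holomorphic_on hyp_plane" and B: "\<And>z. z \<in> hyp_plane \<Longrightarrow> cmod (q z) \<le> B"
  shows "set_integrable lborel hyp_plane (kernel_term k q x X)"
    and "((\<lambda>t. cutoff_integral k q x X (t - a) (t - b)) \<longlongrightarrow>
      of_real (r_const k) * (LINT z:hyp_plane|lborel. kernel_term k q x X z)) at_top"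
proof -
  let ?Q = "strip_pullback k q x X"
  have k1: "k \<ge> 1" using k by simp
  obtain M where M: "M \<ge> 0" "\<And>u. u \<in> strip \<Longrightarrow> cmod (?Q u) \<le> M * inverse (1 + (Re u)\<^sup>2)"
    by (rule strip_pullback_decay[OF x, of q B k]) (erule B, rule k1, blast)
  have Qhol: "?Q holomorphic_on strip" by (rule holomorphic_strip_pullback[OF x hol])
  let ?c = "\<lambda>v::real. cos v ^ (2 * (k - 1))"
  let ?G = "\<lambda>u. of_real (?c (Im u)) * ?Q u"
  have c: "continuous_on UNIV ?c" "\<And>v. \<bar>?c v\<bar> \<le> 1"
    by (auto intro!: continuous_intros simp: power_abs power_le_one)
  have Fub: "set_integrable lborel strip ?G"
    "(LINT u:strip|lborel. ?G u) =
      of_real (LINT v:{- (pi / 2)<..<pi / 2}|lborel. ?c v) * (\<integral>s. ?Q (of_real s) \<partial>lborel)"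
    by (rule strip_integral_Fubini[OF Qhol _ M(1) c], erule M(2))+
  have deriv: "deriv (strip_map x X) u = strip_velocity x X u" if "u \<in> strip" for u
    using strip_map_deriv[OF x that] by (rule DERIV_imp_deriv)
  have eq: "(cmod (deriv (strip_map x X) u))\<^sup>2 *\<^sub>R kernel_term k q x X (strip_map x X u) = (- 2) ^ k * ?G u"
    if "u \<in> strip" for u
    unfolding deriv[OF that] by (rule kernel_term_strip_map[OF x that k1])
  have image: "strip_map x X ` strip = hyp_plane" by (rule strip_map_image[OF x(2)])
  have cv: "continuous_on (strip_map x X ` strip) (kernel_term k q x X)"
    unfolding image by (rule continuous_kernel_term[OF x(1,2) hol])
  have "set_integrable lborel strip (\<lambda>u. (- 2) ^ k * ?G u)"
    using Fub(1) by simp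
  then have int: "set_integrable lborel strip
      (\<lambda>u. (cmod (deriv (strip_map x X) u))\<^sup>2 *\<^sub>R kernel_term k q x X (strip_map x X u))"
    by (rule set_integrable_cong[THEN iffD1, rotated -1]) (auto simp: eq)
  note CV = holomorphic_change_of_variables[OF open_strip holomorphic_strip_map[OF x]
      inj_on_strip_map[OF x(2)] cv int, unfolded image]
  show "set_integrable lborel hyp_plane (kernel_term k q x X)" by (rule CV(1))
  have "(LINT z:hyp_plane|lborel. kernel_term k q x X z) = (LINT u:strip|lborel. (- 2) ^ k * ?G u)"
    unfolding CV(2) using open_strip by (intro set_lebesgue_integral_cong) (auto simp: eq)
  also have "\<dots> = (- 2) ^ k * (LINT u:strip|lborel. ?G u)"
    by simp
  also have "(LINT u:strip|lborel. ?G u) =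
      of_real (LINT v:{- (pi / 2)<..<pi / 2}|lborel. ?c v) * (\<integral>s. ?Q (of_real s) \<partial>lborel)"
    by (rule Fub(2))
  also have "(LINT v:{- (pi / 2)<..<pi / 2}|lborel. ?c v)
      = pi * fact (2 * (k - 1)) / (4 ^ (k - 1) * (fact (k - 1))\<^sup>2)"
  proof -
    have i: "set_integrable lborel {- (pi / 2)..pi / 2} ?c"
      by (rule borel_integrable_atLeastAtMost') (intro continuous_intros)
    have "(LINT v:{- (pi / 2)<..<pi / 2}|lborel. ?c v) = (LINT v:{- (pi / 2)..pi / 2}|lborel. ?c v)"
      using interval_integral_Icc[of "- (pi / 2)" "pi / 2" ?c]
        interval_integral_Ioo[of "- (pi / 2)" "pi / 2" ?c] by simp
    also have "\<dots> = integral {- (pi / 2)..pi / 2} ?c"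
      by (rule set_borel_integral_eq_integral(2)[OF i])
    finally show ?thesis
      using wallis_cos_even[of "k - 1"] by (simp add: integral_unique)
  qed
  finally have "of_real (r_const k) * (LINT z:hyp_plane|lborel. kernel_term k q x X z)
      = of_real (r_const k * ((- 2) ^ k * (pi * fact (2 * (k - 1)) / (4 ^ (k - 1) * (fact (k - 1))\<^sup>2))))
        * (\<integral>s. ?Q (of_real s) \<partial>lborel)"
    by (simp only: of_real_mult of_real_power of_real_minus of_real_numeral mult.assoc)
  then have "of_real (r_const k) * (LINT z:hyp_plane|lborel. kernel_term k q x X z) = (\<integral>s. ?Q (of_real s) \<partial>lborel)"
    unfolding r_const_wallis[OF k] by simp
  moreover have "((\<lambda>t. cutoff_integral k q x X (t - a) (t - b)) \<longlongrightarrow> (\<integral>s. ?Q (of_real s) \<partial>lborel)) at_top"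
    unfolding cutoff_integral_def
  proof (rule truncated_integral_tendsto)
    show "integrable lborel (\<lambda>s. ?Q (of_real s))"
      using horizontal_line_integral(1)[OF Qhol, of M 0] M(2) by (simp add: complex_of_real_def)
  qed real_asymp+
  ultimately show "((\<lambda>t. cutoff_integral k q x X (t - a) (t - b)) \<longlongrightarrow>
      of_real (r_const k) * (LINT z:hyp_plane|lborel. kernel_term k q x X z)) at_top"
    by simp
qed

subsection \<open>Automorphic differentials are bounded in the hyperbolic norm\<close>

lemma one_minus_cnj_mult_nz:
  assumes "cmod a < 1" "cmod z < 1"
  shows "1 - cnj a * z \<noteq> 0"
proof -
  have "cmod (cnj a * z) < 1"
    using norm_mult_less[of "cnj a" 1 z 1] assms by simp
  then show ?thesis by auto
qed

lemma Moebius_function_has_derivative: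
  assumes "cmod a < 1" "cmod z < 1"
  shows "(Moebius_function 0 a has_field_derivative
    of_real (1 - (cmod a)\<^sup>2) / (1 - cnj a * z)\<^sup>2) (at z)"
proof -
  have nz: "1 - cnj a * z \<noteq> 0" by (rule one_minus_cnj_mult_nz[OF assms])
  have D: "((\<lambda>z. (z - a) / (1 - cnj a * z)) has_field_derivative
      ((1 - 0) * (1 - cnj a * z) - (z - a) * (0 - cnj a * 1)) / ((1 - cnj a * z) * (1 - cnj a * z))) (at z)"
    using nz by (intro derivative_intros) auto
  have "(1 - 0) * (1 - cnj a * z) - (z - a) * (0 - cnj a * 1) = 1 - a * cnj a"
    by (simp add: algebra_simps)
  also have "1 - a * cnj a = of_real (1 - (cmod a)\<^sup>2)"
    by (simp only: of_real_diff complex_norm_square of_real_1)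
  finally have E: "(1 - 0) * (1 - cnj a * z) - (z - a) * (0 - cnj a * 1) = of_real (1 - (cmod a)\<^sup>2)" .
  show ?thesis
    using D unfolding E Moebius_function_simple[abs_def] power2_eq_square[of "1 - cnj a * z"] .
qed

text \<open>The Schwarz lemma for \<open>g\<close> composed with disc automorphisms that move
  \<open>w\<close> and \<open>g w\<close> to the origin; the chain rule turns
  \<open>|f'(0)| <= 1\<close> into the claim.\<close>

lemma Schwarz_Pick_deriv:
  assumes hol: "g holomorphic_on ball 0 1" and maps: "g ` ball 0 1 \<subseteq> ball 0 1" and w: "cmod w < 1"
  shows "cmod (deriv g w) * (1 - (cmod w)\<^sup>2) \<le> 1 - (cmod (g w))\<^sup>2"
proof -
  define f where "f = Moebius_function 0 (g w) \<circ> g \<circ> Moebius_function 0 (- w)"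
  let ?a = "g w"
  have a: "cmod ?a < 1" using maps w by (auto simp: image_subset_iff)
  have mw: "cmod (Moebius_function 0 (- w) z) < 1" if "cmod z < 1" for z
    using Moebius_function_norm_lt_1[of "- w" z 0] w that by simp
  have M0: "Moebius_function 0 (- w) 0 = w" by (simp add: Moebius_function_of_zero)
  have "f holomorphic_on ball 0 1"
    unfolding f_def comp_assoc
    using Moebius_function_holomorphic[OF a] Moebius_function_holomorphic[of "- w"] w mw maps
    by (intro holomorphic_on_compose_gen[where t = "ball 0 1"]) (auto intro: hol)
  moreover have "f 0 = 0" by (simp add: f_def M0 Moebius_function_eq_zero)
  moreover have "cmod (f z) < 1" if "cmod z < 1" for z
    using Moebius_function_norm_lt_1[OF a, of "g (Moebius_function 0 (- w) z)" 0] mw[OF that] maps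
    by (auto simp: f_def image_subset_iff)
  ultimately have le: "cmod (deriv f 0) \<le> 1"
    using Schwarz_Lemma(2)[of f 0] by simp
  have 1: "(Moebius_function 0 (- w) has_field_derivative of_real (1 - (cmod w)\<^sup>2)) (at 0)"
    using Moebius_function_has_derivative[of "- w" 0] w by simp
  have 2: "(g has_field_derivative deriv g w) (at (Moebius_function 0 (- w) 0))"
    unfolding M0 using w by (intro holomorphic_derivI[OF hol]) auto
  have 3: "(Moebius_function 0 ?a has_field_derivative of_real (1 - (cmod ?a)\<^sup>2) / (1 - cnj ?a * ?a)\<^sup>2)
      (at (g (Moebius_function 0 (- w) 0)))"
    unfolding M0 by (rule Moebius_function_has_derivative[OF a a])
  have "(f has_field_derivative
      of_real (1 - (cmod ?a)\<^sup>2) / (1 - cnj ?a * ?a)\<^sup>2 * (deriv g w * of_real (1 - (cmod w)\<^sup>2))) (at 0)"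
    using DERIV_chain2[OF 3 DERIV_chain2[OF 2 1]] unfolding f_def comp_def .
  then have "deriv f 0 = of_real (1 - (cmod ?a)\<^sup>2) / (1 - cnj ?a * ?a)\<^sup>2 * (deriv g w * of_real (1 - (cmod w)\<^sup>2))"
    by (rule DERIV_imp_deriv)
  moreover have "1 - cnj ?a * ?a = of_real (1 - (cmod ?a)\<^sup>2)"
    by (simp only: of_real_diff complex_norm_square of_real_1 mult.commute[of "cnj ?a"])
  ultimately have d: "deriv f 0 = of_real (1 - (cmod ?a)\<^sup>2) / (of_real (1 - (cmod ?a)\<^sup>2))\<^sup>2
      * (deriv g w * of_real (1 - (cmod w)\<^sup>2))"
    by (simp only:)
  have pos: "1 - (cmod ?a)\<^sup>2 > 0" "1 - (cmod w)\<^sup>2 > 0"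
    using a w by (auto simp: power_less_one_iff)
  have "cmod (deriv f 0) = (1 - (cmod ?a)\<^sup>2) / (1 - (cmod ?a)\<^sup>2)\<^sup>2 * (cmod (deriv g w) * (1 - (cmod w)\<^sup>2))"
    unfolding d norm_mult norm_divide norm_power norm_of_real using pos by simp
  also have "\<dots> = cmod (deriv g w) * (1 - (cmod w)\<^sup>2) / (1 - (cmod ?a)\<^sup>2)"
    using pos(1) by (simp add: power2_eq_square)
  finally show ?thesis
    using le pos(1) by (simp add: pos_divide_le_eq)
qed

text \<open>The invariant norm is continuous, hence bounded on the compact set whose translates
  cover the disc, and automorphy carries the bound to every point.\<close>

lemma automorphic_differential_hyperbolic_bound:
  assumes \<Gamma>: "surface_fuchsian_group \<Gamma>" and q: "automorphic_differential \<Gamma> k q"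
  obtains C where "hyperbolic_bound k q C"
proof -
  have sub: "subgroup \<Gamma> (BijGroup hyp_plane)" and aut: "\<Gamma> \<subseteq> hyp_automorphisms"
    using \<Gamma> by (auto simp: surface_fuchsian_group_def fuchsian_group_def)
  obtain K where K: "compact K" "K \<subseteq> hyp_plane" "(\<Union>g\<in>\<Gamma>. g ` K) = hyp_plane"
    using \<Gamma> by (auto simp: surface_fuchsian_group_def cocompact_group_def)
  have hol: "q holomorphic_on hyp_plane"
    and auto: "\<And>g z. g \<in> \<Gamma> \<Longrightarrow> z \<in> hyp_plane \<Longrightarrow> q (g z) * deriv g z ^ k = q z"
    using q by (auto simp: automorphic_differential_def)
  let ?N = "\<lambda>z. cmod (q z) * (1 - (cmod z)\<^sup>2) ^ k"
  have "compact (?N ` K)"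
    by (intro compact_continuous_image K continuous_intros
        continuous_on_subset[OF holomorphic_on_imp_continuous_on[OF hol] K(2)])
  then obtain C where C: "\<And>w. w \<in> K \<Longrightarrow> ?N w \<le> C"
    using bounded_imp_bdd_above[OF compact_imp_bounded] by (force simp: bdd_above_def)
  have "?N z \<le> C" if z: "z \<in> hyp_plane" for z
  proof -
    obtain g w where g: "g \<in> \<Gamma>" "w \<in> K" "z = g w" using K(3) z by blast
    have Bij: "g \<in> Bij hyp_plane" using aut g by (auto simp: hyp_automorphisms_def)
    \<comment> \<open>The inverse moves \<open>z\<close> back into \<open>K\<close>; the
      Schwarz-Pick inequality for \<open>h\<close> then bounds the norm at \<open>z\<close> by the
      norm at \<open>w\<close>.\<close>
    define h where "h = inv\<^bsub>BijGroup hyp_plane\<^esub> g"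
    have h: "h \<in> \<Gamma>" unfolding h_def by (rule subgroup.m_inv_closed[OF sub g(1)])
    have hz: "h z = w"
      using z g K(2) Bij by (auto simp: h_def inv_BijGroup Bij_def bij_betw_def inv_into_f_f)
    have "h \<in> Bij hyp_plane" "h holomorphic_on hyp_plane"
      using aut h by (auto simp: hyp_automorphisms_def)
    then have le: "cmod (deriv h z) * (1 - (cmod z)\<^sup>2) \<le> 1 - (cmod w)\<^sup>2"
      using Schwarz_Pick_deriv[of h z] z hz by (auto simp: hyp_plane_def Bij_def bij_betw_def)
    have "?N z = cmod (q w) * (cmod (deriv h z) * (1 - (cmod z)\<^sup>2)) ^ k"
      using auto[OF h z] hz by (simp add: power_mult_distrib mult.assoc flip: norm_mult norm_power)
    also have "\<dots> \<le> ?N w"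
      using one_minus_norm_pos[OF z] by (intro mult_left_mono power_mono le mult_nonneg_nonneg) auto
    also have "\<dots> \<le> C" by (rule C[OF g(2)])
    finally show ?thesis .
  qed
  then show ?thesis by (intro that[of C]) (simp add: hyperbolic_bound_def)
qed

subsection \<open>Domination of the kernel\<close>

text \<open>The factor \<open>d\<close> plays the role of \<open>1 - |z|^2\<close> and compensates the poles of all but the
  lowest mixed term of the binomial expansion.\<close>

lemma binomial_mixed_terms_bound:
  "\<exists>c\<ge>0. \<forall>(a::complex) b d. 0 \<le> d \<longrightarrow> d * cmod a \<le> 2 \<longrightarrow> d * cmod b \<le> 2 \<longrightarrow>
     d ^ n * cmod ((a + b) ^ (n + 2) - a ^ (n + 2) - b ^ (n + 2)) \<le> c * cmod (a * b)"
proof (induction n)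
  case 0
  have "(a + b) ^ (0 + 2) - a ^ (0 + 2) - b ^ (0 + 2) = 2 * (a * b)" for a b :: complex
    by (simp add: power2_eq_square algebra_simps)
  then show ?case
    by (intro exI[of _ 2]) (simp only: norm_mult power_0, simp)
next
  case (Suc n)
  define R where "R n a b = (a + b) ^ (n + 2) - a ^ (n + 2) - b ^ (n + 2)" for n and a b :: complex
  obtain c where c: "c \<ge> 0" "\<And>a b d. 0 \<le> d \<Longrightarrow> d * cmod a \<le> 2 \<Longrightarrow> d * cmod b \<le> 2 \<Longrightarrow>
      d ^ n * cmod (R n a b) \<le> c * cmod (a * b)"
    using Suc unfolding R_def by blast
  have "d ^ Suc n * cmod (R (Suc n) a b) \<le> (4 * c + 2 * 2 ^ Suc n) * cmod (a * b)"
    if d: "0 \<le> d" "d * cmod a \<le> 2" "d * cmod b \<le> 2" for a b d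
  proof -
    \<comment> \<open>One factor \<open>a + b\<close> is split off. The new power of
      \<open>d\<close> tames it by \<open>d |a + b| <= 4\<close>, and \<open>d ^ Suc n\<close>
      bounds the last bracket by \<open>2 * 2 ^ Suc n\<close>; this is the origin of the
      constant.\<close>
    have R: "R (Suc n) a b = (a + b) * R n a b + (a * b) * (a ^ Suc n + b ^ Suc n)"
      by (simp add: R_def algebra_simps)
    have "d ^ Suc n * cmod (R (Suc n) a b)
        \<le> d ^ Suc n * (cmod (a + b) * cmod (R n a b) + cmod (a * b) * cmod (a ^ Suc n + b ^ Suc n))"
      unfolding R norm_mult[symmetric] by (intro mult_left_mono norm_triangle_ineq) (use d in auto)
    also have "\<dots> = (d * cmod (a + b)) * (d ^ n * cmod (R n a b)) + cmod (a * b) * (d ^ Suc n * cmod (a ^ Suc n + b ^ Suc n))"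
      by (simp add: algebra_simps)
    also have "\<dots> \<le> 4 * (c * cmod (a * b)) + cmod (a * b) * (2 * 2 ^ Suc n)"
    proof -
      have "d * cmod (a + b) \<le> d * (cmod a + cmod b)"
        using d by (intro mult_left_mono norm_triangle_ineq)
      then have 1: "d * cmod (a + b) \<le> 4" using d by (simp add: distrib_left)
      have "d ^ Suc n * cmod (a ^ Suc n + b ^ Suc n) \<le> d ^ Suc n * (cmod a ^ Suc n + cmod b ^ Suc n)"
        using d(1) norm_triangle_ineq[of "a ^ Suc n" "b ^ Suc n"]
        by (intro mult_left_mono) (auto simp only: norm_power zero_le_power)
      also have "\<dots> = (d * cmod a) ^ Suc n + (d * cmod b) ^ Suc n"
        by (simp only: power_mult_distrib distrib_left)
      also have "\<dots> \<le> 2 ^ Suc n + 2 ^ Suc n"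
        using d by (intro add_mono power_mono) auto
      finally have 2: "d ^ Suc n * cmod (a ^ Suc n + b ^ Suc n) \<le> 2 * 2 ^ Suc n" by simp
      show ?thesis
        using c(1) d(1) by (intro add_mono mult_mono[OF 1 c(2)[OF d]] mult_left_mono[OF 2]) auto
    qed
    finally show ?thesis by (simp add: algebra_simps)
  qed
  then show ?case
    using c(1) unfolding R_def by (intro exI[of _ "4 * c + 2 * 2 ^ Suc n"]) auto
qed

definition cross_kernel :: "nat \<Rightarrow> complex \<Rightarrow> complex \<Rightarrow> complex \<Rightarrow> complex \<Rightarrow> complex \<Rightarrow> complex" where
  "cross_kernel k x y X Y z =
     ((X - x) / ((z - x) * (z - X))) ^ k - ((X - y) / ((z - y) * (z - X))) ^ k -
     ((Y - x) / ((z - x) * (z - Y))) ^ k + ((Y - y) / ((z - y) * (z - Y))) ^ k"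

lemma one_minus_norm_le:
  assumes "z \<in> hyp_plane" "cmod c = 1"
  shows "(1 - (cmod z)\<^sup>2) * cmod (1 / (z - c)) \<le> 2"
proof -
  have z: "cmod z < 1" using assms by (simp add: hyp_plane_def)
  have "1 - (cmod z)\<^sup>2 = (1 + cmod z) * (1 - cmod z)" by (simp add: power2_eq_square algebra_simps)
  also have "\<dots> \<le> 2 * cmod (z - c)"
    using z norm_triangle_ineq2[of c z] assms by (intro mult_mono) (auto simp: norm_minus_commute)
  finally show ?thesis
    using z assms by (auto simp: norm_divide divide_simps)
qed

text \<open>By partial fractions each base is \<open>a + b\<close> with
  \<open>a = 1 / (z - W)\<close> and \<open>b = - 1 / (z - w)\<close>. After removal of the pure
  powers the mixed terms are controlled by \<open>a b\<close>, and
  \<open>a b = - (a + b) / (W - w)\<close> has only simple poles.\<close>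

lemma cross_kernel_bound:
  assumes circle: "cmod x = 1" "cmod y = 1" "cmod X = 1" "cmod Y = 1"
    and neq: "x \<noteq> X" "x \<noteq> Y" "y \<noteq> X" "y \<noteq> Y" and k: "k \<ge> 2"
  obtains K where "K \<ge> 0" "\<And>z. z \<in> hyp_plane \<Longrightarrow> (1 - (cmod z)\<^sup>2) ^ (k - 2) * cmod (cross_kernel k x y X Y z)
    \<le> K * (\<Sum>c\<in>{x, y, X, Y}. inverse (cmod (z - c)))"
proof -
  obtain n where n: "k = n + 2" using k by (metis add.commute le_iff_add)
  obtain C where C: "C \<ge> 0" "\<And>a b d. 0 \<le> d \<Longrightarrow> d * cmod a \<le> 2 \<Longrightarrow> d * cmod b \<le> 2 \<Longrightarrow>
      d ^ n * cmod ((a + b) ^ k - a ^ k - b ^ k) \<le> C * cmod (a * b)"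
    using binomial_mixed_terms_bound[of n] unfolding n by blast
  let ?T = "\<lambda>z w W. ((W - w) / ((z - w) * (z - W))) ^ k - (1 / (z - W)) ^ k - (- (1 / (z - w))) ^ k"
  define S where "S z = (\<Sum>c\<in>{x, y, X, Y}. inverse (cmod (z - c)))" for z
  have T: "(1 - (cmod z)\<^sup>2) ^ n * cmod (?T z w W) \<le> C / cmod (W - w) * (2 * S z)"
    if z: "z \<in> hyp_plane" and w: "w \<in> {x, y}" and W: "W \<in> {X, Y}" for z w W
  proof -
    have circ: "cmod w = 1" "cmod W = 1" and wW: "w \<noteq> W" using w W circle neq by auto
    have nz: "z \<noteq> w" "z \<noteq> W" using z circ by (auto simp: hyp_plane_def)
    let ?a = "1 / (z - W)" and ?b = "- (1 / (z - w))"
    have sum: "?a + ?b = (W - w) / ((z - w) * (z - W))" using nz by (simp add: field_simps)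
    have prod: "?a * ?b = - ((?a + ?b) / (W - w))" unfolding sum using wW by (simp add: mult.commute)
    have "(1 - (cmod z)\<^sup>2) ^ n * cmod (?T z w W) \<le> C * cmod (?a * ?b)"
      unfolding sum[symmetric] using one_minus_norm_pos[OF z] one_minus_norm_le[OF z] circ
      by (intro C(2)) (auto simp: norm_divide)
    also have "cmod (?a * ?b) = cmod (?a + ?b) / cmod (W - w)"
      unfolding prod by (simp only: norm_minus_cancel norm_divide)
    also have "cmod (?a + ?b) \<le> inverse (cmod (z - W)) + inverse (cmod (z - w))"
      using norm_triangle_ineq[of ?a ?b] by (simp only: norm_minus_cancel norm_divide norm_one inverse_eq_divide)
    also have "\<dots> \<le> 2 * S z"
    proof -
      have "inverse (cmod (z - W)) \<le> S z" "inverse (cmod (z - w)) \<le> S z"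
        unfolding S_def using w W by (intro member_le_sum; auto)+
      then show ?thesis by simp
    qed
    finally show ?thesis
      using C(1) by (simp add: divide_right_mono mult_left_mono)
  qed
  let ?K = "\<lambda>w W. C / cmod (W - w) * 2"
  show ?thesis
  proof (rule that[of "?K x X + ?K y X + ?K x Y + ?K y Y"])
    show "0 \<le> ?K x X + ?K y X + ?K x Y + ?K y Y" using C(1) by simp
    fix z assume z: "z \<in> hyp_plane"
    let ?d = "(1 - (cmod z)\<^sup>2) ^ n"
    have d: "?d \<ge> 0" using one_minus_norm_pos[OF z] by simp
    have triangle: "cmod (a - b - c + d) \<le> cmod a + cmod b + cmod c + cmod d" for a b c d
      using norm_triangle_ineq[of "a - b - c" d] norm_triangle_ineq4[of "a - b" c]
        norm_triangle_ineq4[of a b] by linarith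
    \<comment> \<open>The subtracted powers depend on \<open>w\<close> alone or on \<open>W\<close>
      alone, so the alternating signs cancel them.\<close>
    have "cross_kernel k x y X Y z = ?T z x X - ?T z y X - ?T z x Y + ?T z y Y"
      unfolding cross_kernel_def by (simp only: algebra_simps)
    then have "cmod (cross_kernel k x y X Y z)
        \<le> cmod (?T z x X) + cmod (?T z y X) + cmod (?T z x Y) + cmod (?T z y Y)"
      by (simp only: triangle)
    from mult_left_mono[OF this d]
    have "?d * cmod (cross_kernel k x y X Y z)
        \<le> ?d * cmod (?T z x X) + ?d * cmod (?T z y X) + ?d * cmod (?T z x Y) + ?d * cmod (?T z y Y)"
      by (simp only: distrib_left)
    also have "\<dots> \<le> ?K x X * S z + ?K y X * S z + ?K x Y * S z + ?K y Y * S z"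
      unfolding mult.assoc by (intro add_mono T z) auto
    finally show "(1 - (cmod z)\<^sup>2) ^ (k - 2) * cmod (cross_kernel k x y X Y z)
        \<le> (?K x X + ?K y X + ?K x Y + ?K y Y) * (\<Sum>c\<in>{x, y, X, Y}. inverse (cmod (z - c)))"
      unfolding S_def by (simp only: n distrib_right add_diff_cancel_right')
  qed
qed

section \<open>Integrability of simple poles on the boundary\<close>

lemma integrable_inverse_sqrt:
  "integrable lborel (\<lambda>a::real. indicator {0..2} a * a powr (- 1 / 2))"
proof -
  have "(\<lambda>a. a powr (- 1 / 2)) absolutely_integrable_on {0..2::real}"
    by (intro nonnegative_absolutely_integrable_1 integrable_on_powr_from_0) auto
  then have "integrable lebesgue (\<lambda>a::real. indicator {0..2} a * a powr (- 1 / 2))"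
    by (simp add: set_integrable_def)
  then show ?thesis
    by (subst (asm) integrable_completion) measurable
qed

text \<open>\<open>1 / |a + i b|\<close> is dominated by the product \<open>|a|^(-1/2) |b|^(-1/2)\<close>, off the axes.\<close>

lemma integrable_inverse_norm:
  "set_integrable lborel (ball 0 2) (\<lambda>z::complex. inverse (cmod z))"
proof -
  define g where "g a = indicator {0..2} a * a powr (- 1 / 2) + indicator {0..2} (- a) * (- a) powr (- 1 / 2)" for a :: real
  have g: "integrable lborel g"
    unfolding g_def using integrable_inverse_sqrt lborel_integrable_real_affine[OF integrable_inverse_sqrt, of "- 1" 0]
    by simp
  have g0: "g a \<ge> 0" for a by (simp add: g_def)
  have gabs: "g a = \<bar>a\<bar> powr (- 1 / 2)" if "a \<noteq> 0" "\<bar>a\<bar> \<le> 2" for a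
    using that by (auto simp: g_def indicator_def)
  let ?h = "\<lambda>z::complex. indicator (ball 0 2) z *\<^sub>R inverse (cmod z)"
  have w: "integrable (lborel \<Otimes>\<^sub>M lborel) (\<lambda>(a, b). g a * g b)"
  proof (rule lborel_pair.Fubini_integrable)
    have [measurable]: "g \<in> borel_measurable borel" using g by auto
    show "(\<lambda>(a, b). g a * g b) \<in> borel_measurable (lborel \<Otimes>\<^sub>M lborel)" by measurable
    show "integrable lborel (\<lambda>a. \<integral>b. norm (case (a, b) of (a, b) \<Rightarrow> g a * g b) \<partial>lborel)"
      using g g0 by (simp add: abs_mult)
    show "AE a in lborel. integrable lborel (\<lambda>b. case (a, b) of (a, b) \<Rightarrow> g a * g b)"
      using g by (intro AE_I2) simp
  qed
  have C: "(\<lambda>p. Complex (fst p) (snd p)) \<in> measurable (lborel \<Otimes>\<^sub>M lborel) borel"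
    by (simp add: lborel_prod) (intro borel_measurable_continuous_onI continuous_intros)
  have h: "?h \<in> borel_measurable borel"
    by (intro borel_measurable_scaleR borel_measurable_indicator borel_measurable_inverse
        borel_measurable_norm) auto
  have "integrable (lborel \<Otimes>\<^sub>M lborel) (\<lambda>p. ?h (Complex (fst p) (snd p)))"
  proof (rule Bochner_Integration.integrable_bound[OF w])
    show "(\<lambda>p. ?h (Complex (fst p) (snd p))) \<in> borel_measurable (lborel \<Otimes>\<^sub>M lborel)"
      using measurable_compose[OF C h] .
    have "AE a in lborel. AE b in lborel. a \<noteq> 0 \<and> b \<noteq> (0::real)"
      by (rule eventually_mono[OF AE_lborel_singleton], rule eventually_mono[OF AE_lborel_singleton]) auto
    then have ae: "AE a in lborel. AE b in lborel. fst (a, b) \<noteq> 0 \<and> snd (a, b) \<noteq> (0::real)"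
      by simp
    have "AE p in lborel \<Otimes>\<^sub>M lborel. fst p \<noteq> 0 \<and> snd p \<noteq> (0::real)"
      by (rule lborel_pair.AE_pair_measure[OF _ ae]) measurable
    then show "AE p in lborel \<Otimes>\<^sub>M lborel. norm (?h (Complex (fst p) (snd p))) \<le> norm (case p of (a, b) \<Rightarrow> g a * g b)"
    proof (rule eventually_mono)
      fix p :: "real \<times> real" assume p: "fst p \<noteq> 0 \<and> snd p \<noteq> 0"
      obtain a b where ab: "p = (a, b)" by (cases p)
      let ?z = "Complex a b"
      show "norm (?h (Complex (fst p) (snd p))) \<le> norm (case p of (a, b) \<Rightarrow> g a * g b)"
      proof (cases "?z \<in> ball 0 2")
        case True
        then have le: "\<bar>a\<bar> \<le> 2" "\<bar>b\<bar> \<le> 2"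
          using abs_Re_le_cmod[of ?z] abs_Im_le_cmod[of ?z] by auto
        have "\<bar>a\<bar> * \<bar>b\<bar> \<le> cmod ?z * cmod ?z"
          using abs_Re_le_cmod[of ?z] abs_Im_le_cmod[of ?z] by (intro mult_mono) auto
        then have sq: "sqrt (\<bar>a\<bar> * \<bar>b\<bar>) \<le> cmod ?z"
          by (intro real_le_lsqrt) (auto simp: power2_eq_square)
        have "g a * g b = \<bar>a\<bar> powr (- 1 / 2) * \<bar>b\<bar> powr (- 1 / 2)"
          using p le by (simp add: ab gabs)
        also have "\<dots> = inverse (sqrt (\<bar>a\<bar> * \<bar>b\<bar>))"
          by (simp add: powr_minus powr_half_sqrt real_sqrt_mult)
        also have "\<dots> \<ge> inverse (cmod ?z)"
          using p by (intro le_imp_inverse_le sq) (simp add: ab)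
        finally show ?thesis using True g0 by (simp add: ab)
      qed (use g0 in \<open>simp add: ab\<close>)
    qed
  qed
  then have "integrable (distr (lborel \<Otimes>\<^sub>M lborel) borel (\<lambda>p. Complex (fst p) (snd p))) ?h"
    using integrable_distr_eq[OF C h] by simp
  then show ?thesis
    by (simp add: lborel_prod distr_Complex set_integrable_def)
qed

text \<open>The disc lies in the ball of radius \<open>2\<close> about each of its boundary points,
  so a translation reduces the claim to a pole at the origin.\<close>

lemma integrable_inverse_norm_diff:
  assumes "cmod c = 1"
  shows "set_integrable lborel hyp_plane (\<lambda>z. inverse (cmod (z - c)))"
proof -
  let ?h = "\<lambda>z::complex. indicator (ball 0 2) z *\<^sub>R inverse (cmod z)"
  have h: "?h \<in> borel_measurable borel"
    by (intro borel_measurable_scaleR borel_measurable_indicator borel_measurable_inverse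
        borel_measurable_norm) auto
  have "integrable (distr lborel borel ((+) (- c))) ?h"
    using integrable_inverse_norm by (simp add: lborel_distr_plus set_integrable_def)
  then have "integrable lborel (\<lambda>z. ?h (- c + z))"
    by (subst (asm) integrable_distr_eq[OF _ h]) auto
  moreover have "?h (- c + z) = indicator (ball c 2) z *\<^sub>R inverse (cmod (z - c))" for z
    by (simp add: indicator_def dist_norm norm_minus_commute)
  ultimately have "set_integrable lborel (ball c 2) (\<lambda>z. inverse (cmod (z - c)))"
    unfolding set_integrable_def by (simp only:)
  moreover have "hyp_plane \<subseteq> ball c 2"
  proof
    fix z assume "z \<in> hyp_plane"
    then show "z \<in> ball c 2"
      using norm_triangle_ineq4[of c z] assms by (simp add: hyp_plane_def dist_norm)
  qed
  ultimately show ?thesis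
    by (elim set_integrable_subset) (simp_all add: hyp_plane_def)
qed

lemma hyp_area_integral:
  fixes f :: "complex \<Rightarrow> complex"
  assumes "continuous_on hyp_plane f"
  shows "integrable hyp_area f \<longleftrightarrow> set_integrable lborel hyp_plane (\<lambda>z. (2 * hyp_h z) *\<^sub>R f z)"
    and "integral\<^sup>L hyp_area f = (LINT z:hyp_plane|lborel. (2 * hyp_h z) *\<^sub>R f z)"
proof -
  have meas: "g \<in> borel_measurable (restrict_space lborel hyp_plane)"
    if "continuous_on hyp_plane g" for g :: "complex \<Rightarrow> 'b::{second_countable_topology, banach}"
    using borel_measurable_continuous_on_restrict[OF that]
    by (simp cong: measurable_cong_sets add: sets_restrict_space_cong[OF sets_lborel])
  have f: "f \<in> borel_measurable (restrict_space lborel hyp_plane)" by (rule meas[OF assms])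
  have h: "(\<lambda>z. 2 * hyp_h z) \<in> borel_measurable (restrict_space lborel hyp_plane)"
    by (intro meas continuous_intros continuous_hyp_h)
  have h0: "AE z in restrict_space lborel hyp_plane. 0 \<le> 2 * hyp_h z"
    by (intro AE_I2) (simp add: hyp_h_def)
  have S: "hyp_plane \<inter> space lborel \<in> sets lborel" by (simp add: hyp_plane_def)
  show "integrable hyp_area f \<longleftrightarrow> set_integrable lborel hyp_plane (\<lambda>z. (2 * hyp_h z) *\<^sub>R f z)"
    unfolding hyp_area_def integrable_density[OF f h h0] integrable_restrict_space[OF S] set_integrable_def ..
  show "integral\<^sup>L hyp_area f = (LINT z:hyp_plane|lborel. (2 * hyp_h z) *\<^sub>R f z)"
    unfolding hyp_area_def integral_density[OF f h h0] integral_restrict_space[OF S] set_lebesgue_integral_def ..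
qed

subsection \<open>Approximation by bounded differentials\<close>

definition rhombus_density ::
  "nat \<Rightarrow> (complex \<Rightarrow> complex) \<Rightarrow> complex \<Rightarrow> complex \<Rightarrow> complex \<Rightarrow> complex \<Rightarrow> complex \<Rightarrow> complex" where
  "rhombus_density k q x y X Y z =
     (2 * hyp_h z) *\<^sub>R diff_inner k z (q z) (cross_kernel k x y X Y z)"

lemma rhombus_density_eq_kernel_terms:
  "rhombus_density k q x y X Y z =
    kernel_term k q x X z - kernel_term k q y X z - kernel_term k q x Y z + kernel_term k q y Y z"
  unfolding rhombus_density_def kernel_term_def cross_kernel_def diff_inner_def
  by (simp add: algebra_simps diff_divide_distrib add_divide_distrib)

text \<open>With \<open>d = 1 - |z|^2\<close> the weight \<open>2 h h^(-k)\<close> equals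
  \<open>d^(2k-2) / 2^(k-2)\<close>. Of this, \<open>d^k\<close> is spent on \<open>q\<close> and
  \<open>d^(k-2)\<close> is left for the kernel.\<close>

lemma rhombus_density_bound:
  assumes q: "hyperbolic_bound k q C" and z: "z \<in> hyp_plane" and k: "k \<ge> 2"
  shows "cmod (rhombus_density k q x y X Y z) \<le> C * ((1 - (cmod z)\<^sup>2) ^ (k - 2) * cmod (cross_kernel k x y X Y z))"
proof -
  define d where "d = 1 - (cmod z)\<^sup>2"
  define A where "A = cmod (cross_kernel k x y X Y z)"
  have d: "d > 0" unfolding d_def by (rule one_minus_norm_pos[OF z])
  obtain n where n: "k = n + 2" using k by (metis add.commute le_iff_add)
  have h: "hyp_h z = 2 / d\<^sup>2" by (simp add: hyp_h_def d_def)
  have bound: "cmod (q z) * d ^ k \<le> C" using q z by (simp add: hyperbolic_bound_def d_def)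
  have "cmod (rhombus_density k q x y X Y z) = (2 * (2 / d\<^sup>2)) * (cmod (q z) * A / (2 / d\<^sup>2) ^ k)"
    unfolding rhombus_density_def diff_inner_def h A_def using d
    by (simp add: norm_mult norm_divide norm_power)
  also have "\<dots> = (cmod (q z) * d ^ k) * (d ^ n * A / 2 ^ n)"
  proof -
    have "(d\<^sup>2) ^ n = d ^ n * d ^ n"
      by (simp only: power2_eq_square power_mult_distrib)
    moreover have "(2 / D) ^ k = 4 * 2 ^ n / (E * E * (D * D))" if "D ^ n = E * E" for D E :: real
      by (simp add: n that power_divide power_add power2_eq_square)
    ultimately have 1: "(2 / d\<^sup>2) ^ k = 4 * 2 ^ n / (d ^ n * d ^ n * (d\<^sup>2 * d\<^sup>2))"
      by blast
    have 2: "d ^ k = d ^ n * d\<^sup>2" by (simp only: n power_add)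
    have 3: "2 * (2 / D) * (Q * A / (4 * T / (E * E * (D * D)))) = Q * (E * D) * (E * A / T)"
      if "D \<noteq> 0" "T \<noteq> 0" "E \<noteq> 0" for D Q E T :: real
      using that by simp
    show ?thesis unfolding 1 2 by (rule 3) (use d in auto)
  qed
  also have "\<dots> \<le> C * (d ^ n * A / 2 ^ n)"
    using d by (intro mult_right_mono bound) (auto simp: A_def)
  also have "\<dots> \<le> C * (d ^ n * A)"
  proof (intro mult_left_mono hyperbolic_bound_nonneg[OF q])
    have "d ^ n * A / 2 ^ n \<le> d ^ n * A / 1"
      using d by (intro divide_left_mono) (auto simp: A_def one_le_power)
    then show "d ^ n * A / 2 ^ n \<le> d ^ n * A" by simp
  qed
  finally show ?thesis by (simp add: n d_def A_def)
qed

lemma continuous_rhombus_density: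
  assumes circle: "cmod x = 1" "cmod y = 1" "cmod X = 1" "cmod Y = 1" and hol: "q holomorphic_on hyp_plane"
  shows "continuous_on hyp_plane (rhombus_density k q x y X Y)"
  unfolding rhombus_density_eq_kernel_terms[abs_def]
  by (intro continuous_intros continuous_kernel_term circle hol)

text \<open>The majorant \<open>D\<close> is chosen before \<open>q\<close>, so one integrable
  function dominates a whole family with common bound \<open>C\<close>.\<close>

lemma rhombus_density_dominated:
  assumes circle: "cmod x = 1" "cmod y = 1" "cmod X = 1" "cmod Y = 1"
    and neq: "x \<noteq> X" "x \<noteq> Y" "y \<noteq> X" "y \<noteq> Y" and k: "k \<ge> 2"
  obtains D where "set_integrable lborel hyp_plane D"
    "\<And>q C z. hyperbolic_bound k q C \<Longrightarrow> z \<in> hyp_plane \<Longrightarrow> cmod (rhombus_density k q x y X Y z) \<le> C * D z"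
proof -
  obtain K where K: "\<And>z. z \<in> hyp_plane \<Longrightarrow> (1 - (cmod z)\<^sup>2) ^ (k - 2) * cmod (cross_kernel k x y X Y z)
    \<le> K * (\<Sum>c\<in>{x, y, X, Y}. inverse (cmod (z - c)))"
    using cross_kernel_bound[OF circle neq k] by metis
  show ?thesis
  proof
    have "set_integrable lborel hyp_plane (\<lambda>z. \<Sum>c\<in>{x, y, X, Y}. inverse (cmod (z - c)))"
      unfolding set_integrable_def scaleR_sum_right
    proof (rule Bochner_Integration.integrable_sum)
      fix c assume "c \<in> {x, y, X, Y}"
      then have "cmod c = 1" using circle by auto
      then show "integrable lborel (\<lambda>z. indicator hyp_plane z *\<^sub>R inverse (cmod (z - c)))"
        using integrable_inverse_norm_diff unfolding set_integrable_def by blast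
    qed
    then show "set_integrable lborel hyp_plane (\<lambda>z. K * (\<Sum>c\<in>{x, y, X, Y}. inverse (cmod (z - c))))"
      by (rule set_integrable_mult_right)
    fix q C z assume q: "hyperbolic_bound k q C" and z: "z \<in> hyp_plane"
    have "cmod (rhombus_density k q x y X Y z) \<le> C * ((1 - (cmod z)\<^sup>2) ^ (k - 2) * cmod (cross_kernel k x y X Y z))"
      by (rule rhombus_density_bound[OF q z k])
    also have "\<dots> \<le> C * (K * (\<Sum>c\<in>{x, y, X, Y}. inverse (cmod (z - c))))"
      by (intro mult_left_mono K z hyperbolic_bound_nonneg[OF q])
    finally show "cmod (rhombus_density k q x y X Y z) \<le> C * (K * (\<Sum>c\<in>{x, y, X, Y}. inverse (cmod (z - c))))" .
  qed
qed

lemma rhombus_density_integrable: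
  assumes circle: "cmod x = 1" "cmod y = 1" "cmod X = 1" "cmod Y = 1"
    and neq: "x \<noteq> X" "x \<noteq> Y" "y \<noteq> X" "y \<noteq> Y" and k: "k \<ge> 2"
    and hol: "q holomorphic_on hyp_plane" and q: "hyperbolic_bound k q C"
  shows "set_integrable lborel hyp_plane (rhombus_density k q x y X Y)"
proof -
  obtain D where D: "set_integrable lborel hyp_plane D"
    "\<And>q C z. hyperbolic_bound k q C \<Longrightarrow> z \<in> hyp_plane \<Longrightarrow> cmod (rhombus_density k q x y X Y z) \<le> C * D z"
    using rhombus_density_dominated[OF circle neq k] by metis
  have "set_integrable lborel hyp_plane (\<lambda>z. C * D z)"
    using D(1) by (rule set_integrable_mult_right)
  then show ?thesis
  proof (rule set_integrable_bound)
    show "set_borel_measurable lborel hyp_plane (rhombus_density k q x y X Y)"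
      using borel_measurable_continuous_on_indicator[OF _ continuous_rhombus_density[OF circle hol]]
      by (simp add: set_borel_measurable_def hyp_plane_def)
    show "AE z in lborel. z \<in> hyp_plane \<longrightarrow> norm (rhombus_density k q x y X Y z) \<le> norm (C * D z)"
      using order_trans[OF D(2)[OF q] abs_ge_self] by (intro AE_I2) simp
  qed
qed

lemma strip_pullback_bound:
  assumes "cmod x = 1" "cmod X = 1" "x \<noteq> X" and q: "hyperbolic_bound k q C"
  shows "cmod (strip_pullback k q x X (of_real s)) \<le> C / 2 ^ k"
proof -
  let ?z = "strip_map x X (of_real s)"
  have "cmod (strip_velocity x X (of_real s)) = (1 - (cmod ?z)\<^sup>2) / 2"
    using norm_strip_velocity[OF assms(1-3) of_real_strip, of s] by simp
  then have "cmod (strip_pullback k q x X (of_real s)) = cmod (q ?z) * (1 - (cmod ?z)\<^sup>2) ^ k / 2 ^ k"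
    unfolding strip_pullback_def norm_mult norm_power by (simp only: power_divide times_divide_eq_right)
  also have "\<dots> \<le> C / 2 ^ k"
    using q strip_map_in_plane[OF assms(2) of_real_strip]
    by (intro divide_right_mono) (auto simp: hyperbolic_bound_def)
  finally show ?thesis .
qed

text \<open>At fixed horocycles the segment is finite, and the common hyperbolic bound gives a
  constant majorant on it.\<close>

lemma cutoff_integral_tendsto:
  assumes x: "cmod x = 1" "cmod X = 1" "x \<noteq> X"
    and hol: "\<And>n. qs n holomorphic_on hyp_plane" "q holomorphic_on hyp_plane"
    and bound: "\<And>n. hyperbolic_bound k (qs n) C"
    and lim: "\<And>z. z \<in> hyp_plane \<Longrightarrow> (\<lambda>n. qs n z) \<longlonglongrightarrow> q z"
  shows "(\<lambda>n. cutoff_integral k (qs n) x X a b) \<longlonglongrightarrow> cutoff_integral k q x X a b"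
proof -
  have meas: "(\<lambda>s. indicator {c<..<d} s *\<^sub>R strip_pullback k q x X (of_real s)) \<in> borel_measurable lborel"
    if "q holomorphic_on hyp_plane" for q and c d :: real
    using borel_measurable_continuous_on_indicator[OF _ continuous_strip_pullback_real[OF x that], of "{c<..<d}" k]
    by simp
  have "(\<lambda>n. LINT s:{c<..<d}|lborel. strip_pullback k (qs n) x X (of_real s))
      \<longlonglongrightarrow> (LINT s:{c<..<d}|lborel. strip_pullback k q x X (of_real s))" for c d :: real
    unfolding set_lebesgue_integral_def
  proof (rule integral_dominated_convergence[where w = "\<lambda>s. indicator {c<..<d} s * (C / 2 ^ k)"])
    show "AE s in lborel. (\<lambda>n. indicator {c<..<d} s *\<^sub>R strip_pullback k (qs n) x X (of_real s))
        \<longlonglongrightarrow> indicator {c<..<d} s *\<^sub>R strip_pullback k q x X (of_real s)"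
      unfolding strip_pullback_def using strip_map_in_plane[OF x(2) of_real_strip]
      by (intro AE_I2 tendsto_intros lim)
    show "AE s in lborel. norm (indicator {c<..<d} s *\<^sub>R strip_pullback k (qs n) x X (of_real s))
        \<le> indicator {c<..<d} s * (C / 2 ^ k)" for n
      using strip_pullback_bound[OF x bound] by (intro AE_I2) (simp add: indicator_def)
    show "integrable lborel (\<lambda>s. indicator {c<..<d} s * (C / 2 ^ k))" by (cases "c \<le> d") auto
  qed (rule meas, rule hol)+
  then show ?thesis
    unfolding cutoff_integral_def interval_lebesgue_integral_def
    by (auto intro!: tendsto_minus)
qed

lemma cutoff_rhombus_bounded_limit:
  assumes circle: "cmod x = 1" "cmod y = 1" "cmod X = 1" "cmod Y = 1"
    and neq: "x \<noteq> X" "x \<noteq> Y" "y \<noteq> X" "y \<noteq> Y" and k: "k \<ge> 2"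
    and hol: "q holomorphic_on hyp_plane" and B: "\<And>z. z \<in> hyp_plane \<Longrightarrow> cmod (q z) \<le> B"
  shows "(cutoff_rhombus k q x y X Y \<beta> \<longlongrightarrow>
    of_real (r_const k) * (LINT z:hyp_plane|lborel. rhombus_density k q x y X Y z)) at_top"
proof -
  have int: "set_integrable lborel hyp_plane (kernel_term k q w W)"
    and lim: "((\<lambda>t. cutoff_integral k q w W (t - a) (t - b)) \<longlongrightarrow>
      of_real (r_const k) * (LINT z:hyp_plane|lborel. kernel_term k q w W z)) at_top"
    if "w \<in> {x, y}" "W \<in> {X, Y}" for w W a b
    by (rule kernel_term_integral[OF _ _ _ k hol]; use that circle neq B in auto)+
  let ?J = "\<lambda>w W. LINT z:hyp_plane|lborel. kernel_term k q w W z"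
  have "(LINT z:hyp_plane|lborel. rhombus_density k q x y X Y z) = ?J x X - ?J y X - ?J x Y + ?J y Y"
    unfolding rhombus_density_eq_kernel_terms using int by (simp add: set_integral_diff set_integral_add)
  then have "of_real (r_const k) * (LINT z:hyp_plane|lborel. rhombus_density k q x y X Y z)
      = of_real (r_const k) * ?J x X - of_real (r_const k) * ?J y X
        - of_real (r_const k) * ?J x Y + of_real (r_const k) * ?J y Y"
    by (simp only: distrib_left right_diff_distrib)
  then show ?thesis
    unfolding cutoff_rhombus_def[abs_def] by (auto intro!: tendsto_intros lim)
qed

lemma dilation_in_plane:
  assumes "z \<in> hyp_plane" "0 \<le> r" "r \<le> 1"
  shows "of_real r * z \<in> hyp_plane" "cmod (of_real r * z) \<le> cmod z"
proof -
  show "cmod (of_real r * z) \<le> cmod z"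
    using assms by (simp add: norm_mult mult_left_le_one_le)
  then show "of_real r * z \<in> hyp_plane" using assms by (simp add: hyp_plane_def)
qed

text \<open>Moving towards the centre increases \<open>1 - |z|^2\<close>, so the weight at
  \<open>z\<close> is at most the weight at \<open>r z\<close>.\<close>

lemma hyperbolic_bound_dilation:
  assumes q: "hyperbolic_bound k q C" and r: "0 \<le> r" "r \<le> 1"
  shows "hyperbolic_bound k (\<lambda>z. q (of_real r * z)) C"
  unfolding hyperbolic_bound_def
proof
  fix z assume z: "z \<in> hyp_plane"
  let ?w = "of_real r * z"
  have "(cmod ?w)\<^sup>2 \<le> (cmod z)\<^sup>2"
    by (intro power_mono dilation_in_plane[OF z r]) simp
  then have "cmod (q ?w) * (1 - (cmod z)\<^sup>2) ^ k \<le> cmod (q ?w) * (1 - (cmod ?w)\<^sup>2) ^ k"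
    using one_minus_norm_pos[OF z] by (intro mult_left_mono power_mono) auto
  also have "\<dots> \<le> C"
    using q dilation_in_plane[OF z r] by (auto simp: hyperbolic_bound_def)
  finally show "cmod (q ?w) * (1 - (cmod z)\<^sup>2) ^ k \<le> C" .
qed

text \<open>The dilations \<open>q (r z)\<close>, \<open>r < 1\<close>, are bounded and obey the same hyperbolic bound, so that the
  estimate of the truncation error passes to the limit \<open>r \<rightarrow> 1\<close>.\<close>

lemma cutoff_rhombus_limit:
  assumes circle: "cmod x = 1" "cmod y = 1" "cmod X = 1" "cmod Y = 1"
    and neq: "x \<noteq> X" "x \<noteq> Y" "y \<noteq> X" "y \<noteq> Y" and k: "k \<ge> 2"
    and hol: "q holomorphic_on hyp_plane" and q: "hyperbolic_bound k q C"
  shows "(cutoff_rhombus k q x y X Y \<beta> \<longlongrightarrow>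
    of_real (r_const k) * (LINT z:hyp_plane|lborel. rhombus_density k q x y X Y z)) at_top"
proof -
  define r where "r n = 1 - inverse (real (Suc n))" for n
  define qs where "qs n z = q (of_real (r n) * z)" for n z
  let ?I = "\<lambda>q. of_real (r_const k) * (LINT z:hyp_plane|lborel. rhombus_density k q x y X Y z)"
  have r: "0 \<le> r n" "r n < 1" for n by (auto simp: r_def inverse_le_1_iff)
  have r1: "r \<longlonglongrightarrow> 1"
    unfolding r_def using tendsto_diff[OF tendsto_const LIMSEQ_inverse_real_of_nat, of 1] by simp
  have qs_bound: "hyperbolic_bound k (qs n) C" for n
    unfolding qs_def by (rule hyperbolic_bound_dilation[OF q]) (use r[of n] in auto)
  have qs_hol: "qs n holomorphic_on hyp_plane" for n
  proof -
    have "(q \<circ> (\<lambda>z. of_real (r n) * z)) holomorphic_on hyp_plane"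
      by (rule holomorphic_on_compose_gen[OF _ hol])
        (use r[of n] dilation_in_plane in \<open>auto intro!: holomorphic_intros\<close>)
    then show ?thesis by (simp add: qs_def[abs_def] comp_def)
  qed
  have qs_lim: "(\<lambda>n. qs n z) \<longlonglongrightarrow> q z" if z: "z \<in> hyp_plane" for z
  proof -
    have "(\<lambda>n. of_real (r n) * z) \<longlonglongrightarrow> of_real 1 * z" by (intro tendsto_intros r1)
    then have "(\<lambda>n. of_real (r n) * z) \<longlonglongrightarrow> z" by simp
    then show ?thesis
      unfolding qs_def using r dilation_in_plane[OF z] z
      by (intro continuous_on_tendsto_compose[OF holomorphic_on_imp_continuous_on[OF hol]])
        (auto intro!: always_eventually less_imp_le)
  qed
  have qs_bounded: "\<exists>B. \<forall>z\<in>hyp_plane. cmod (qs n z) \<le> B" for n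
  proof -
    have sub: "cball 0 (r n) \<subseteq> hyp_plane" using r[of n] by (auto simp: hyp_plane_def)
    have "bounded (q ` cball 0 (r n))"
      by (intro compact_imp_bounded compact_continuous_image compact_cball
          continuous_on_subset[OF holomorphic_on_imp_continuous_on[OF hol] sub])
    then obtain B where "\<And>w. w \<in> cball 0 (r n) \<Longrightarrow> cmod (q w) \<le> B"
      unfolding bounded_iff by blast
    moreover have "of_real (r n) * z \<in> cball 0 (r n)" if "z \<in> hyp_plane" for z
      using that r[of n] by (simp add: hyp_plane_def norm_mult mult_left_le)
    ultimately show ?thesis unfolding qs_def by blast
  qed
  obtain K where K: "\<And>k q C t t'. q holomorphic_on hyp_plane \<Longrightarrow> hyperbolic_bound k q C \<Longrightarrow> t \<le> t' \<Longrightarrow>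
    cmod (cutoff_rhombus k q x y X Y \<beta> t' - cutoff_rhombus k q x y X Y \<beta> t) \<le> C * K * exp (- t)"
    using cutoff_rhombus_Cauchy[OF circle neq, of \<beta>] by metis
  \<comment> \<open>For fixed \<open>n\<close> the later truncation is sent to infinity in the
    Cauchy estimate; its limit is known because \<open>qs n\<close> is bounded.\<close>
  have tail: "cmod (?I (qs n) - cutoff_rhombus k (qs n) x y X Y \<beta> t) \<le> C * K * exp (- t)" for n t
  proof (rule tendsto_upperbound)
    obtain B where "\<And>z. z \<in> hyp_plane \<Longrightarrow> cmod (qs n z) \<le> B" using qs_bounded[of n] by blast
    then show "((\<lambda>t'. cmod (cutoff_rhombus k (qs n) x y X Y \<beta> t' - cutoff_rhombus k (qs n) x y X Y \<beta> t))
        \<longlongrightarrow> cmod (?I (qs n) - cutoff_rhombus k (qs n) x y X Y \<beta> t)) at_top"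
      by (intro tendsto_intros cutoff_rhombus_bounded_limit[OF circle neq k qs_hol])
    show "eventually (\<lambda>t'. cmod (cutoff_rhombus k (qs n) x y X Y \<beta> t' - cutoff_rhombus k (qs n) x y X Y \<beta> t)
        \<le> C * K * exp (- t)) at_top"
      using eventually_ge_at_top[of t] by eventually_elim (rule K[OF qs_hol qs_bound])
  qed simp
  obtain D where D: "set_integrable lborel hyp_plane D"
    "\<And>q C z. hyperbolic_bound k q C \<Longrightarrow> z \<in> hyp_plane \<Longrightarrow> cmod (rhombus_density k q x y X Y z) \<le> C * D z"
    using rhombus_density_dominated[OF circle neq k] by metis
  have meas: "(\<lambda>z. indicator hyp_plane z *\<^sub>R rhombus_density k q x y X Y z) \<in> borel_measurable lborel"
    if "q holomorphic_on hyp_plane" for q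
    using borel_measurable_continuous_on_indicator[OF _ continuous_rhombus_density[OF circle that]]
    by (simp add: hyp_plane_def)
  have I_lim: "(\<lambda>n. ?I (qs n)) \<longlonglongrightarrow> ?I q"
    unfolding set_lebesgue_integral_def
  proof (intro tendsto_intros integral_dominated_convergence[where w = "\<lambda>z. C * (indicator hyp_plane z *\<^sub>R D z)"])
    show "integrable lborel (\<lambda>z. C * (indicator hyp_plane z *\<^sub>R D z))"
      using D(1) unfolding set_integrable_def by (rule integrable_mult_right)
    have "(\<lambda>n. rhombus_density k (qs n) x y X Y z) \<longlonglongrightarrow> rhombus_density k q x y X Y z"
      if z: "z \<in> hyp_plane" for z
      unfolding rhombus_density_def diff_inner_def using hyp_h_pos[OF z]
      by (intro tendsto_intros qs_lim z) simp
    then show "AE z in lborel. (\<lambda>n. indicator hyp_plane z *\<^sub>R rhombus_density k (qs n) x y X Y z)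
        \<longlonglongrightarrow> indicator hyp_plane z *\<^sub>R rhombus_density k q x y X Y z"
      by (intro AE_I2) (simp add: indicator_def)
    show "AE z in lborel. norm (indicator hyp_plane z *\<^sub>R rhombus_density k (qs n) x y X Y z)
        \<le> C * (indicator hyp_plane z *\<^sub>R D z)" for n
      using D(2)[OF qs_bound] by (intro AE_I2) (simp add: indicator_def)
  qed (rule meas, rule hol qs_hol)+
  have "(\<lambda>n. cutoff_rhombus k (qs n) x y X Y \<beta> t) \<longlonglongrightarrow> cutoff_rhombus k q x y X Y \<beta> t" for t
    unfolding cutoff_rhombus_def
    by (intro tendsto_intros cutoff_integral_tendsto[where C = C] circle neq qs_hol hol qs_bound qs_lim)
  \<comment> \<open>At fixed \<open>t\<close> both the area integral and the truncation are
    continuous along the dilations, and the error bound does not involve \<open>n\<close>.\<close>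
  then have error: "cmod (?I q - cutoff_rhombus k q x y X Y \<beta> t) \<le> C * K * exp (- t)" for t
    by (intro tendsto_upperbound[of "\<lambda>n. cmod (?I (qs n) - cutoff_rhombus k (qs n) x y X Y \<beta> t)" _ sequentially]
        tendsto_intros I_lim) (auto intro!: always_eventually tail)
  have "((\<lambda>t. cutoff_rhombus k q x y X Y \<beta> t - ?I q) \<longlongrightarrow> 0) at_top"
  proof (rule Lim_null_comparison)
    show "eventually (\<lambda>t. cmod (cutoff_rhombus k q x y X Y \<beta> t - ?I q) \<le> C * K * exp (- t)) at_top"
      using error by (intro always_eventually) (simp add: norm_minus_commute)
    show "((\<lambda>t. C * K * exp (- t)) \<longlongrightarrow> 0) at_top" by real_asymp
  qed
  then show ?thesis by (rule LIM_zero_cancel)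
qed

lemma has_rhombus_unique:
  assumes "rhombus_choice x y X Y b \<gamma> \<tau>" "has_rhombus x y X Y f L" "has_rhombus x y X Y f L'"
  shows "L = L'"
  using assms unfolding has_rhombus_def by (meson tendsto_unique trivial_limit_at_top_linorder)

theorem theorem7p2p2:
  fixes \<Gamma> :: "(complex \<Rightarrow> complex) set"
    and q :: "complex \<Rightarrow> complex"
    and k :: nat
    and x X :: "nat \<Rightarrow> complex"
  defines "integrand \<equiv> \<lambda>z. diff_inner k z (q z)
      (\<Sum>i\<in>{1, 2}. \<Sum>j\<in>{1, 2}. (-1) ^ (i + j) * ((X j - x i) / ((z - x i) * (z - X j))) ^ k)"
  assumes "surface_fuchsian_group \<Gamma>"
    and "k \<ge> 2"
    and "automorphic_differential \<Gamma> k q"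
    and "{x 1, x 2, X 1, X 2} \<subseteq> ideal_boundary"
    and "distinct [x 1, x 2, X 1, X 2]"
  shows "(\<exists>!L. has_rhombus (x 1) (x 2) (X 1) (X 2) (diff_hat k q) L) \<and>
    integrable hyp_area integrand \<and>
    Rh (x 1) (x 2) (X 1) (X 2) (diff_hat k q) =
      of_real (r_const k) * (\<integral>z. integrand z \<partial>hyp_area)"
proof -
  have circle: "cmod (x 1) = 1" "cmod (x 2) = 1" "cmod (X 1) = 1" "cmod (X 2) = 1"
    using assms(5) by (auto simp: ideal_boundary_def)
  have neq: "x 1 \<noteq> X 1" "x 1 \<noteq> X 2" "x 2 \<noteq> X 1" "x 2 \<noteq> X 2"
    using assms(6) by auto
  have hol: "q holomorphic_on hyp_plane" using assms(4) by (simp add: automorphic_differential_def)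
  obtain C where C: "hyperbolic_bound k q C"
    using automorphic_differential_hyperbolic_bound[OF assms(2,4)] by blast
  let ?\<kappa> = "cross_kernel k (x 1) (x 2) (X 1) (X 2)" and ?\<rho> = "rhombus_density k q (x 1) (x 2) (X 1) (X 2)"
  have integrand: "integrand z = diff_inner k z (q z) (?\<kappa> z)" for z
    unfolding integrand_def cross_kernel_def by (simp add: algebra_simps)
  have density: "(2 * hyp_h z) *\<^sub>R integrand z = ?\<rho> z" for z
    by (simp only: integrand rhombus_density_def)
  \<comment> \<open>Continuity of the integrand is inherited from the density, since
    \<open>hyp_h\<close> is continuous and positive on the disc.\<close>
  have "integrand z = (1 / (2 * hyp_h z)) *\<^sub>R ?\<rho> z" if "z \<in> hyp_plane" for z
    unfolding density[symmetric] using hyp_h_pos[OF that] by simp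
  moreover have "continuous_on hyp_plane (\<lambda>z. (1 / (2 * hyp_h z)) *\<^sub>R ?\<rho> z)"
    using hyp_h_pos by (intro continuous_intros continuous_hyp_h continuous_rhombus_density circle hol) force
  ultimately have cont: "continuous_on hyp_plane integrand"
    by (simp cong: continuous_on_cong)
  have int: "integrable hyp_area integrand"
    unfolding hyp_area_integral(1)[OF cont] density
    by (rule rhombus_density_integrable[OF circle neq assms(3) hol C])
  define L where "L = of_real (r_const k) * (\<integral>z. integrand z \<partial>hyp_area)"
  have L: "L = of_real (r_const k) * (LINT z:hyp_plane|lborel. ?\<rho> z)"
    unfolding L_def hyp_area_integral(2)[OF cont] density ..
  have has: "has_rhombus (x 1) (x 2) (X 1) (X 2) (diff_hat k q) L"
    unfolding has_rhombus_def
  proof (intro allI impI)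
    fix b \<gamma> \<tau> assume "rhombus_choice (x 1) (x 2) (X 1) (X 2) b \<gamma> \<tau>"
    then obtain \<beta> where \<beta>: "\<And>k q t. truncated_rhombus (x 1) (x 2) (X 1) (X 2) (diff_hat k q) \<gamma> \<tau> t
        = cutoff_rhombus k q (x 1) (x 2) (X 1) (X 2) \<beta> t"
      using truncated_rhombus_eq_cutoff[OF _ circle neq] by metis
    show "(truncated_rhombus (x 1) (x 2) (X 1) (X 2) (diff_hat k q) \<gamma> \<tau> \<longlongrightarrow> L) at_top"
      using cutoff_rhombus_limit[OF circle neq assms(3) hol C, of \<beta>]
      unfolding L \<beta>[abs_def] .
  qed
  obtain b \<gamma> \<tau> where "rhombus_choice (x 1) (x 2) (X 1) (X 2) b \<gamma> \<tau>"
    using rhombus_choice_exists[OF circle neq] by blast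
  then have unique: "L' = L" if "has_rhombus (x 1) (x 2) (X 1) (X 2) (diff_hat k q) L'" for L'
    using has that has_rhombus_unique by blast
  then have "Rh (x 1) (x 2) (X 1) (X 2) (diff_hat k q) = L"
    unfolding Rh_def using has by (intro the_equality)
  then show ?thesis
    using int has unique unfolding L_def by blast
qed

end
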